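(* Let $f : X \to Y$ be an affine morphism of schemes. Then $\mathrm{Spec}_Y f_*\mathcal{O}_X$ is naturally isomorphic to $X$ in $\mathbf{LRS}/Y$, where $\mathrm{Spec}_Y$ is the relative spectrum defined by localization of primed ringed spaces.
   Context: Rings are commutative with $1$. $\mathbf{RS}$ is the category of ringed spaces; $\mathbf{LRS}$ is the category of locally ringed spaces, with morphisms the $\mathbf{RS}$ morphisms whose stalks are local. For a morphism $f$ of ringed spaces, $f_x : \mathcal{O}_{Y,f(x)} \to \mathcal{O}_{X,x}$ denotes its stalk. Primed ringed spaces. A prime system $M$ on a ringed space $X$ is an assignment, to each $x \in X$, of a subset $M_x \subseteq \mathrm{Spec}\, \mathcal{O}_{X,x}$. A primed ringed space $(X,M)$, or $(X,\mathcal{O}_X,M)$, is a ringed space with a prime system. A morphism $f : (X,M) \to (Y,N)$ in the category $\mathbf{PRS}$ is a morphism of ringed spaces such that $f_x^{-1}(z) \in N_{f(x)}$ for all $x \in X$, $z \in M_x$. For a locally ringed space $X$, the local prime system is $\mathcal{M}_{X,x} := \{\mathfrak{m}_x\}$. Localization. For $(X,M) \in \mathbf{PRS}$, the locally ringed space $X^{\mathrm{loc}} = (X,M)^{\mathrm{loc}}$ has points $\{(x,z) : x \in X,\ z \in M_x\}$. For $U \subseteq X$ open and $s \in \mathcal{O}_X(U)$ put $\mathrm{U}(U,s) := \{(x,z) : x \in U,\ s_x \notin z\}$; these sets form a basis for the topology. For $V \subseteq X^{\mathrm{loc}}$ open, $\mathcal{O}_{X^{\mathrm{loc}}}(V)$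 is the ring of those $s = (s(x,z)) \in \prod_{(x,z) \in V} (\mathcal{O}_{X,x})_z$ such that for every $(x,z) \in V$ there are a basic open neighborhood $\mathrm{U}(U,t) \subseteq V$ of $(x,z)$ and $a/t^n \in \mathcal{O}_X(U)_t$ with $s(x',z') = a_{x'}/t_{x'}^n$ in $(\mathcal{O}_{X,x'})_{z'}$ for all $(x',z') \in \mathrm{U}(U,t)$. The map $\pi : X^{\mathrm{loc}} \to X$, $(x,z) \mapsto x$, with sheaf map $s \mapsto ((s_x)_z)_{(x,z)}$, is a morphism of ringed spaces. A $\mathbf{PRS}$ morphism $f : (X,M) \to (Y,N)$ induces a unique $\mathbf{LRS}$ morphism $\overline{f} : (X,M)^{\mathrm{loc}} \to (Y,N)^{\mathrm{loc}}$ with $\pi\overline{f} = f\pi$ in $\mathbf{RS}$, and for $Y \in \mathbf{LRS}$, $\pi : (Y,\mathcal{M}_Y)^{\mathrm{loc}} \to Y$ is an isomorphism. Relative spectrum. For $Y \in \mathbf{LRS}$ and an $\mathcal{O}_Y$-algebra $g : \mathcal{O}_Y \to A$ (a map of sheaves of rings), view $g$ as a morphism of ringed spaces $(Y,A) \to (Y,\mathcal{O}_Y)$ and let $g^*\mathcal{M}_Y$ be the prime system on $(Y,A)$ given by $(g^*\mathcal{M}_Y)_y = \{\mathfrak{p} \in \mathrm{Spec}\,A_y : g_y^{-1}(\mathfrak{p}) = \mathfrak{m}_y\}$. Then $\mathrm{Spec}_Y A := (Y,A,g^*\mathcal{M}_Y)^{\mathrm{loc}}$, with structure map $\overline{g}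 : \mathrm{Spec}_Y A \to (Y,\mathcal{O}_Y,\mathcal{M}_Y)^{\mathrm{loc}} = Y$ in $\mathbf{LRS}$. In the claim, $f_*\mathcal{O}_X$ is an $\mathcal{O}_Y$-algebra via the map $f^\flat : \mathcal{O}_Y \to f_*\mathcal{O}_X$ given by $f$. *)

theory Defs
  imports "HOL-Analysis.Abstract_Topology" "HOL-Algebra.Ideal"
begin

section \<open>Rings: spectrum, local rings, localization\<close>

definition prime_spectrum :: "'r ring \<Rightarrow> 'r set set" where
  "prime_spectrum R = {p. primeideal p R}"

definition local_ring :: "'r ring \<Rightarrow> bool" where
  "local_ring R \<longleftrightarrow> cring R \<and> (\<exists>!m. maximalideal m R)"

definition max_ideal :: "'r ring \<Rightarrow> 'r set" where
  "max_ideal R = (THE m. maximalideal m R)"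

definition contraction :: "'r ring \<Rightarrow> ('r \<Rightarrow> 's) \<Rightarrow> 's set \<Rightarrow> 'r set" where
  "contraction R h p = {r \<in> carrier R. h r \<in> p}"

definition local_hom :: "'r ring \<Rightarrow> 's ring \<Rightarrow> ('r \<Rightarrow> 's) \<Rightarrow> bool" where
  "local_hom R S h \<longleftrightarrow>
     local_ring R \<and> local_ring S \<and> h \<in> ring_hom R S \<and>
     contraction R h (max_ideal S) = max_ideal R"

text \<open>
  The fraction \<open>a / b\<close> of the localization of \<open>R\<close> at a prime \<open>p\<close>, as an equivalence class of pairs.
\<close>

definition fraction :: "'r ring \<Rightarrow> 'r set \<Rightarrow> 'r \<Rightarrow> 'r \<Rightarrow> ('r \<times> 'r) set" where
  "fraction R p a b =
     {(a', b'). a' \<in> carrier R \<and> b' \<in> carrier R - p \<and>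
        (\<exists>u \<in> carrier R - p. u \<otimes>\<^bsub>R\<^esub> (a \<otimes>\<^bsub>R\<^esub> b') = u \<otimes>\<^bsub>R\<^esub> (a' \<otimes>\<^bsub>R\<^esub> b))}"

text \<open>
  Operations on equivalence classes are unions over representatives: all the classes
  in such a union coincide.
\<close>

definition localize_at :: "'r ring \<Rightarrow> 'r set \<Rightarrow> ('r \<times> 'r) set ring" where
  "localize_at R p =
     \<lparr>carrier = {fraction R p a b | a b. a \<in> carrier R \<and> b \<in> carrier R - p},
      monoid.mult = (\<lambda>\<alpha> \<beta>. \<Union>(a, b)\<in>\<alpha>. \<Union>(c, d)\<in>\<beta>. fraction R p (a \<otimes>\<^bsub>R\<^esub> c) (b \<otimes>\<^bsub>R\<^esub> d)),
      one = fraction R p \<one>\<^bsub>R\<^esub> \<one>\<^bsub>R\<^esub>,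
      zero = fraction R p \<zero>\<^bsub>R\<^esub> \<one>\<^bsub>R\<^esub>,
      add = (\<lambda>\<alpha> \<beta>. \<Union>(a, b)\<in>\<alpha>. \<Union>(c, d)\<in>\<beta>.
               fraction R p ((a \<otimes>\<^bsub>R\<^esub> d) \<oplus>\<^bsub>R\<^esub> (c \<otimes>\<^bsub>R\<^esub> b)) (b \<otimes>\<^bsub>R\<^esub> d))\<rparr>"

text \<open>
  The map \<open>a / b \<mapsto> h a / h b\<close> into the localization of \<open>S\<close> at \<open>q\<close>, defined on the localization of
  the source of \<open>h\<close> at the contraction of \<open>q\<close>.
\<close>

definition localize_hom :: "'s ring \<Rightarrow> 's set \<Rightarrow> ('r \<Rightarrow> 's) \<Rightarrow> ('r \<times> 'r) set \<Rightarrow> ('s \<times> 's) set" where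
  "localize_hom S q h \<alpha> = (\<Union>(a, b)\<in>\<alpha>. fraction S q (h a) (h b))"

definition function_ring :: "'i set \<Rightarrow> ('i \<Rightarrow> 'r ring) \<Rightarrow> ('i \<Rightarrow> 'r) set \<Rightarrow> ('i \<Rightarrow> 'r) ring" where
  "function_ring I R F =
     \<lparr>carrier = F,
      monoid.mult = (\<lambda>s t. \<lambda>i\<in>I. s i \<otimes>\<^bsub>R i\<^esub> t i),
      one = (\<lambda>i\<in>I. \<one>\<^bsub>R i\<^esub>),
      zero = (\<lambda>i\<in>I. \<zero>\<^bsub>R i\<^esub>),
      add = (\<lambda>s t. \<lambda>i\<in>I. s i \<oplus>\<^bsub>R i\<^esub> t i)\<rparr>"


section \<open>Ringed spaces\<close>

text \<open>
  Only the values of \<open>sec\<close> and \<open>res\<close> on open sets, and of \<open>res\<close> on sections, are meaningful.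
\<close>

record ('a, 'b) rspace =
  top_sp :: "'a topology"
  sec :: "'a set \<Rightarrow> 'b ring"
  res :: "'a set \<Rightarrow> 'a set \<Rightarrow> 'b \<Rightarrow> 'b"

abbreviation points :: "('a, 'b) rspace \<Rightarrow> 'a set" where
  "points X \<equiv> topspace (top_sp X)"

abbreviation open_in :: "('a, 'b) rspace \<Rightarrow> 'a set \<Rightarrow> bool" where
  "open_in X U \<equiv> openin (top_sp X) U"

definition presheaf_of_rings :: "('a, 'b) rspace \<Rightarrow> bool" where
  "presheaf_of_rings X \<longleftrightarrow>
     (\<forall>U. open_in X U \<longrightarrow> cring (sec X U)) \<and>
     (\<forall>U V. open_in X U \<and> open_in X V \<and> V \<subseteq> U \<longrightarrow> res X U V \<in> ring_hom (sec X U) (sec X V)) \<and>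
     (\<forall>U. open_in X U \<longrightarrow> (\<forall>s \<in> carrier (sec X U). res X U U s = s)) \<and>
     (\<forall>U V W. open_in X U \<and> open_in X V \<and> open_in X W \<and> W \<subseteq> V \<and> V \<subseteq> U \<longrightarrow>
        (\<forall>s \<in> carrier (sec X U). res X V W (res X U V s) = res X U W s))"

definition ringed_space :: "('a, 'b) rspace \<Rightarrow> bool" where
  "ringed_space X \<longleftrightarrow> presheaf_of_rings X \<and>
     (\<forall>\<U>. (\<forall>U\<in>\<U>. open_in X U) \<longrightarrow>
        (\<forall>s \<in> carrier (sec X (\<Union>\<U>)). \<forall>t \<in> carrier (sec X (\<Union>\<U>)).
           (\<forall>U\<in>\<U>. res X (\<Union>\<U>) U s = res X (\<Union>\<U>) U t) \<longrightarrow> s = t)) \<and>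
     (\<forall>\<U> s. (\<forall>U\<in>\<U>. open_in X U \<and> s U \<in> carrier (sec X U)) \<and>
        (\<forall>U\<in>\<U>. \<forall>V\<in>\<U>. res X U (U \<inter> V) (s U) = res X V (U \<inter> V) (s V)) \<longrightarrow>
        (\<exists>t \<in> carrier (sec X (\<Union>\<U>)). \<forall>U\<in>\<U>. res X (\<Union>\<U>) U t = s U))"

definition germ :: "('a, 'b) rspace \<Rightarrow> 'a \<Rightarrow> 'a set \<Rightarrow> 'b \<Rightarrow> ('a set \<times> 'b) set" where
  "germ X x U s =
     {(V, t). open_in X V \<and> x \<in> V \<and> t \<in> carrier (sec X V) \<and>
        (\<exists>W. open_in X W \<and> x \<in> W \<and> W \<subseteq> U \<inter> V \<and> res X U W s = res X V W t)}"

definition stalk :: "('a, 'b) rspace \<Rightarrow> 'a \<Rightarrow> ('a set \<times> 'b) set ring" where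
  "stalk X x =
     \<lparr>carrier = {germ X x U s | U s. open_in X U \<and> x \<in> U \<and> s \<in> carrier (sec X U)},
      monoid.mult = (\<lambda>\<alpha> \<beta>. \<Union>(U, s)\<in>\<alpha>. \<Union>(V, t)\<in>\<beta>.
        germ X x (U \<inter> V) (res X U (U \<inter> V) s \<otimes>\<^bsub>sec X (U \<inter> V)\<^esub> res X V (U \<inter> V) t)),
      one = germ X x (points X) \<one>\<^bsub>sec X (points X)\<^esub>,
      zero = germ X x (points X) \<zero>\<^bsub>sec X (points X)\<^esub>,
      add = (\<lambda>\<alpha> \<beta>. \<Union>(U, s)\<in>\<alpha>. \<Union>(V, t)\<in>\<beta>.
        germ X x (U \<inter> V) (res X U (U \<inter> V) s \<oplus>\<^bsub>sec X (U \<inter> V)\<^esub> res X V (U \<inter> V) t))\<rparr>"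

definition open_subspace :: "('a, 'b) rspace \<Rightarrow> 'a set \<Rightarrow> ('a, 'b) rspace" where
  "open_subspace X U = \<lparr>top_sp = subtopology (top_sp X) U, sec = sec X, res = res X\<rparr>"


section \<open>Morphisms of ringed spaces\<close>

text \<open>
  For \<open>f : X \<rightarrow> Y\<close>, \<open>shm f V\<close> maps sections of \<open>Y\<close> over \<open>V\<close> to sections of \<open>X\<close> over the preimage
  of \<open>V\<close>. A raw map also carries irrelevant values (at non-points, non-open sets, non-sections),
  so equality of morphisms is the relation \<open>rs_eq\<close> below rather than HOL equality.
\<close>

record ('a, 'b, 'c, 'd) rs_map =
  pt :: "'a \<Rightarrow> 'c"
  shm :: "'c set \<Rightarrow> 'd \<Rightarrow> 'b"

definition preim :: "('a, 'b) rspace \<Rightarrow> ('a, 'b, 'c, 'd) rs_map \<Rightarrow> 'c set \<Rightarrow> 'a set" where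
  "preim X f V = {x \<in> points X. pt f x \<in> V}"

definition rs_morphism ::
    "('a, 'b) rspace \<Rightarrow> ('c, 'd) rspace \<Rightarrow> ('a, 'b, 'c, 'd) rs_map \<Rightarrow> bool" where
  "rs_morphism X Y f \<longleftrightarrow>
     ringed_space X \<and> ringed_space Y \<and>
     continuous_map (top_sp X) (top_sp Y) (pt f) \<and>
     (\<forall>V. open_in Y V \<longrightarrow> shm f V \<in> ring_hom (sec Y V) (sec X (preim X f V))) \<and>
     (\<forall>V W. open_in Y V \<and> open_in Y W \<and> W \<subseteq> V \<longrightarrow>
        (\<forall>s \<in> carrier (sec Y V).
           shm f W (res Y V W s) = res X (preim X f V) (preim X f W) (shm f V s)))"

definition rs_eq ::
    "('a, 'b) rspace \<Rightarrow> ('c, 'd) rspace \<Rightarrow>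
     ('a, 'b, 'c, 'd) rs_map \<Rightarrow> ('a, 'b, 'c, 'd) rs_map \<Rightarrow> bool" where
  "rs_eq X Y f g \<longleftrightarrow>
     (\<forall>x \<in> points X. pt f x = pt g x) \<and>
     (\<forall>V. open_in Y V \<longrightarrow> (\<forall>s \<in> carrier (sec Y V). shm f V s = shm g V s))"

definition rs_id :: "('a, 'b, 'a, 'b) rs_map" where
  "rs_id = \<lparr>pt = (\<lambda>x. x), shm = (\<lambda>V s. s)\<rparr>"

text \<open>
  \<open>rs_comp Y g f\<close> is the composite of \<open>f : X \<rightarrow> Y\<close> and \<open>g : Y \<rightarrow> Z\<close>; the middle space \<open>Y\<close> is
  needed to form preimages under \<open>g\<close>.
\<close>

definition rs_comp ::
    "('c, 'd) rspace \<Rightarrow> ('c, 'd, 'e, 'g) rs_map \<Rightarrow> ('a, 'b, 'c, 'd) rs_map \<Rightarrow>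
     ('a, 'b, 'e, 'g) rs_map" where
  "rs_comp Y g f =
     \<lparr>pt = (\<lambda>x. pt g (pt f x)), shm = (\<lambda>W s. shm f (preim Y g W) (shm g W s))\<rparr>"

definition stalk_map ::
    "('a, 'b) rspace \<Rightarrow> ('a, 'b, 'c, 'd) rs_map \<Rightarrow> 'a \<Rightarrow> ('c set \<times> 'd) set \<Rightarrow> ('a set \<times> 'b) set" where
  "stalk_map X f x \<alpha> = (\<Union>(V, s)\<in>\<alpha>. germ X x (preim X f V) (shm f V s))"


section \<open>Locally ringed spaces\<close>

definition locally_ringed_space :: "('a, 'b) rspace \<Rightarrow> bool" where
  "locally_ringed_space X \<longleftrightarrow> ringed_space X \<and> (\<forall>x \<in> points X. local_ring (stalk X x))"

definition lrs_morphism ::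
    "('a, 'b) rspace \<Rightarrow> ('c, 'd) rspace \<Rightarrow> ('a, 'b, 'c, 'd) rs_map \<Rightarrow> bool" where
  "lrs_morphism X Y f \<longleftrightarrow>
     locally_ringed_space X \<and> locally_ringed_space Y \<and> rs_morphism X Y f \<and>
     (\<forall>x \<in> points X. local_hom (stalk Y (pt f x)) (stalk X x) (stalk_map X f x))"

definition inverse_rs_maps ::
    "('a, 'b) rspace \<Rightarrow> ('c, 'd) rspace \<Rightarrow>
     ('a, 'b, 'c, 'd) rs_map \<Rightarrow> ('c, 'd, 'a, 'b) rs_map \<Rightarrow> bool" where
  "inverse_rs_maps X Y f g \<longleftrightarrow>
     rs_eq X X (rs_comp Y g f) rs_id \<and> rs_eq Y Y (rs_comp X f g) rs_id"

definition lrs_iso ::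
    "('a, 'b) rspace \<Rightarrow> ('c, 'd) rspace \<Rightarrow> ('a, 'b, 'c, 'd) rs_map \<Rightarrow> bool" where
  "lrs_iso X Y f \<longleftrightarrow>
     lrs_morphism X Y f \<and> (\<exists>g. lrs_morphism Y X g \<and> inverse_rs_maps X Y f g)"

text \<open>Inverse morphisms are unique up to \<open>rs_eq\<close>, so the choice below is immaterial.\<close>

definition lrs_inverse ::
    "('a, 'b) rspace \<Rightarrow> ('c, 'd) rspace \<Rightarrow>
     ('a, 'b, 'c, 'd) rs_map \<Rightarrow> ('c, 'd, 'a, 'b) rs_map" where
  "lrs_inverse X Y f = (SOME g. lrs_morphism Y X g \<and> inverse_rs_maps X Y f g)"

text \<open>Morphisms and isomorphisms from \<open>(X, p)\<close> to \<open>(Z, q)\<close> in the slice category over \<open>Y\<close>.\<close>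

definition lrs_over_morphism ::
    "('c, 'd) rspace \<Rightarrow> ('a, 'b) rspace \<Rightarrow> ('a, 'b, 'c, 'd) rs_map \<Rightarrow>
     ('e, 'g) rspace \<Rightarrow> ('e, 'g, 'c, 'd) rs_map \<Rightarrow> ('a, 'b, 'e, 'g) rs_map \<Rightarrow> bool" where
  "lrs_over_morphism Y X p Z q \<phi> \<longleftrightarrow>
     lrs_morphism X Y p \<and> lrs_morphism Z Y q \<and> lrs_morphism X Z \<phi> \<and>
     rs_eq X Y (rs_comp Z q \<phi>) p"

definition lrs_over_iso ::
    "('c, 'd) rspace \<Rightarrow> ('a, 'b) rspace \<Rightarrow> ('a, 'b, 'c, 'd) rs_map \<Rightarrow>
     ('e, 'g) rspace \<Rightarrow> ('e, 'g, 'c, 'd) rs_map \<Rightarrow> ('a, 'b, 'e, 'g) rs_map \<Rightarrow> bool" where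
  "lrs_over_iso Y X p Z q \<phi> \<longleftrightarrow>
     lrs_over_morphism Y X p Z q \<phi> \<and>
     (\<exists>\<psi>. lrs_over_morphism Y Z q X p \<psi> \<and> inverse_rs_maps X Z \<phi> \<psi>)"


section \<open>Schemes and affine morphisms\<close>

definition spec_sections :: "'r ring \<Rightarrow> 'r set set \<Rightarrow> ('r set \<Rightarrow> ('r \<times> 'r) set) set" where
  "spec_sections R V =
     {s \<in> (\<Pi>\<^sub>E p\<in>V. carrier (localize_at R p)).
        \<forall>p\<in>V. \<exists>a \<in> carrier R. \<exists>b \<in> carrier R.
          p \<in> {q \<in> prime_spectrum R. b \<notin> q} \<and> {q \<in> prime_spectrum R. b \<notin> q} \<subseteq> V \<and>
          (\<forall>q \<in> {q \<in> prime_spectrum R. b \<notin> q}. s q = fraction R q a b)}"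

definition Spec :: "'r ring \<Rightarrow> ('r set, 'r set \<Rightarrow> ('r \<times> 'r) set) rspace" where
  "Spec R =
     \<lparr>top_sp = topology_generated_by {{p \<in> prime_spectrum R. b \<notin> p} | b. b \<in> carrier R},
      sec = (\<lambda>V. function_ring V (localize_at R) (spec_sections R V)),
      res = (\<lambda>V W s. restrict s W)\<rparr>"

text \<open>
  The ring \<open>R\<close> ranges over rings on the type of sections of \<open>X\<close>. This loses nothing: if \<open>X\<close> is
  isomorphic to \<open>Spec R\<close>, then \<open>R\<close> is isomorphic to the ring of global sections of \<open>X\<close>.
\<close>

definition affine_scheme :: "('a, 'b) rspace \<Rightarrow> bool" where
  "affine_scheme X \<longleftrightarrow> (\<exists>(R :: 'b ring) \<phi>. cring R \<and> lrs_iso X (Spec R) \<phi>)"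

definition affine_open :: "('a, 'b) rspace \<Rightarrow> 'a set \<Rightarrow> bool" where
  "affine_open X U \<longleftrightarrow> open_in X U \<and> affine_scheme (open_subspace X U)"

definition scheme :: "('a, 'b) rspace \<Rightarrow> bool" where
  "scheme X \<longleftrightarrow> locally_ringed_space X \<and> (\<forall>x \<in> points X. \<exists>U. x \<in> U \<and> affine_open X U)"

definition affine_morphism ::
    "('a, 'b) rspace \<Rightarrow> ('c, 'd) rspace \<Rightarrow> ('a, 'b, 'c, 'd) rs_map \<Rightarrow> bool" where
  "affine_morphism X Y f \<longleftrightarrow>
     lrs_morphism X Y f \<and>
     (\<exists>\<V>. \<Union>\<V> = points Y \<and> (\<forall>V\<in>\<V>. affine_open Y V \<and> affine_open X (preim X f V)))"


section \<open>Primed ringed spaces and their localization\<close>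

type_synonym ('a, 'b) prime_sys = "'a \<Rightarrow> ('a set \<times> 'b) set set set"

definition prime_system :: "('a, 'b) rspace \<Rightarrow> ('a, 'b) prime_sys \<Rightarrow> bool" where
  "prime_system X M \<longleftrightarrow> (\<forall>x \<in> points X. M x \<subseteq> prime_spectrum (stalk X x))"

definition prs_morphism ::
    "('a, 'b) rspace \<Rightarrow> ('a, 'b) prime_sys \<Rightarrow> ('c, 'd) rspace \<Rightarrow> ('c, 'd) prime_sys \<Rightarrow>
     ('a, 'b, 'c, 'd) rs_map \<Rightarrow> bool" where
  "prs_morphism X M Y N f \<longleftrightarrow>
     prime_system X M \<and> prime_system Y N \<and> rs_morphism X Y f \<and>
     (\<forall>x \<in> points X. \<forall>z \<in> M x. contraction (stalk Y (pt f x)) (stalk_map X f x) z \<in> N (pt f x))"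

definition local_prime_system :: "('a, 'b) rspace \<Rightarrow> ('a, 'b) prime_sys" where
  "local_prime_system X x = {max_ideal (stalk X x)}"

text \<open>The prime system \<open>g\<^sup>*M\<close> for \<open>g : X \<rightarrow> Y\<close> and a prime system \<open>M\<close> on \<open>Y\<close>.\<close>

definition pullback_prime_system ::
    "('a, 'b) rspace \<Rightarrow> ('c, 'd) rspace \<Rightarrow> ('a, 'b, 'c, 'd) rs_map \<Rightarrow>
     ('c, 'd) prime_sys \<Rightarrow> ('a, 'b) prime_sys" where
  "pullback_prime_system X Y g M x =
     {p \<in> prime_spectrum (stalk X x).
        contraction (stalk Y (pt g x)) (stalk_map X g x) p \<in> M (pt g x)}"

type_synonym ('a, 'b) loc_pt = "'a \<times> ('a set \<times> 'b) set set"
type_synonym ('a, 'b) loc_val = "(('a set \<times> 'b) set \<times> ('a set \<times> 'b) set) set"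
type_synonym ('a, 'b) loc_sec = "('a, 'b) loc_pt \<Rightarrow> ('a, 'b) loc_val"

definition loc_basic ::
    "('a, 'b) rspace \<Rightarrow> ('a, 'b) prime_sys \<Rightarrow> 'a set \<Rightarrow> 'b \<Rightarrow> ('a, 'b) loc_pt set" where
  "loc_basic X M U s = {(x, z). x \<in> U \<and> z \<in> M x \<and> germ X x U s \<notin> z}"

definition loc_ring_at :: "('a, 'b) rspace \<Rightarrow> ('a, 'b) loc_pt \<Rightarrow> ('a, 'b) loc_val ring" where
  "loc_ring_at X = (\<lambda>(x, z). localize_at (stalk X x) z)"

definition loc_sections ::
    "('a, 'b) rspace \<Rightarrow> ('a, 'b) prime_sys \<Rightarrow> ('a, 'b) loc_pt set \<Rightarrow> ('a, 'b) loc_sec set" where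
  "loc_sections X M V =
     {s \<in> (\<Pi>\<^sub>E w\<in>V. carrier (loc_ring_at X w)).
        \<forall>w\<in>V. \<exists>U t a (n::nat).
          open_in X U \<and> t \<in> carrier (sec X U) \<and> a \<in> carrier (sec X U) \<and>
          w \<in> loc_basic X M U t \<and> loc_basic X M U t \<subseteq> V \<and>
          (\<forall>(x, z) \<in> loc_basic X M U t.
             s (x, z) = fraction (stalk X x) z (germ X x U a) (germ X x U t [^]\<^bsub>stalk X x\<^esub> n))}"

definition loc :: "('a, 'b) rspace \<Rightarrow> ('a, 'b) prime_sys \<Rightarrow>
    (('a, 'b) loc_pt, ('a, 'b) loc_sec) rspace" where
  "loc X M =
     \<lparr>top_sp = topology_generated_by
        {loc_basic X M U s | U s. open_in X U \<and> s \<in> carrier (sec X U)},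
      sec = (\<lambda>V. function_ring V (loc_ring_at X) (loc_sections X M V)),
      res = (\<lambda>V W s. restrict s W)\<rparr>"

definition loc_proj :: "('a, 'b) rspace \<Rightarrow> ('a, 'b) prime_sys \<Rightarrow>
    (('a, 'b) loc_pt, ('a, 'b) loc_sec, 'a, 'b) rs_map" where
  "loc_proj X M =
     \<lparr>pt = fst,
      shm = (\<lambda>U s. \<lambda>(x, z) \<in> {w \<in> points (loc X M). fst w \<in> U}.
               fraction (stalk X x) z (germ X x U s) \<one>\<^bsub>stalk X x\<^esub>)\<rparr>"

text \<open>
  For a morphism \<open>f : (X, M) \<rightarrow> (Y, N)\<close> of primed ringed spaces, the induced morphism
  \<open>loc X M \<rightarrow> loc Y N\<close> of locally ringed spaces lying over \<open>f\<close>. Locality of stalks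
  and commutation with the projections force it to map \<open>(x, z)\<close> to \<open>(f x, f\<^sub>x\<^sup>-\<^sup>1 z)\<close>, and to act on
  values of sections by the localized stalk maps.
\<close>

definition loc_map_pt ::
    "('a, 'b) rspace \<Rightarrow> ('c, 'd) rspace \<Rightarrow> ('a, 'b, 'c, 'd) rs_map \<Rightarrow>
     ('a, 'b) loc_pt \<Rightarrow> ('c, 'd) loc_pt" where
  "loc_map_pt X Y f = (\<lambda>(x, z). (pt f x, contraction (stalk Y (pt f x)) (stalk_map X f x) z))"

definition loc_map ::
    "('a, 'b) rspace \<Rightarrow> ('a, 'b) prime_sys \<Rightarrow> ('c, 'd) rspace \<Rightarrow> ('a, 'b, 'c, 'd) rs_map \<Rightarrow>
     (('a, 'b) loc_pt, ('a, 'b) loc_sec, ('c, 'd) loc_pt, ('c, 'd) loc_sec) rs_map" where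
  "loc_map X M Y f =
     \<lparr>pt = loc_map_pt X Y f,
      shm = (\<lambda>V s. \<lambda>(x, z) \<in> {w \<in> points (loc X M). loc_map_pt X Y f w \<in> V}.
               localize_hom (stalk X x) z (stalk_map X f x) (s (loc_map_pt X Y f (x, z))))\<rparr>"


section \<open>The relative spectrum\<close>

text \<open>
  A sheaf \<open>A\<close> of algebras on \<open>Y\<close> is given as a ringed space with the topology of \<open>Y\<close> and a
  morphism \<open>g\<close> from it to \<open>Y\<close> that is the identity on points.
\<close>

definition rel_prime_system ::
    "('c, 'd) rspace \<Rightarrow> ('c, 'b) rspace \<Rightarrow> ('c, 'b, 'c, 'd) rs_map \<Rightarrow> ('c, 'b) prime_sys" where
  "rel_prime_system Y A g = pullback_prime_system A Y g (local_prime_system Y)"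

definition rel_spec ::
    "('c, 'd) rspace \<Rightarrow> ('c, 'b) rspace \<Rightarrow> ('c, 'b, 'c, 'd) rs_map \<Rightarrow>
     (('c, 'b) loc_pt, ('c, 'b) loc_sec) rspace" where
  "rel_spec Y A g = loc A (rel_prime_system Y A g)"

definition rel_spec_struct ::
    "('c, 'd) rspace \<Rightarrow> ('c, 'b) rspace \<Rightarrow> ('c, 'b, 'c, 'd) rs_map \<Rightarrow>
     (('c, 'b) loc_pt, ('c, 'b) loc_sec, 'c, 'd) rs_map" where
  "rel_spec_struct Y A g =
     rs_comp (loc Y (local_prime_system Y))
       (loc_proj Y (local_prime_system Y)) (loc_map A (rel_prime_system Y A g) Y g)"

text \<open>
  A homomorphism of algebras from \<open>B\<close> to \<open>(A, g)\<close> is a morphism \<open>u\<close> from the ringed space \<open>A\<close> to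
  the ringed space \<open>B\<close>, again the identity on points, and induces a map of relative spectra in the
  same direction as \<open>u\<close>.
\<close>

definition rel_spec_map ::
    "('c, 'd) rspace \<Rightarrow> ('c, 'b) rspace \<Rightarrow> ('c, 'b, 'c, 'd) rs_map \<Rightarrow> ('c, 'g) rspace \<Rightarrow>
     ('c, 'b, 'c, 'g) rs_map \<Rightarrow>
     (('c, 'b) loc_pt, ('c, 'b) loc_sec, ('c, 'g) loc_pt, ('c, 'g) loc_sec) rs_map" where
  "rel_spec_map Y A g B u = loc_map A (rel_prime_system Y A g) B u"


section \<open>The relative spectrum of a direct image\<close>

definition direct_image ::
    "('a, 'b) rspace \<Rightarrow> ('c, 'd) rspace \<Rightarrow> ('a, 'b, 'c, 'd) rs_map \<Rightarrow> ('c, 'b) rspace" where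
  "direct_image X Y f =
     \<lparr>top_sp = top_sp Y,
      sec = (\<lambda>V. sec X (preim X f V)),
      res = (\<lambda>V W. res X (preim X f V) (preim X f W))\<rparr>"

definition direct_image_alg :: "('a, 'b, 'c, 'd) rs_map \<Rightarrow> ('c, 'b, 'c, 'd) rs_map" where
  "direct_image_alg f = \<lparr>pt = (\<lambda>y. y), shm = shm f\<rparr>"

text \<open>
  Let \<open>f : X \<rightarrow> Y\<close>, \<open>f' : X' \<rightarrow> Y\<close> and \<open>h : X \<rightarrow> X'\<close> over \<open>Y\<close>. On sections over \<open>V\<close> the algebra map
  from the direct image of \<open>X'\<close> to that of \<open>X\<close> is \<open>h\<close> over the preimage of \<open>V\<close> in \<open>X'\<close>.
\<close>

definition direct_image_map ::
    "('e, 'g) rspace \<Rightarrow> ('e, 'g, 'c, 'd) rs_map \<Rightarrow> ('a, 'b, 'e, 'g) rs_map \<Rightarrow>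
     ('c, 'b, 'c, 'g) rs_map" where
  "direct_image_map X' f' h = \<lparr>pt = (\<lambda>y. y), shm = (\<lambda>V. shm h (preim X' f' V))\<rparr>"

definition Spec_direct_image ::
    "('a, 'b) rspace \<Rightarrow> ('c, 'd) rspace \<Rightarrow> ('a, 'b, 'c, 'd) rs_map \<Rightarrow>
     (('c, 'b) loc_pt, ('c, 'b) loc_sec) rspace" where
  "Spec_direct_image X Y f = rel_spec Y (direct_image X Y f) (direct_image_alg f)"

definition Spec_direct_image_struct ::
    "('a, 'b) rspace \<Rightarrow> ('c, 'd) rspace \<Rightarrow> ('a, 'b, 'c, 'd) rs_map \<Rightarrow>
     (('c, 'b) loc_pt, ('c, 'b) loc_sec, 'c, 'd) rs_map" where
  "Spec_direct_image_struct X Y f =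
     rel_spec_struct Y (direct_image X Y f) (direct_image_alg f)"

definition Spec_direct_image_map ::
    "('a, 'b) rspace \<Rightarrow> ('c, 'd) rspace \<Rightarrow> ('a, 'b, 'c, 'd) rs_map \<Rightarrow>
     ('e, 'g) rspace \<Rightarrow> ('e, 'g, 'c, 'd) rs_map \<Rightarrow> ('a, 'b, 'e, 'g) rs_map \<Rightarrow>
     (('c, 'b) loc_pt, ('c, 'b) loc_sec, ('c, 'g) loc_pt, ('c, 'g) loc_sec) rs_map" where
  "Spec_direct_image_map X Y f X' f' h =
     rel_spec_map Y (direct_image X Y f) (direct_image_alg f) (direct_image X' Y f')
       (direct_image_map X' f' h)"

text \<open>
  The canonical comparison map: regard \<open>f\<close> as a morphism from \<open>X\<close> with its local prime system to
  the direct image (the identity on sections), localize it, and precompose with the inverse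
  of the isomorphism \<open>loc X (local_prime_system X) \<rightarrow> X\<close>.
\<close>

definition to_direct_image :: "('a, 'b, 'c, 'd) rs_map \<Rightarrow> ('a, 'b, 'c, 'b) rs_map" where
  "to_direct_image f = \<lparr>pt = pt f, shm = (\<lambda>V s. s)\<rparr>"

definition comparison ::
    "('a, 'b) rspace \<Rightarrow> ('c, 'd) rspace \<Rightarrow> ('a, 'b, 'c, 'd) rs_map \<Rightarrow>
     ('a, 'b, ('c, 'b) loc_pt, ('c, 'b) loc_sec) rs_map" where
  "comparison X Y f =
     rs_comp (loc X (local_prime_system X))
       (loc_map X (local_prime_system X) (direct_image X Y f) (to_direct_image f))
       (lrs_inverse (loc X (local_prime_system X)) X (loc_proj X (local_prime_system X)))"

end

theory Submission
  imports Defs "HOL-Algebra.QuotRing" "HOL-Algebra.Ring_Divisibility"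
begin

text \<open>
  The comparison map sends \<open>x\<close> to \<open>(f x, p)\<close>, where \<open>p\<close> consists of the germs in the stalk of
  \<open>A = f\<^sub>*O\<^sub>X\<close> at \<open>f x\<close> that vanish at \<open>x\<close>. For any morphism \<open>k\<close> of primed ringed spaces from a
  locally ringed space \<open>X\<close>, with its local prime system, to \<open>(A, M)\<close>, the induced map to the
  localization is an isomorphism as soon as it is bijective on points, sections of \<open>X\<close> are locally
  fractions of sections of \<open>A\<close> on sets \<open>D(t)\<close> with \<open>t\<close> from \<open>A\<close>, and a germ of \<open>A\<close> that dies in the
  stalk of \<open>X\<close> is killed by a germ outside \<open>p\<close>. For the identity of \<open>X\<close> this gives the isomorphism
  of \<open>X\<close> with its own localization, and for \<open>X \<rightarrow> A\<close> the theorem. In the latter case the three conditions are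
  checked over an affine \<open>V\<close> with affine preimage \<open>U\<close>: they reduce to \<open>O(D(b)) = O(U)\<^sub>b\<close> for
  \<open>b \<in> O(U)\<close> and to the bijection between points and primes on \<open>U\<close> and \<open>V\<close>. Naturality
  is the equality of two maps on stalks, read off from the values of sections.
\<close>

section \<open>Prime and maximal ideals\<close>

text \<open>The proof never shows in general that a localization is a locally ringed space. The
  structure is transported from \<open>X\<close> along a map \<open>D\<close> that runs from the
  localization back to \<open>X\<close>. On sections \<open>D\<close> can be written down value by
  value, while a map the other way would need a gluing for each section. Once \<open>D\<close> is a
  homeomorphism and bijective on sections, compatibly with operations and restrictions, the sheaf
  axioms, the local stalks and the inverse morphism follow formally. Morphisms are compared only up
  to \<open>rs_eq\<close>, and \<open>comparison\<close> contains a chosen inverse. So structure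
  maps and naturality are computed for \<open>D\<close>, whose values are explicit, and then
  inverted by diagram chases. Two of the three conditions make the stalk of \<open>A\<close>,
  localized at p, isomorphic to the stalk of \<open>X\<close>: fractions give surjectivity, the
  killing denominator gives injectivity. Because the fractions are uniform on a neighbourhood, they
  also give openness of the map on points and local expressions for sections. Different affine opens
  are never compared: over one affine V a germ is represented on some D(r) with r in O(V), and r
  lies outside every relevant prime.\<close>

lemma (in cring) ideal_maximal_avoiding_powers:
  assumes I: "ideal I R" and f: "f \<in> carrier R" and fI: "\<And>n::nat. f [^] n \<notin> I"
  obtains P where "ideal P R" "I \<subseteq> P" "\<And>n::nat. f [^] n \<notin> P"
    "\<And>J. ideal J R \<Longrightarrow> P \<subseteq> J \<Longrightarrow> (\<And>n::nat. f [^] n \<notin> J) \<Longrightarrow> J = P"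
proof -
  define A where "A = {J. ideal J R \<and> I \<subseteq> J \<and> (\<forall>n::nat. f [^] n \<notin> J)}"
  have "\<exists>M\<in>A. \<forall>X\<in>A. M \<subseteq> X \<longrightarrow> X = M"
  proof (rule subset_Zorn_nonempty)
    show "A \<noteq> {}" using I fI by (auto simp: A_def)
    fix C assume ne: "C \<noteq> {}" and ch: "subset.chain A C"
    have ch': "subset.chain {I. ideal I R} C"
      using ch by (auto simp: pred_on.chain_def A_def)
    have "ideal (\<Union>C) R" using chain_Union_is_ideal[OF ch'] ne by simp
    moreover have C: "C \<subseteq> A" using ch by (simp add: pred_on.chain_def)
    then have "I \<subseteq> \<Union>C" "\<forall>n::nat. f [^] n \<notin> \<Union>C" using ne by (auto simp: A_def)
    ultimately show "\<Union>C \<in> A" by (simp add: A_def)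
  qed
  then obtain M where "M \<in> A" and "\<And>X. X \<in> A \<Longrightarrow> M \<subseteq> X \<Longrightarrow> X = M" by blast
  then show thesis by (intro that[of M]) (auto simp: A_def)
qed

lemma (in cring) ideal_adjoin:
  assumes "ideal P R" and a: "a \<in> carrier R"
  shows "ideal {p \<oplus> r \<otimes> a | p r. p \<in> P \<and> r \<in> carrier R} R"
proof -
  have "{p \<oplus> r \<otimes> a | p r. p \<in> P \<and> r \<in> carrier R} = P <+>\<^bsub>R\<^esub> PIdl a"
    by (auto simp: set_add_def set_mult_def cgenideal_def)
  then show ?thesis using add_ideals[OF assms(1) cgenideal_ideal[OF a]] by simp
qed

text \<open>An ideal \<open>P\<close> that is maximal among those avoiding the powers of
  \<open>f\<close> is prime. If \<open>a\<close> and \<open>b\<close> are outside \<open>P\<close>,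
  then the ideals generated by \<open>P\<close> with \<open>a\<close> and by \<open>P\<close> with
  \<open>b\<close> both contain a power of \<open>f\<close>; the product of these powers is
  congruent modulo \<open>P\<close> to a multiple of \<open>a \<otimes> b\<close>, so
  \<open>a \<otimes> b\<close> cannot be in \<open>P\<close>.\<close>

lemma (in cring) exists_prime_avoiding_powers:
  assumes I: "ideal I R" and f: "f \<in> carrier R" and fI: "\<And>n::nat. f [^] n \<notin> I"
  obtains P where "primeideal P R" "I \<subseteq> P" "f \<notin> P"
proof -
  obtain P where P: "ideal P R" "I \<subseteq> P" "\<And>n::nat. f [^] n \<notin> P"
    and max: "\<And>J. ideal J R \<Longrightarrow> P \<subseteq> J \<Longrightarrow> (\<And>n::nat. f [^] n \<notin> J) \<Longrightarrow> J = P"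
    using ideal_maximal_avoiding_powers[OF assms] by blast
  interpret P: ideal P R by fact
  have *: "\<exists>n::nat. \<exists>p\<in>P. \<exists>r\<in>carrier R. f [^] n = p \<oplus> r \<otimes> a"
    if a: "a \<in> carrier R" "a \<notin> P" for a
  proof (rule ccontr)
    assume neg: "\<not> ?thesis"
    let ?J = "{p \<oplus> r \<otimes> a | p r. p \<in> P \<and> r \<in> carrier R}"
    have "p \<in> ?J" if "p \<in> P" for p
    proof -
      have "p = p \<oplus> \<zero> \<otimes> a" using that a P.Icarr by simp
      then show ?thesis using that by blast
    qed
    then have "P \<subseteq> ?J" by (rule subsetI)
    moreover have "f [^] n \<notin> ?J" for n :: nat using neg by (simp only: mem_Collect_eq) metis
    ultimately have "?J = P" by (intro max[OF ideal_adjoin[OF P(1) a(1)]])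
    moreover have "a = \<zero> \<oplus> \<one> \<otimes> a" using a by simp
    then have "a \<in> ?J" using P.zero_closed by blast
    ultimately show False using a by simp
  qed
  have "primeideal P R"
  proof (rule primeidealI)
    show "carrier R \<noteq> P" using P(3)[of 0] by auto
    fix a b assume ab: "a \<in> carrier R" "b \<in> carrier R" "a \<otimes> b \<in> P"
    show "a \<in> P \<or> b \<in> P"
    proof (rule ccontr)
      assume "\<not> (a \<in> P \<or> b \<in> P)"
      then obtain m n :: nat and p q r s where
        1: "p \<in> P" "r \<in> carrier R" "f [^] m = p \<oplus> r \<otimes> a" and
        2: "q \<in> P" "s \<in> carrier R" "f [^] n = q \<oplus> s \<otimes> b"
        using *[OF ab(1)] *[OF ab(2)] by metis
      have c: "p \<in> carrier R" "q \<in> carrier R" using 1 2 P.Icarr by auto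
      have "f [^] (m + n) = (p \<oplus> r \<otimes> a) \<otimes> (q \<oplus> s \<otimes> b)"
        using f 1 2 by (metis nat_pow_mult)
      also have "\<dots> = p \<otimes> (q \<oplus> s \<otimes> b) \<oplus> ((r \<otimes> a) \<otimes> q \<oplus> (r \<otimes> s) \<otimes> (a \<otimes> b))"
        using c 1(2) 2(2) ab(1,2) by algebra
      also have "\<dots> \<in> P"
        using 1 2 ab c
        by (intro P.a_closed[OF P.I_r_closed[OF 1(1)] P.a_closed[OF P.I_l_closed[OF 2(1)]
              P.I_l_closed[OF ab(3)]]]) auto
      finally show False using P(3) by blast
    qed
  qed (use P is_cring in auto)
  moreover have "f \<notin> P" using P(3)[of 1] f by simp
  ultimately show thesis using that P by blast
qed

text \<open>All powers of \<open>\<one>\<close> are \<open>\<one>\<close>, so avoiding them means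
  being a proper ideal. An ideal maximal with this property is a maximal ideal, and one application
  of Zorn's lemma serves for primes and for maximal ideals.\<close>

lemma (in cring) nonunit_in_maximalideal:
  assumes r: "r \<in> carrier R" "r \<notin> Units R"
  obtains M where "maximalideal M R" "r \<in> M"
proof -
  have "\<one> [^] (n::nat) \<notin> PIdl r" for n
  proof
    assume "\<one> [^] n \<in> PIdl r"
    then obtain x where "x \<in> carrier R" "\<one> = x \<otimes> r" by (auto simp: cgenideal_def)
    then show False using r by (metis (mono_tags, lifting) Units_def m_comm mem_Collect_eq)
  qed
  then obtain P where P: "ideal P R" "PIdl r \<subseteq> P" "\<And>n::nat. \<one> [^] n \<notin> P"
    and max: "\<And>J. ideal J R \<Longrightarrow> P \<subseteq> J \<Longrightarrow> (\<And>n::nat. \<one> [^] n \<notin> J) \<Longrightarrow> J = P"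
    using ideal_maximal_avoiding_powers[OF cgenideal_ideal[OF r(1)] one_closed] by blast
  have "maximalideal P R"
  proof (rule maximalidealI)
    show "carrier R \<noteq> P" using P(3)[of 0] by auto
    fix J assume J: "ideal J R" "P \<subseteq> J" "J \<subseteq> carrier R"
    show "J = P \<or> J = carrier R"
      using max[OF J(1,2)] ideal.one_imp_carrier[OF J(1)] by auto
  qed fact
  then show thesis using that cgenideal_self[OF r(1)] P(2) by blast
qed

lemma (in cring) UnitsI_right_inverse:
  assumes "a \<in> carrier R" "b \<in> carrier R" "a \<otimes> b = \<one>"
  shows "a \<in> Units R"
  using assms m_comm[of a b] unfolding Units_def by auto

section \<open>Local rings and contraction of primes\<close>

lemma max_ideal_maximal:
  assumes "local_ring R" shows "maximalideal (max_ideal R) R"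
  using assms unfolding local_ring_def max_ideal_def by (metis theI_unique)

lemma max_ideal_eqI:
  assumes "local_ring R" "maximalideal m R" shows "max_ideal R = m"
  using assms max_ideal_maximal[OF assms(1)] unfolding local_ring_def by blast

lemma max_ideal_prime:
  assumes "local_ring R" shows "primeideal (max_ideal R) R"
  using assms max_ideal_maximal cring.maximalideal_prime unfolding local_ring_def by blast

text \<open>Bridge between two languages: primes and points speak of membership in the maximal
  ideal, while invertibility is what spreads from a germ to a section on a neighbourhood.\<close>

lemma max_ideal_iff_nonunit:
  fixes R (structure)
  assumes R: "local_ring R" and r: "r \<in> carrier R"
  shows "r \<in> max_ideal R \<longleftrightarrow> r \<notin> Units R"
proof -
  interpret cring R using R by (simp add: local_ring_def)
  interpret M: maximalideal "max_ideal R" R by (rule max_ideal_maximal[OF R])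
  have "r \<notin> max_ideal R" if "r \<in> Units R"
  proof
    assume "r \<in> max_ideal R"
    then have "inv r \<otimes> r \<in> max_ideal R" using that M.I_l_closed by blast
    then have "\<one> \<in> max_ideal R" using that by simp
    then show False using M.one_imp_carrier M.I_notcarr by simp
  qed
  moreover have "r \<in> max_ideal R" if "r \<notin> Units R"
    using nonunit_in_maximalideal[OF r that] max_ideal_eqI[OF R] by metis
  ultimately show ?thesis by blast
qed

lemma primeideal_contraction:
  assumes "cring R" "cring S" "h \<in> ring_hom R S" "primeideal p S"
  shows "primeideal (contraction R h p) R"
proof -
  interpret ring_hom_ring R S h
    using assms(1-3) by (intro ring_hom_ringI2) (auto intro: cring.axioms)
  show ?thesis
    unfolding contraction_def by (rule primeideal_vimage[OF assms(1,4)])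
qed

section \<open>Localization at a prime\<close>

text \<open>Operations on fractions and on germs are unions over all representatives. This evaluates
  such a union once its members are known to coincide.\<close>

lemma UN_pairs_const:
  assumes "\<And>a b. (a, b) \<in> A \<Longrightarrow> f a b = C" and "A \<noteq> {}"
  shows "(\<Union>(a, b)\<in>A. f a b) = C"
  using assms by auto

locale prime_localization = cring R for R :: "'r ring" (structure) +
  fixes p :: "'r set"
  assumes prime: "primeideal p R"
begin

lemma one_denom: "\<one> \<in> carrier R - p"
  using ideal.one_imp_carrier primeideal.I_notcarr prime primeideal.axioms(1) by blast

lemma mult_denom:
  "a \<in> carrier R - p \<Longrightarrow> b \<in> carrier R - p \<Longrightarrow> a \<otimes> b \<in> carrier R - p"
  using primeideal.I_prime[OF prime] by blast

lemma pow_denom: "a \<in> carrier R - p \<Longrightarrow> a [^] (n::nat) \<in> carrier R - p"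
  by (induction n) (use one_denom mult_denom in auto)

lemma fraction_self:
  "a \<in> carrier R \<Longrightarrow> b \<in> carrier R - p \<Longrightarrow> (a, b) \<in> fraction R p a b"
  unfolding fraction_def using one_denom by auto

lemma fraction_memD:
  assumes "(a', b') \<in> fraction R p a b"
  shows "a' \<in> carrier R" "b' \<in> carrier R - p"
    "\<exists>u \<in> carrier R - p. u \<otimes> (a \<otimes> b') = u \<otimes> (a' \<otimes> b)"
  using assms unfolding fraction_def by auto

lemma fraction_subset:
  assumes c: "a \<in> carrier R" "b \<in> carrier R - p" "a' \<in> carrier R" "b' \<in> carrier R - p"
    and u: "u \<in> carrier R - p" "u \<otimes> (a \<otimes> b') = u \<otimes> (a' \<otimes> b)"
  shows "fraction R p a b \<subseteq> fraction R p a' b'"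
proof
  fix z assume z: "z \<in> fraction R p a b"
  obtain x y where xy: "z = (x, y)" by force
  note m = fraction_memD[OF z[unfolded xy]]
  note x = m(1) and y = m(2)
  obtain v where v: "v \<in> carrier R - p" "v \<otimes> (a \<otimes> y) = v \<otimes> (x \<otimes> b)"
    using m(3) by blast
  have k: "u \<in> carrier R" "v \<in> carrier R" "b \<in> carrier R" "b' \<in> carrier R" "y \<in> carrier R"
    using u v c y by auto
  \<comment> \<open>Transitivity of the relation between fractions: the witnesses \<open>u\<close>
    and \<open>v\<close> are multiplied, and the additional factor \<open>b\<close> allows
    \<open>a\<close> to be eliminated between the two equations.\<close>
  have "(u \<otimes> v \<otimes> b) \<otimes> (a' \<otimes> y) = v \<otimes> y \<otimes> (u \<otimes> (a' \<otimes> b))"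
    using k c x by algebra
  also have "\<dots> = u \<otimes> b' \<otimes> (v \<otimes> (a \<otimes> y))"
    unfolding u(2)[symmetric] using k c x by algebra
  also have "\<dots> = (u \<otimes> v \<otimes> b) \<otimes> (x \<otimes> b')"
    unfolding v(2) using k c x by algebra
  finally have "(u \<otimes> v \<otimes> b) \<otimes> (a' \<otimes> y) = (u \<otimes> v \<otimes> b) \<otimes> (x \<otimes> b')" .
  moreover have "u \<otimes> v \<otimes> b \<in> carrier R - p" using u v c mult_denom by blast
  ultimately show "z \<in> fraction R p a' b'"
    unfolding fraction_def xy using x y by blast
qed

lemma fraction_eqI:
  assumes "a \<in> carrier R" "b \<in> carrier R - p" "a' \<in> carrier R" "b' \<in> carrier R - p"
    and "u \<in> carrier R - p" "u \<otimes> (a \<otimes> b') = u \<otimes> (a' \<otimes> b)"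
  shows "fraction R p a b = fraction R p a' b'"
  using fraction_subset[OF assms] fraction_subset[OF assms(3,4,1,2,5) assms(6)[symmetric]]
  by (rule equalityI)

lemma fraction_eq_iff:
  assumes "a \<in> carrier R" "b \<in> carrier R - p" "a' \<in> carrier R" "b' \<in> carrier R - p"
  shows "fraction R p a b = fraction R p a' b' \<longleftrightarrow>
    (\<exists>u \<in> carrier R - p. u \<otimes> (a \<otimes> b') = u \<otimes> (a' \<otimes> b))"
  using fraction_eqI[OF assms] fraction_self[OF assms(3,4)] fraction_memD(3) by blast

lemma fraction_eqI':
  assumes "a \<in> carrier R" "b \<in> carrier R - p" "a' \<in> carrier R" "b' \<in> carrier R - p"
    and "a \<otimes> b' = a' \<otimes> b"
  shows "fraction R p a b = fraction R p a' b'"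
  using fraction_eqI[OF assms(1-4) one_denom] assms(5) by simp

lemma fraction_closed:
  "a \<in> carrier R \<Longrightarrow> b \<in> carrier R - p \<Longrightarrow> fraction R p a b \<in> carrier (localize_at R p)"
  unfolding localize_at_def by auto

lemma fraction_cases:
  assumes "\<alpha> \<in> carrier (localize_at R p)"
  obtains a b where "a \<in> carrier R" "b \<in> carrier R - p" "\<alpha> = fraction R p a b"
  using assms unfolding localize_at_def by auto

lemma localize_one: "\<one>\<^bsub>localize_at R p\<^esub> = fraction R p \<one> \<one>"
  and localize_zero: "\<zero>\<^bsub>localize_at R p\<^esub> = fraction R p \<zero> \<one>"
  by (simp_all add: localize_at_def)

lemma fraction_eq_of_mem:
  assumes "a \<in> carrier R" "b \<in> carrier R - p" "(a', b') \<in> fraction R p a b"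
  shows "fraction R p a' b' = fraction R p a b"
  using assms fraction_memD[OF assms(3)] fraction_eq_iff[of a b a' b'] by auto

text \<open>Only the first fraction is replaced. For the second one, \<open>fraction_mult\<close>
  commutes the product and applies this again; \<open>fraction_add_cong\<close> is used in the same
  way.\<close>

lemma fraction_mult_cong:
  assumes c: "a \<in> carrier R" "b \<in> carrier R - p" "a' \<in> carrier R" "b' \<in> carrier R - p"
    "d \<in> carrier R" "e \<in> carrier R - p"
    and eq: "fraction R p a b = fraction R p a' b'"
  shows "fraction R p (a \<otimes> d) (b \<otimes> e) = fraction R p (a' \<otimes> d) (b' \<otimes> e)"
proof -
  obtain u where u: "u \<in> carrier R - p" "u \<otimes> (a \<otimes> b') = u \<otimes> (a' \<otimes> b)"
    using eq fraction_eq_iff[OF c(1-4)] by blast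
  have k: "u \<in> carrier R" "b \<in> carrier R" "b' \<in> carrier R" "e \<in> carrier R" using u c by auto
  have "u \<otimes> ((a \<otimes> d) \<otimes> (b' \<otimes> e)) = (d \<otimes> e) \<otimes> (u \<otimes> (a \<otimes> b'))" using k c by algebra
  also have "\<dots> = u \<otimes> ((a' \<otimes> d) \<otimes> (b \<otimes> e))" unfolding u(2) using k c by algebra
  finally show ?thesis
    using u(1) c mult_denom by (intro fraction_eqI[of _ _ _ _ u]) auto
qed

lemma fraction_add_cong:
  assumes c: "a \<in> carrier R" "b \<in> carrier R - p" "a' \<in> carrier R" "b' \<in> carrier R - p"
    "d \<in> carrier R" "e \<in> carrier R - p"
    and eq: "fraction R p a b = fraction R p a' b'"
  shows "fraction R p (a \<otimes> e \<oplus> d \<otimes> b) (b \<otimes> e) = fraction R p (a' \<otimes> e \<oplus> d \<otimes> b') (b' \<otimes> e)"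
proof -
  obtain u where u: "u \<in> carrier R - p" "u \<otimes> (a \<otimes> b') = u \<otimes> (a' \<otimes> b)"
    using eq fraction_eq_iff[OF c(1-4)] by blast
  have k: "u \<in> carrier R" "b \<in> carrier R" "b' \<in> carrier R" "e \<in> carrier R" using u c by auto
  have "u \<otimes> ((a \<otimes> e \<oplus> d \<otimes> b) \<otimes> (b' \<otimes> e))
      = (e \<otimes> e) \<otimes> (u \<otimes> (a \<otimes> b')) \<oplus> u \<otimes> (d \<otimes> b \<otimes> b' \<otimes> e)" using k c by algebra
  also have "\<dots> = u \<otimes> ((a' \<otimes> e \<oplus> d \<otimes> b') \<otimes> (b \<otimes> e))" unfolding u(2) using k c by algebra
  finally show ?thesis
    using u(1) c mult_denom by (intro fraction_eqI[of _ _ _ _ u]) auto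
qed

lemma fraction_mult:
  assumes c: "a \<in> carrier R" "b \<in> carrier R - p" "c \<in> carrier R" "d \<in> carrier R - p"
  shows "fraction R p a b \<otimes>\<^bsub>localize_at R p\<^esub> fraction R p c d = fraction R p (a \<otimes> c) (b \<otimes> d)"
proof -
  have "fraction R p (a' \<otimes> c') (b' \<otimes> d') = fraction R p (a \<otimes> c) (b \<otimes> d)"
    if m: "(a', b') \<in> fraction R p a b" "(c', d') \<in> fraction R p c d" for a' b' c' d'
  proof -
    note M = fraction_memD(1,2)[OF m(1)] fraction_memD(1,2)[OF m(2)]
    have "fraction R p (a' \<otimes> c') (b' \<otimes> d') = fraction R p (a \<otimes> c') (b \<otimes> d')"
      using fraction_mult_cong M c fraction_eq_of_mem[OF c(1,2) m(1)] by metis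
    also have "\<dots> = fraction R p (c' \<otimes> a) (d' \<otimes> b)" using M c by (simp add: m_comm)
    also have "\<dots> = fraction R p (c \<otimes> a) (d \<otimes> b)"
      using fraction_mult_cong M c fraction_eq_of_mem[OF c(3,4) m(2)] by metis
    finally show ?thesis using c by (simp add: m_comm)
  qed
  moreover have "fraction R p a b \<noteq> {}" "fraction R p c d \<noteq> {}"
    using fraction_self c by blast+
  ultimately show ?thesis
    by (simp add: localize_at_def UN_pairs_const)
qed

lemma fraction_add:
  assumes c: "a \<in> carrier R" "b \<in> carrier R - p" "c \<in> carrier R" "d \<in> carrier R - p"
  shows "fraction R p a b \<oplus>\<^bsub>localize_at R p\<^esub> fraction R p c d
    = fraction R p (a \<otimes> d \<oplus> c \<otimes> b) (b \<otimes> d)"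
proof -
  have "fraction R p (a' \<otimes> d' \<oplus> c' \<otimes> b') (b' \<otimes> d') = fraction R p (a \<otimes> d \<oplus> c \<otimes> b) (b \<otimes> d)"
    if m: "(a', b') \<in> fraction R p a b" "(c', d') \<in> fraction R p c d" for a' b' c' d'
  proof -
    note M = fraction_memD(1,2)[OF m(1)] fraction_memD(1,2)[OF m(2)]
    have "fraction R p (a' \<otimes> d' \<oplus> c' \<otimes> b') (b' \<otimes> d') = fraction R p (a \<otimes> d' \<oplus> c' \<otimes> b) (b \<otimes> d')"
      using fraction_add_cong M c fraction_eq_of_mem[OF c(1,2) m(1)] by metis
    also have "\<dots> = fraction R p (c' \<otimes> b \<oplus> a \<otimes> d') (d' \<otimes> b)" using M c by (simp add: m_comm a_comm)
    also have "\<dots> = fraction R p (c \<otimes> b \<oplus> a \<otimes> d) (d \<otimes> b)"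
      using fraction_add_cong M c fraction_eq_of_mem[OF c(3,4) m(2)] by metis
    finally show ?thesis using c by (simp add: m_comm a_comm)
  qed
  moreover have "fraction R p a b \<noteq> {}" "fraction R p c d \<noteq> {}"
    using fraction_self c by blast+
  ultimately show ?thesis
    by (simp add: localize_at_def UN_pairs_const)
qed

lemma localize_cring: "cring (localize_at R p)"
proof -
  let ?L = "localize_at R p"
  have mc: "x \<otimes>\<^bsub>?L\<^esub> y = y \<otimes>\<^bsub>?L\<^esub> x" if "x \<in> carrier ?L" "y \<in> carrier ?L" for x y
    using that by (elim fraction_cases) (simp add: fraction_mult m_comm)
  have lu: "\<one>\<^bsub>?L\<^esub> \<otimes>\<^bsub>?L\<^esub> x = x" if "x \<in> carrier ?L" for x
    using that one_denom by (elim fraction_cases) (simp add: fraction_mult localize_one)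
  have di: "(x \<oplus>\<^bsub>?L\<^esub> y) \<otimes>\<^bsub>?L\<^esub> z = x \<otimes>\<^bsub>?L\<^esub> z \<oplus>\<^bsub>?L\<^esub> y \<otimes>\<^bsub>?L\<^esub> z"
    if xyz: "x \<in> carrier ?L" "y \<in> carrier ?L" "z \<in> carrier ?L" for x y z
  proof -
    from xyz obtain a b c d e f where c: "a \<in> carrier R" "b \<in> carrier R - p" "x = fraction R p a b"
        "c \<in> carrier R" "d \<in> carrier R - p" "y = fraction R p c d"
        "e \<in> carrier R" "f \<in> carrier R - p" "z = fraction R p e f"
      by (elim fraction_cases) blast
    have k: "b \<in> carrier R" "d \<in> carrier R" "f \<in> carrier R" using c by auto
    have "((a \<otimes> d \<oplus> c \<otimes> b) \<otimes> e) \<otimes> ((b \<otimes> f) \<otimes> (d \<otimes> f))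
        = (a \<otimes> e \<otimes> (d \<otimes> f) \<oplus> c \<otimes> e \<otimes> (b \<otimes> f)) \<otimes> ((b \<otimes> d) \<otimes> f)"
      using k c(1,4,7) by algebra
    then show ?thesis
      unfolding c(3,6,9) using c(1,2,4,5,7,8) k mult_denom
      by (simp add: fraction_mult fraction_add, intro fraction_eqI') auto
  qed
  have mcl: "x \<otimes>\<^bsub>?L\<^esub> y \<in> carrier ?L" "x \<oplus>\<^bsub>?L\<^esub> y \<in> carrier ?L"
    if "x \<in> carrier ?L" "y \<in> carrier ?L" for x y
    using that mult_denom
    by (elim fraction_cases; simp add: fraction_mult fraction_add fraction_closed)+
  have as: "(x \<otimes>\<^bsub>?L\<^esub> y) \<otimes>\<^bsub>?L\<^esub> z = x \<otimes>\<^bsub>?L\<^esub> (y \<otimes>\<^bsub>?L\<^esub> z)"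
    if xyz: "x \<in> carrier ?L" "y \<in> carrier ?L" "z \<in> carrier ?L" for x y z
    using that mult_denom by (elim fraction_cases) (simp add: fraction_mult m_assoc)
  have aas: "(x \<oplus>\<^bsub>?L\<^esub> y) \<oplus>\<^bsub>?L\<^esub> z = x \<oplus>\<^bsub>?L\<^esub> (y \<oplus>\<^bsub>?L\<^esub> z)"
    if xyz: "x \<in> carrier ?L" "y \<in> carrier ?L" "z \<in> carrier ?L" for x y z
  proof -
    from xyz obtain a b c d e f where c: "a \<in> carrier R" "b \<in> carrier R - p" "x = fraction R p a b"
        "c \<in> carrier R" "d \<in> carrier R - p" "y = fraction R p c d"
        "e \<in> carrier R" "f \<in> carrier R - p" "z = fraction R p e f"
      by (elim fraction_cases) blast
    have k: "b \<in> carrier R" "d \<in> carrier R" "f \<in> carrier R" using c by auto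
    have "(a \<otimes> d \<oplus> c \<otimes> b) \<otimes> f \<oplus> e \<otimes> (b \<otimes> d) = a \<otimes> (d \<otimes> f) \<oplus> (c \<otimes> f \<oplus> e \<otimes> d) \<otimes> b"
      using k c(1,4,7) by algebra
    then show ?thesis
      unfolding c(3,6,9) using c(1,2,4,5,7,8) k mult_denom
      by (simp add: fraction_add m_assoc)
  qed
  have ac: "x \<oplus>\<^bsub>?L\<^esub> y = y \<oplus>\<^bsub>?L\<^esub> x" if "x \<in> carrier ?L" "y \<in> carrier ?L" for x y
    using that by (elim fraction_cases) (simp add: fraction_add m_comm a_comm)
  have lz: "\<zero>\<^bsub>?L\<^esub> \<oplus>\<^bsub>?L\<^esub> x = x" if "x \<in> carrier ?L" for x
    using that one_denom by (elim fraction_cases) (simp add: fraction_add localize_zero)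
  have li: "\<exists>y\<in>carrier ?L. y \<oplus>\<^bsub>?L\<^esub> x = \<zero>\<^bsub>?L\<^esub>" if "x \<in> carrier ?L" for x
  proof -
    from that obtain a b where ab: "a \<in> carrier R" "b \<in> carrier R - p" "x = fraction R p a b"
      by (elim fraction_cases)
    have "(\<ominus> a \<otimes> b \<oplus> a \<otimes> b) \<otimes> \<one> = \<zero> \<otimes> (b \<otimes> b)" using ab(1,2) l_minus l_neg by auto
    then have "fraction R p (\<ominus> a \<otimes> b \<oplus> a \<otimes> b) (b \<otimes> b) = fraction R p \<zero> \<one>"
      using ab mult_denom one_denom by (intro fraction_eqI') auto
    then have "fraction R p (\<ominus> a) b \<oplus>\<^bsub>?L\<^esub> x = \<zero>\<^bsub>?L\<^esub>"
      using ab(1,2) by (simp add: ab(3) fraction_add localize_zero)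
    then show ?thesis using ab fraction_closed[of "\<ominus> a" b] by auto
  qed
  have "\<one>\<^bsub>?L\<^esub> \<in> carrier ?L" "\<zero>\<^bsub>?L\<^esub> \<in> carrier ?L"
    using one_denom by (auto simp: localize_one localize_zero intro: fraction_closed)
  then show ?thesis
    by (intro cringI abelian_groupI comm_monoidI mcl as aas mc ac lu lz li di)
qed

lemma fraction_one_hom: "(\<lambda>a. fraction R p a \<one>) \<in> ring_hom R (localize_at R p)"
  using one_denom
  by (intro ring_hom_memI) (auto simp: fraction_mult fraction_add localize_one fraction_closed)

lemma fraction_mult_denom:
  assumes "a \<in> carrier R" "b \<in> carrier R - p"
  shows "fraction R p b \<one> \<otimes>\<^bsub>localize_at R p\<^esub> fraction R p a b = fraction R p a \<one>"
  using assms one_denom fraction_eqI'[of "a \<otimes> b" b a \<one>]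
  by (simp add: fraction_mult m_comm)

lemma fraction_denom_unit:
  assumes "b \<in> carrier R - p"
  shows "fraction R p \<one> b \<otimes>\<^bsub>localize_at R p\<^esub> fraction R p b \<one> = \<one>\<^bsub>localize_at R p\<^esub>"
  using assms one_denom fraction_eqI'[of b b \<one> \<one>]
  by (simp add: fraction_mult localize_one)

end

text \<open>A witness \<open>u\<close> outside the contraction of \<open>q\<close> is mapped outside
  \<open>q\<close>, so all representatives have the same image. Later computations with induced maps
  on values of sections rest on this rule.\<close>

lemma localize_hom_fraction:
  assumes R: "cring R" and S: "cring S" and h: "h \<in> ring_hom R S" and q: "primeideal q S"
    and a: "a \<in> carrier R" "b \<in> carrier R" "h b \<notin> q"
  shows "localize_hom S q h (fraction R (contraction R h q) a b) = fraction S q (h a) (h b)"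
proof -
  let ?p = "contraction R h q"
  interpret h: ring_hom_cring R S h
    using R S h by (intro ring_hom_cringI ring_hom_ringI2) (auto intro: cring.axioms)
  interpret Rp: prime_localization R ?p
    by (intro prime_localization.intro prime_localization_axioms.intro R primeideal_contraction[OF assms(1-4)])
  interpret Sq: prime_localization S q
    by (intro prime_localization.intro prime_localization_axioms.intro S q)
  have d: "h c \<in> carrier S - q" if "c \<in> carrier R - ?p" for c
    using that by (auto simp: contraction_def)
  have b: "b \<in> carrier R - ?p" using a by (simp add: contraction_def)
  have "fraction S q (h a') (h b') = fraction S q (h a) (h b)" if m: "(a', b') \<in> fraction R ?p a b" for a' b'
  proof -
    note M = Rp.fraction_memD(1,2)[OF m]
    obtain u where u: "u \<in> carrier R - ?p" "u \<otimes>\<^bsub>R\<^esub> (a \<otimes>\<^bsub>R\<^esub> b') = u \<otimes>\<^bsub>R\<^esub> (a' \<otimes>\<^bsub>R\<^esub> b)"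
      using Rp.fraction_memD(3)[OF m] by blast
    have "h (u \<otimes>\<^bsub>R\<^esub> (a \<otimes>\<^bsub>R\<^esub> b')) = h (u \<otimes>\<^bsub>R\<^esub> (a' \<otimes>\<^bsub>R\<^esub> b))" using u(2) by simp
    then have "h u \<otimes>\<^bsub>S\<^esub> (h a \<otimes>\<^bsub>S\<^esub> h b') = h u \<otimes>\<^bsub>S\<^esub> (h a' \<otimes>\<^bsub>S\<^esub> h b)"
      using u(1) a b M by simp
    then show ?thesis
      using Sq.fraction_eqI[of "h a'" "h b'" "h a" "h b" "h u"] d[OF u(1)] d[OF b] d[OF M(2)] M a by auto
  qed
  moreover have "fraction R ?p a b \<noteq> {}" using Rp.fraction_self[OF a(1) b] by blast
  ultimately show ?thesis
    unfolding localize_hom_def by (intro UN_pairs_const)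
qed

section \<open>Stalks\<close>

locale presheaf =
  fixes X :: "('a, 'b) rspace"
  assumes presheaf: "presheaf_of_rings X"
begin

lemma sec_cring: "open_in X U \<Longrightarrow> cring (sec X U)"
  using presheaf by (simp add: presheaf_of_rings_def)

lemma res_hom:
  "open_in X U \<Longrightarrow> open_in X V \<Longrightarrow> V \<subseteq> U \<Longrightarrow> res X U V \<in> ring_hom (sec X U) (sec X V)"
  using presheaf by (simp add: presheaf_of_rings_def)

lemma res_id: "open_in X U \<Longrightarrow> s \<in> carrier (sec X U) \<Longrightarrow> res X U U s = s"
  using presheaf by (simp add: presheaf_of_rings_def)

lemma res_res:
  "open_in X U \<Longrightarrow> open_in X V \<Longrightarrow> open_in X W \<Longrightarrow> W \<subseteq> V \<Longrightarrow> V \<subseteq> U \<Longrightarrow>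
    s \<in> carrier (sec X U) \<Longrightarrow> res X V W (res X U V s) = res X U W s"
  using presheaf by (simp add: presheaf_of_rings_def)

lemma res_closed:
  "open_in X U \<Longrightarrow> open_in X V \<Longrightarrow> V \<subseteq> U \<Longrightarrow> s \<in> carrier (sec X U) \<Longrightarrow>
    res X U V s \<in> carrier (sec X V)"
  by (rule ring_hom_closed[OF res_hom])

lemma res_ring_hom_cring:
  assumes "open_in X U" "open_in X V" "V \<subseteq> U"
  shows "ring_hom_cring (sec X U) (sec X V) (res X U V)"
  using assms res_hom sec_cring
  by (intro ring_hom_cringI ring_hom_ringI2) (auto intro: cring.axioms)

lemma germ_self:
  assumes "open_in X U" "x \<in> U" "s \<in> carrier (sec X U)"
  shows "(U, s) \<in> germ X x U s"
  using assms unfolding germ_def by auto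

lemma germ_eq_iff:
  assumes U: "open_in X U" "x \<in> U" "s \<in> carrier (sec X U)"
    and V: "open_in X V" "x \<in> V" "t \<in> carrier (sec X V)"
  shows "germ X x U s = germ X x V t \<longleftrightarrow>
    (\<exists>W. open_in X W \<and> x \<in> W \<and> W \<subseteq> U \<inter> V \<and> res X U W s = res X V W t)"
    (is "_ \<longleftrightarrow> ?R")
proof
  assume "germ X x U s = germ X x V t"
  then have "(V, t) \<in> germ X x U s" using germ_self[OF V] by simp
  then show ?R unfolding germ_def by simp
next
  have *: "germ X x U s \<subseteq> germ X x V t"
    if U: "open_in X U" "x \<in> U" "s \<in> carrier (sec X U)"
      and V: "open_in X V" "x \<in> V" "t \<in> carrier (sec X V)"
      and W: "open_in X W" "x \<in> W" "W \<subseteq> U \<inter> V" "res X U W s = res X V W t" for U V s t W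
  proof (clarsimp simp: germ_def)
    fix Z u W' assume a: "open_in X Z" "x \<in> Z" "u \<in> carrier (sec X Z)" "open_in X W'" "x \<in> W'"
      "W' \<subseteq> U" "W' \<subseteq> Z" "res X U W' s = res X Z W' u"
    let ?W = "W \<inter> W'"
    have o: "open_in X ?W" using a W by blast
    have "res X V ?W t = res X W ?W (res X V W t)" using V W o by (intro res_res[symmetric]) auto
    also have "\<dots> = res X W ?W (res X U W s)" using W by simp
    also have "\<dots> = res X U ?W s" using U W o by (intro res_res) auto
    also have "\<dots> = res X W' ?W (res X U W' s)" using U W a o by (intro res_res[symmetric]) auto
    also have "\<dots> = res X W' ?W (res X Z W' u)" using a by simp
    also have "\<dots> = res X Z ?W u" using a o by (intro res_res) auto
    finally show "\<exists>W. open_in X W \<and> x \<in> W \<and> W \<subseteq> V \<and> W \<subseteq> Z \<and> res X V W t = res X Z W u"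
      using o W a by (intro exI[of _ ?W]) auto
  qed
  assume ?R
  then obtain W where W: "open_in X W" "x \<in> W" "W \<subseteq> U \<inter> V" "res X U W s = res X V W t" by blast
  show "germ X x U s = germ X x V t"
    using *[OF U V W] *[OF V U W(1,2)] W(3,4) by (metis Int_commute equalityI)
qed

lemma germ_res:
  assumes "open_in X U" "open_in X V" "V \<subseteq> U" "x \<in> V" "s \<in> carrier (sec X U)"
  shows "germ X x V (res X U V s) = germ X x U s"
  using assms res_closed
  by (subst germ_eq_iff) (auto intro!: exI[of _ V] simp: res_res)

lemma germ_closed:
  "open_in X U \<Longrightarrow> x \<in> U \<Longrightarrow> s \<in> carrier (sec X U) \<Longrightarrow> germ X x U s \<in> carrier (stalk X x)"
  unfolding stalk_def by auto

lemma stalk_cases: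
  assumes "\<alpha> \<in> carrier (stalk X x)"
  obtains U s where "open_in X U" "x \<in> U" "s \<in> carrier (sec X U)" "\<alpha> = germ X x U s"
  using assms unfolding stalk_def by auto

lemma stalk_cases_in:
  assumes "\<alpha> \<in> carrier (stalk X x)" "open_in X W" "x \<in> W"
  obtains U s where "open_in X U" "x \<in> U" "U \<subseteq> W" "s \<in> carrier (sec X U)" "\<alpha> = germ X x U s"
proof -
  obtain U s where U: "open_in X U" "x \<in> U" "s \<in> carrier (sec X U)" "\<alpha> = germ X x U s"
    using stalk_cases[OF assms(1)] .
  show thesis
  proof (rule that[of "U \<inter> W" "res X U (U \<inter> W) s"])
    show "open_in X (U \<inter> W)" using U assms by blast
    then show "res X U (U \<inter> W) s \<in> carrier (sec X (U \<inter> W))" "\<alpha> = germ X x (U \<inter> W) (res X U (U \<inter> W) s)"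
      using U assms by (auto intro: res_closed simp: germ_res)
  qed (use U assms in auto)
qed

lemma stalk_cases_two:
  assumes \<alpha>: "\<alpha> \<in> carrier (stalk X x)" and \<beta>: "\<beta> \<in> carrier (stalk X x)"
  obtains U s t where "open_in X U" "x \<in> U" "s \<in> carrier (sec X U)" "t \<in> carrier (sec X U)"
    "\<alpha> = germ X x U s" "\<beta> = germ X x U t"
proof -
  obtain V s where V: "open_in X V" "x \<in> V" "s \<in> carrier (sec X V)" "\<alpha> = germ X x V s"
    using stalk_cases[OF \<alpha>] .
  obtain U t where U: "open_in X U" "x \<in> U" "U \<subseteq> V" "t \<in> carrier (sec X U)" "\<beta> = germ X x U t"
    using stalk_cases_in[OF \<beta> V(1,2)] .
  show thesis
    using that[of U "res X V U s" t] U V by (auto intro: res_closed simp: germ_res)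
qed

lemma germ_memD:
  assumes "open_in X U" "x \<in> U" "s \<in> carrier (sec X U)" "(V, t) \<in> germ X x U s"
  shows "open_in X V" "x \<in> V" "t \<in> carrier (sec X V)" "germ X x V t = germ X x U s"
proof -
  show *: "open_in X V" "x \<in> V" "t \<in> carrier (sec X V)" using assms unfolding germ_def by auto
  have "(\<exists>W. open_in X W \<and> x \<in> W \<and> W \<subseteq> U \<inter> V \<and> res X U W s = res X V W t)"
    using assms unfolding germ_def by auto
  then show "germ X x V t = germ X x U s" using germ_eq_iff[OF assms(1-3) *] by simp
qed

lemma germ_eq_res:
  assumes "open_in X U" "x \<in> U" "s \<in> carrier (sec X U)" "t \<in> carrier (sec X U)"
    and "germ X x U s = germ X x U t"
  obtains W where "open_in X W" "x \<in> W" "W \<subseteq> U" "res X U W s = res X U W t"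
  using assms germ_eq_iff[OF assms(1-3) assms(1,2,4)] by auto

text \<open>Two representatives agree with \<open>s\<close> and \<open>t\<close> on neighbourhoods
  \<open>Z\<close> and \<open>Z'\<close>, so on the intersection of these the result of the
  operation does not depend on the representatives. This moves every computation with germs into a
  ring of sections.\<close>

lemma germ_mult_add:
  assumes U: "open_in X U" "x \<in> U" and s: "s \<in> carrier (sec X U)" and t: "t \<in> carrier (sec X U)"
  shows "germ X x U s \<otimes>\<^bsub>stalk X x\<^esub> germ X x U t = germ X x U (s \<otimes>\<^bsub>sec X U\<^esub> t)"
    and "germ X x U s \<oplus>\<^bsub>stalk X x\<^esub> germ X x U t = germ X x U (s \<oplus>\<^bsub>sec X U\<^esub> t)"
proof -
  have *: "germ X x (V \<inter> W) (res X V (V \<inter> W) v \<otimes>\<^bsub>sec X (V \<inter> W)\<^esub> res X W (V \<inter> W) w)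
       = germ X x U (s \<otimes>\<^bsub>sec X U\<^esub> t)"
    "germ X x (V \<inter> W) (res X V (V \<inter> W) v \<oplus>\<^bsub>sec X (V \<inter> W)\<^esub> res X W (V \<inter> W) w)
       = germ X x U (s \<oplus>\<^bsub>sec X U\<^esub> t)"
    if m: "(V, v) \<in> germ X x U s" "(W, w) \<in> germ X x U t" for V v W w
  proof -
    note M1 = germ_memD[OF U s m(1)] and M2 = germ_memD[OF U t m(2)]
    obtain Z where Z: "open_in X Z" "x \<in> Z" "Z \<subseteq> V \<inter> U" "res X V Z v = res X U Z s"
      using M1(4) germ_eq_iff[OF M1(1-3) U s] by blast
    obtain Z' where Z': "open_in X Z'" "x \<in> Z'" "Z' \<subseteq> W \<inter> U" "res X W Z' w = res X U Z' t"
      using M2(4) germ_eq_iff[OF M2(1-3) U t] by blast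
    let ?Z = "Z \<inter> Z'"
    have o: "open_in X ?Z" "open_in X (V \<inter> W)" using Z Z' M1 M2 by blast+
    have "res X V ?Z v = res X Z ?Z (res X V Z v)" using M1 Z o by (intro res_res[symmetric]) auto
    also have "\<dots> = res X U ?Z s" unfolding Z(4) using U s Z o by (intro res_res) auto
    finally have 1: "res X V ?Z v = res X U ?Z s" .
    have "res X W ?Z w = res X Z' ?Z (res X W Z' w)" using M2 Z' o by (intro res_res[symmetric]) auto
    also have "\<dots> = res X U ?Z t" unfolding Z'(4) using U t Z' o by (intro res_res) auto
    finally have 2: "res X W ?Z w = res X U ?Z t" .
    have s1: "?Z \<subseteq> V \<inter> W" "?Z \<subseteq> U" using Z Z' by auto
    interpret h: ring_hom_cring "sec X (V \<inter> W)" "sec X ?Z" "res X (V \<inter> W) ?Z"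
      by (rule res_ring_hom_cring[OF o(2,1) s1(1)])
    interpret k: ring_hom_cring "sec X U" "sec X ?Z" "res X U ?Z"
      by (rule res_ring_hom_cring[OF U(1) o(1) s1(2)])
    have c: "res X V (V \<inter> W) v \<in> carrier (sec X (V \<inter> W))" "res X W (V \<inter> W) w \<in> carrier (sec X (V \<inter> W))"
      using M1 M2 o by (auto intro: res_closed)
    have r: "res X (V \<inter> W) ?Z (res X V (V \<inter> W) v) = res X U ?Z s"
      "res X (V \<inter> W) ?Z (res X W (V \<inter> W) w) = res X U ?Z t"
      using res_res[of V "V \<inter> W" ?Z v] res_res[of W "V \<inter> W" ?Z w] M1 M2 o s1 1 2 by auto
    have x: "x \<in> ?Z" "x \<in> V \<inter> W" using Z Z' M1 M2 by auto
    show "germ X x (V \<inter> W) (res X V (V \<inter> W) v \<otimes>\<^bsub>sec X (V \<inter> W)\<^esub> res X W (V \<inter> W) w)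
       = germ X x U (s \<otimes>\<^bsub>sec X U\<^esub> t)"
      using c s t r x s1 o(1)
      by (subst germ_eq_iff[OF o(2) x(2) _ U]) (auto intro!: exI[of _ ?Z])
    show "germ X x (V \<inter> W) (res X V (V \<inter> W) v \<oplus>\<^bsub>sec X (V \<inter> W)\<^esub> res X W (V \<inter> W) w)
       = germ X x U (s \<oplus>\<^bsub>sec X U\<^esub> t)"
      using c s t r x s1 o(1)
      by (subst germ_eq_iff[OF o(2) x(2) _ U]) (auto intro!: exI[of _ ?Z])
  qed
  have ne: "germ X x U s \<noteq> {}" "germ X x U t \<noteq> {}" using germ_self U s t by blast+
  show "germ X x U s \<otimes>\<^bsub>stalk X x\<^esub> germ X x U t = germ X x U (s \<otimes>\<^bsub>sec X U\<^esub> t)"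
    "germ X x U s \<oplus>\<^bsub>stalk X x\<^esub> germ X x U t = germ X x U (s \<oplus>\<^bsub>sec X U\<^esub> t)"
    using ne * by (simp_all add: stalk_def UN_pairs_const)
qed

lemma open_points: "open_in X (points X)" by simp

lemma germ_one_zero:
  assumes U: "open_in X U" "x \<in> U"
  shows "germ X x U \<one>\<^bsub>sec X U\<^esub> = \<one>\<^bsub>stalk X x\<^esub>" and "germ X x U \<zero>\<^bsub>sec X U\<^esub> = \<zero>\<^bsub>stalk X x\<^esub>"
proof -
  have s: "U \<subseteq> points X" using U openin_subset by blast
  interpret h: ring_hom_cring "sec X (points X)" "sec X U" "res X (points X) U"
    by (rule res_ring_hom_cring[OF open_points U(1) s])
  show "germ X x U \<one>\<^bsub>sec X U\<^esub> = \<one>\<^bsub>stalk X x\<^esub>" "germ X x U \<zero>\<^bsub>sec X U\<^esub> = \<zero>\<^bsub>stalk X x\<^esub>"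
    using germ_res[OF open_points U(1) s U(2), of "\<one>\<^bsub>sec X (points X)\<^esub>"]
      germ_res[OF open_points U(1) s U(2), of "\<zero>\<^bsub>sec X (points X)\<^esub>"]
    by (simp_all add: stalk_def)
qed

lemma stalk_cases_three:
  assumes \<alpha>: "\<alpha> \<in> carrier (stalk X x)" and \<beta>: "\<beta> \<in> carrier (stalk X x)" and \<gamma>: "\<gamma> \<in> carrier (stalk X x)"
  obtains U s t u where "open_in X U" "x \<in> U" "s \<in> carrier (sec X U)" "t \<in> carrier (sec X U)"
    "u \<in> carrier (sec X U)" "\<alpha> = germ X x U s" "\<beta> = germ X x U t" "\<gamma> = germ X x U u"
proof -
  obtain V s t where V: "open_in X V" "x \<in> V" "s \<in> carrier (sec X V)" "t \<in> carrier (sec X V)"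
      "\<alpha> = germ X x V s" "\<beta> = germ X x V t"
    using stalk_cases_two[OF \<alpha> \<beta>] .
  obtain U u where U: "open_in X U" "x \<in> U" "U \<subseteq> V" "u \<in> carrier (sec X U)" "\<gamma> = germ X x U u"
    using stalk_cases_in[OF \<gamma> V(1,2)] .
  show thesis
    using that[of U "res X V U s" "res X V U t" u] U V by (auto intro: res_closed simp: germ_res)
qed

text \<open>Each ring axiom involves at most three germs, and these have representatives on one open
  set, where the axiom is that of the ring of sections. The axioms are grouped by the number of
  germs they mention.\<close>

lemma stalk_cring:
  assumes x: "x \<in> points X"
  shows "cring (stalk X x)"
proof -
  let ?S = "stalk X x"
  have 2: "a \<oplus>\<^bsub>?S\<^esub> b \<in> carrier ?S \<and> a \<otimes>\<^bsub>?S\<^esub> b \<in> carrier ?S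
      \<and> a \<oplus>\<^bsub>?S\<^esub> b = b \<oplus>\<^bsub>?S\<^esub> a \<and> a \<otimes>\<^bsub>?S\<^esub> b = b \<otimes>\<^bsub>?S\<^esub> a"
    if ab: "a \<in> carrier ?S" "b \<in> carrier ?S" for a b
  proof -
    obtain U s t where c: "open_in X U" "s \<in> carrier (sec X U)" "t \<in> carrier (sec X U)" and
        e: "a = germ X x U s" "b = germ X x U t" "x \<in> U"
      using stalk_cases_two[OF ab] by metis
    interpret cring "sec X U" using sec_cring c by blast
    show ?thesis using c e(3) unfolding e(1,2)
      by (auto simp: germ_mult_add m_comm a_comm intro!: germ_closed)
  qed
  have 3: "(a \<oplus>\<^bsub>?S\<^esub> b) \<oplus>\<^bsub>?S\<^esub> c = a \<oplus>\<^bsub>?S\<^esub> (b \<oplus>\<^bsub>?S\<^esub> c)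
      \<and> (a \<otimes>\<^bsub>?S\<^esub> b) \<otimes>\<^bsub>?S\<^esub> c = a \<otimes>\<^bsub>?S\<^esub> (b \<otimes>\<^bsub>?S\<^esub> c)
      \<and> (a \<oplus>\<^bsub>?S\<^esub> b) \<otimes>\<^bsub>?S\<^esub> c = a \<otimes>\<^bsub>?S\<^esub> c \<oplus>\<^bsub>?S\<^esub> b \<otimes>\<^bsub>?S\<^esub> c"
    if abc: "a \<in> carrier ?S" "b \<in> carrier ?S" "c \<in> carrier ?S" for a b c
  proof -
    obtain U s t u where c: "open_in X U" "s \<in> carrier (sec X U)" "t \<in> carrier (sec X U)"
        "u \<in> carrier (sec X U)" and
        e: "a = germ X x U s" "b = germ X x U t" "c = germ X x U u" "x \<in> U"
      using stalk_cases_three[OF abc] by metis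
    interpret cring "sec X U" using sec_cring c by blast
    show ?thesis using c e(4) unfolding e(1-3)
      by (auto simp: germ_mult_add m_assoc a_assoc l_distr)
  qed
  have 1: "\<one>\<^bsub>?S\<^esub> \<otimes>\<^bsub>?S\<^esub> a = a \<and> \<zero>\<^bsub>?S\<^esub> \<oplus>\<^bsub>?S\<^esub> a = a \<and> (\<exists>b\<in>carrier ?S. b \<oplus>\<^bsub>?S\<^esub> a = \<zero>\<^bsub>?S\<^esub>)"
    if a: "a \<in> carrier ?S" for a
  proof -
    obtain U s where c: "open_in X U" "x \<in> U" "s \<in> carrier (sec X U)" and e: "a = germ X x U s"
      using stalk_cases[OF a] by metis
    interpret cring "sec X U" using sec_cring c by blast
    show ?thesis unfolding e germ_one_zero[OF c(1,2), symmetric]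
      using c by (auto simp: germ_mult_add l_neg intro!: germ_closed bexI[of _ "germ X x U (\<ominus>\<^bsub>sec X U\<^esub> s)"])
  qed
  have "\<one>\<^bsub>?S\<^esub> \<in> carrier ?S" "\<zero>\<^bsub>?S\<^esub> \<in> carrier ?S"
    using x by (auto simp: stalk_def intro!: exI[of _ "points X"] cring.cring_simprules sec_cring)
  then show ?thesis
    by (intro cringI abelian_groupI comm_monoidI
        1[THEN conjunct1] 1[THEN conjunct2, THEN conjunct1] 1[THEN conjunct2, THEN conjunct2]
        2[THEN conjunct1] 2[THEN conjunct2, THEN conjunct1]
        2[THEN conjunct2, THEN conjunct2, THEN conjunct1]
        2[THEN conjunct2, THEN conjunct2, THEN conjunct2]
        3[THEN conjunct1] 3[THEN conjunct2, THEN conjunct1] 3[THEN conjunct2, THEN conjunct2])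
qed

lemma germ_hom:
  assumes "open_in X U" "x \<in> U"
  shows "germ X x U \<in> ring_hom (sec X U) (stalk X x)"
  using assms by (intro ring_hom_memI) (auto simp: germ_mult_add germ_one_zero germ_closed)

lemma germ_ring_hom_cring:
  assumes "open_in X U" "x \<in> U"
  shows "ring_hom_cring (sec X U) (stalk X x) (germ X x U)"
proof -
  have "x \<in> points X" using assms openin_subset by blast
  then show ?thesis
    using assms germ_hom sec_cring stalk_cring
    by (intro ring_hom_cringI ring_hom_ringI2) (auto intro: cring.axioms)
qed

lemma germ_pow:
  assumes "open_in X U" "x \<in> U" "s \<in> carrier (sec X U)"
  shows "germ X x U (s [^]\<^bsub>sec X U\<^esub> (n::nat)) = germ X x U s [^]\<^bsub>stalk X x\<^esub> n"
proof -
  interpret ring_hom_cring "sec X U" "stalk X x" "germ X x U" by (rule germ_ring_hom_cring[OF assms(1,2)])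
  show ?thesis using assms(3) by (rule ring.hom_nat_pow)
qed

end

section \<open>Sheaves\<close>

locale sheaf =
  fixes X :: "('a, 'b) rspace"
  assumes ringed: "ringed_space X"

sublocale sheaf \<subseteq> presheaf
  using ringed by unfold_locales (simp add: ringed_space_def)

context sheaf
begin

lemma glue:
  assumes "\<And>U. U \<in> C \<Longrightarrow> open_in X U" "\<And>U. U \<in> C \<Longrightarrow> s U \<in> carrier (sec X U)"
    and "\<And>U V. U \<in> C \<Longrightarrow> V \<in> C \<Longrightarrow> res X U (U \<inter> V) (s U) = res X V (U \<inter> V) (s V)"
  shows "\<exists>t\<in>carrier (sec X (\<Union>C)). \<forall>U\<in>C. res X (\<Union>C) U t = s U"
proof -
  have "\<forall>\<U> s. (\<forall>U\<in>\<U>. open_in X U \<and> s U \<in> carrier (sec X U)) \<and>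
        (\<forall>U\<in>\<U>. \<forall>V\<in>\<U>. res X U (U \<inter> V) (s U) = res X V (U \<inter> V) (s V)) \<longrightarrow>
        (\<exists>t \<in> carrier (sec X (\<Union>\<U>)). \<forall>U\<in>\<U>. res X (\<Union>\<U>) U t = s U)"
    using ringed unfolding ringed_space_def by blast
  note * = this[rule_format, of C s]
  show ?thesis by (rule *) (use assms in blast)
qed

lemma sections_eqI:
  assumes U: "open_in X U" and s: "s \<in> carrier (sec X U)" and t: "t \<in> carrier (sec X U)"
    and "\<And>x. x \<in> U \<Longrightarrow> \<exists>W. open_in X W \<and> x \<in> W \<and> W \<subseteq> U \<and> res X U W s = res X U W t"
  shows "s = t"
proof -
  let ?C = "{W. open_in X W \<and> W \<subseteq> U \<and> res X U W s = res X U W t}"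
  have "\<Union>?C = U" using assms(4) by blast
  moreover have "\<forall>\<U>. (\<forall>U\<in>\<U>. open_in X U) \<longrightarrow>
        (\<forall>s \<in> carrier (sec X (\<Union>\<U>)). \<forall>t \<in> carrier (sec X (\<Union>\<U>)).
           (\<forall>U\<in>\<U>. res X (\<Union>\<U>) U s = res X (\<Union>\<U>) U t) \<longrightarrow> s = t)"
    using ringed unfolding ringed_space_def by blast
  from this[rule_format, of ?C s t] calculation show ?thesis using s t by simp
qed

lemma sections_eq_germsI:
  assumes U: "open_in X U" and s: "s \<in> carrier (sec X U)" and t: "t \<in> carrier (sec X U)"
    and g: "\<And>x. x \<in> U \<Longrightarrow> germ X x U s = germ X x U t"
  shows "s = t"
  by (rule sections_eqI[OF U s t]) (metis g germ_eq_res[OF U _ s t])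

text \<open>Sections with the same germs agree on overlaps, so a locally realizable family of germs
  is already gluing data. Inverses of sections and preimages of sections are later built in this
  way, without tracking compatible local sections.\<close>

lemma glue_germs:
  assumes U: "open_in X U"
    and loc: "\<And>x. x \<in> U \<Longrightarrow> \<exists>W. open_in X W \<and> x \<in> W \<and> W \<subseteq> U \<and>
      (\<exists>s\<in>carrier (sec X W). \<forall>y\<in>W. germ X y W s = \<sigma> y)"
  shows "\<exists>t\<in>carrier (sec X U). \<forall>x\<in>U. germ X x U t = \<sigma> x"
proof -
  define P where "P W s \<longleftrightarrow> s \<in> carrier (sec X W) \<and> (\<forall>y\<in>W. germ X y W s = \<sigma> y)" for W s
  define C where "C = {W. open_in X W \<and> W \<subseteq> U \<and> (\<exists>s. P W s)}"
  \<comment> \<open>The choice is harmless: on \<open>W\<close> the prescribed germs determine the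
    section.\<close>
  define \<tau> where "\<tau> W = (SOME s. P W s)" for W
  have C: "open_in X W" "W \<subseteq> U" "P W (\<tau> W)" if "W \<in> C" for W
    using that someI_ex[of "P W"] unfolding C_def \<tau>_def by auto
  have UC: "\<Union>C = U" using loc unfolding C_def P_def by fast
  have agree: "res X V (V \<inter> W) (\<tau> V) = res X W (V \<inter> W) (\<tau> W)" if VW: "V \<in> C" "W \<in> C" for V W
  proof (rule sections_eq_germsI)
    show o: "open_in X (V \<inter> W)" using C VW by blast
    show "res X V (V \<inter> W) (\<tau> V) \<in> carrier (sec X (V \<inter> W))"
      "res X W (V \<inter> W) (\<tau> W) \<in> carrier (sec X (V \<inter> W))"
      using C[OF VW(1)] C[OF VW(2)] o by (auto simp: P_def intro: res_closed)
    show "germ X x (V \<inter> W) (res X V (V \<inter> W) (\<tau> V)) = germ X x (V \<inter> W) (res X W (V \<inter> W) (\<tau> W))"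
      if "x \<in> V \<inter> W" for x
      using C[OF VW(1)] C[OF VW(2)] o that by (simp add: germ_res P_def)
  qed
  have "\<forall>\<U> s. (\<forall>U\<in>\<U>. open_in X U \<and> s U \<in> carrier (sec X U)) \<and>
        (\<forall>U\<in>\<U>. \<forall>V\<in>\<U>. res X U (U \<inter> V) (s U) = res X V (U \<inter> V) (s V)) \<longrightarrow>
        (\<exists>t \<in> carrier (sec X (\<Union>\<U>)). \<forall>U\<in>\<U>. res X (\<Union>\<U>) U t = s U)"
    using ringed unfolding ringed_space_def by blast
  note glue = this[rule_format, of C \<tau>, unfolded UC]
  have "\<exists>t\<in>carrier (sec X U). \<forall>W\<in>C. res X U W t = \<tau> W"
    by (rule glue) (use agree C in \<open>auto simp: P_def\<close>)
  then obtain t where t: "t \<in> carrier (sec X U)" "\<And>W. W \<in> C \<Longrightarrow> res X U W t = \<tau> W"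
    by blast
  have "germ X x U t = \<sigma> x" if x: "x \<in> U" for x
  proof -
    obtain W where W: "W \<in> C" "x \<in> W" using x UC by blast
    then have "germ X x U t = germ X x W (res X U W t)" using C[OF W(1)] t U W(2) by (intro germ_res[symmetric]) auto
    also have "\<dots> = \<sigma> x" using W C t by (simp add: P_def)
    finally show ?thesis .
  qed
  then show ?thesis using t by blast
qed

end

section \<open>Locally ringed spaces\<close>

text \<open>This is the set usually written D(s): in a locally ringed space, the points of
  \<open>U\<close> at which \<open>s\<close> is invertible.\<close>

definition nonvanishing :: "('a, 'b) rspace \<Rightarrow> 'a set \<Rightarrow> 'b \<Rightarrow> 'a set" where
  "nonvanishing X U s = {x \<in> U. germ X x U s \<notin> max_ideal (stalk X x)}"

locale lrs =
  fixes X :: "('a, 'b) rspace"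
  assumes lrs: "locally_ringed_space X"

sublocale lrs \<subseteq> sheaf
  using lrs by unfold_locales (simp add: locally_ringed_space_def)

context lrs
begin

lemma local_stalk: "x \<in> points X \<Longrightarrow> local_ring (stalk X x)"
  using lrs unfolding locally_ringed_space_def by blast

text \<open>Spreading out: an inverse of the germ is represented by a section near \<open>x\<close>,
  and the equation saying that the product is one holds on a smaller neighbourhood. The right side
  mentions no stalk, which makes it usable for comparing a space with an open subspace.\<close>

lemma germ_unit_iff:
  assumes U: "open_in X U" "x \<in> U" "s \<in> carrier (sec X U)"
  shows "germ X x U s \<in> Units (stalk X x) \<longleftrightarrow>
    (\<exists>W. open_in X W \<and> x \<in> W \<and> W \<subseteq> U \<and> res X U W s \<in> Units (sec X W))" (is "_ \<longleftrightarrow> ?R")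
proof
  have xp: "x \<in> points X" using U openin_subset by blast
  interpret S: cring "stalk X x" by (rule stalk_cring[OF xp])
  {
    assume u: "germ X x U s \<in> Units (stalk X x)"
    let ?i = "inv\<^bsub>stalk X x\<^esub> (germ X x U s)"
    obtain V t where V: "open_in X V" "x \<in> V" "V \<subseteq> U" "t \<in> carrier (sec X V)" "?i = germ X x V t"
      using stalk_cases_in[OF S.Units_inv_closed[OF u] U(1,2)] .
    interpret V: cring "sec X V" by (rule sec_cring[OF V(1)])
    have c: "res X U V s \<in> carrier (sec X V)" using U V by (intro res_closed)
    have "germ X x V (res X U V s \<otimes>\<^bsub>sec X V\<^esub> t) = germ X x U s \<otimes>\<^bsub>stalk X x\<^esub> ?i"
      using U V c by (simp add: germ_mult_add[symmetric] germ_res)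
    also have "\<dots> = germ X x V \<one>\<^bsub>sec X V\<^esub>" using S.Units_r_inv[OF u] V(1,2) by (simp only: germ_one_zero)
    finally obtain W where W: "open_in X W" "x \<in> W" "W \<subseteq> V"
      "res X V W (res X U V s \<otimes>\<^bsub>sec X V\<^esub> t) = res X V W \<one>\<^bsub>sec X V\<^esub>"
      using V c by (elim germ_eq_res[rotated 4]) auto
    interpret h: ring_hom_cring "sec X V" "sec X W" "res X V W"
      by (rule res_ring_hom_cring[OF V(1) W(1,3)])
    have "res X U W s \<otimes>\<^bsub>sec X W\<^esub> res X V W t = \<one>\<^bsub>sec X W\<^esub>"
      using W(4) c V(4) res_res[OF U(1) V(1) W(1) W(3) V(3) U(3)] by simp
    moreover have "res X U W s \<in> carrier (sec X W)" using U V W by (intro res_closed) auto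
    ultimately have "res X U W s \<in> Units (sec X W)"
      using V(4) by (intro h.S.UnitsI_right_inverse[of _ "res X V W t"]) auto
    then show ?R using W V by blast
  next
    assume ?R
    then obtain W where W: "open_in X W" "x \<in> W" "W \<subseteq> U" "res X U W s \<in> Units (sec X W)" by blast
    interpret h: ring_hom_cring "sec X W" "stalk X x" "germ X x W"
      by (rule germ_ring_hom_cring[OF W(1,2)])
    obtain t where t: "t \<in> carrier (sec X W)" "t \<otimes>\<^bsub>sec X W\<^esub> res X U W s = \<one>\<^bsub>sec X W\<^esub>"
      using W(4) unfolding Units_def by blast
    have c: "res X U W s \<in> carrier (sec X W)" using W(4) by blast
    have "germ X x W t \<otimes>\<^bsub>stalk X x\<^esub> germ X x U s = \<one>\<^bsub>stalk X x\<^esub>"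
      using t c h.hom_mult[OF t(1) c] h.hom_one germ_res[OF U(1) W(1,3,2) U(3)] by simp
    then show "germ X x U s \<in> Units (stalk X x)"
      using germ_closed[OF U] germ_closed[OF W(1,2) t(1)] S.m_comm
      by (intro S.UnitsI_right_inverse[of _ "germ X x W t"]) auto
  }
qed

lemma nonvanishing_iff_unit:
  assumes "open_in X U" "x \<in> U" "s \<in> carrier (sec X U)"
  shows "x \<in> nonvanishing X U s \<longleftrightarrow> germ X x U s \<in> Units (stalk X x)"
proof -
  have "x \<in> points X" using assms openin_subset by blast
  then show ?thesis
    using max_ideal_iff_nonunit[OF local_stalk germ_closed[OF assms]] assms by (simp add: nonvanishing_def)
qed

lemma nonvanishing_iff:
  assumes "open_in X U" "s \<in> carrier (sec X U)"
  shows "x \<in> nonvanishing X U s \<longleftrightarrow>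
    (\<exists>W. open_in X W \<and> x \<in> W \<and> W \<subseteq> U \<and> res X U W s \<in> Units (sec X W))"
  using assms nonvanishing_iff_unit germ_unit_iff by (cases "x \<in> U") (auto simp: nonvanishing_def)

lemma nonvanishing_subset: "nonvanishing X U s \<subseteq> U"
  by (auto simp: nonvanishing_def)

lemma nonvanishing_open:
  assumes "open_in X U" "s \<in> carrier (sec X U)"
  shows "open_in X (nonvanishing X U s)"
proof (subst openin_subopen, intro ballI)
  fix x assume "x \<in> nonvanishing X U s"
  then obtain W where W: "open_in X W" "x \<in> W" "W \<subseteq> U" "res X U W s \<in> Units (sec X W)"
    using nonvanishing_iff[OF assms] by blast
  then have "W \<subseteq> nonvanishing X U s" using nonvanishing_iff[OF assms] by blast
  then show "\<exists>T. open_in X T \<and> x \<in> T \<and> T \<subseteq> nonvanishing X U s" using W by blast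
qed

text \<open>Inverses are unique, so the inverses of the germs are a prescribed family of germs that
  is locally realized by inverse sections.\<close>

lemma section_unitI:
  assumes U: "open_in X U" and s: "s \<in> carrier (sec X U)"
    and u: "\<And>x. x \<in> U \<Longrightarrow> germ X x U s \<in> Units (stalk X x)"
  shows "s \<in> Units (sec X U)"
proof -
  interpret U: cring "sec X U" by (rule sec_cring[OF U])
  have "\<exists>t\<in>carrier (sec X U). \<forall>x\<in>U. germ X x U t = inv\<^bsub>stalk X x\<^esub> (germ X x U s)"
  proof (rule glue_germs[OF U])
    fix x assume x: "x \<in> U"
    obtain W where W: "open_in X W" "x \<in> W" "W \<subseteq> U" "res X U W s \<in> Units (sec X W)"
      using germ_unit_iff[OF U x s] u[OF x] by blast
    interpret W: cring "sec X W" by (rule sec_cring[OF W(1)])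
    let ?t = "inv\<^bsub>sec X W\<^esub> (res X U W s)"
    have t: "?t \<in> carrier (sec X W)" and c: "res X U W s \<in> carrier (sec X W)" using W(4) by auto
    have "germ X y W ?t = inv\<^bsub>stalk X y\<^esub> (germ X y U s)" if y: "y \<in> W" for y
    proof -
      have yp: "y \<in> points X" using y W openin_subset by blast
      interpret S: cring "stalk X y" by (rule stalk_cring[OF yp])
      have yU: "y \<in> U" using y W by blast
      have "germ X y W ?t \<otimes>\<^bsub>stalk X y\<^esub> germ X y W (res X U W s) = germ X y W (\<one>\<^bsub>sec X W\<^esub>)"
        using germ_mult_add(1)[OF W(1) y t c] W(4) by simp
      then have "germ X y W ?t \<otimes>\<^bsub>stalk X y\<^esub> germ X y U s = \<one>\<^bsub>stalk X y\<^esub>"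
        using germ_res[OF U W(1,3) y s] germ_one_zero[OF W(1) y] by simp
      then show ?thesis
        using S.inv_char[of "germ X y U s" "germ X y W ?t"] S.m_comm germ_closed[OF U yU s]
          germ_closed[OF W(1) y t] by simp
    qed
    then show "\<exists>W. open_in X W \<and> x \<in> W \<and> W \<subseteq> U \<and>
      (\<exists>t\<in>carrier (sec X W). \<forall>y\<in>W. germ X y W t = inv\<^bsub>stalk X y\<^esub> (germ X y U s))"
      using W t by blast
  qed
  then obtain t where t: "t \<in> carrier (sec X U)"
    "\<And>x. x \<in> U \<Longrightarrow> germ X x U t = inv\<^bsub>stalk X x\<^esub> (germ X x U s)" by blast
  have "s \<otimes>\<^bsub>sec X U\<^esub> t = \<one>\<^bsub>sec X U\<^esub>"
  proof (rule sections_eq_germsI[OF U])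
    fix x assume x: "x \<in> U"
    then have "x \<in> points X" using U openin_subset by blast
    then interpret S: cring "stalk X x" by (rule stalk_cring)
    show "germ X x U (s \<otimes>\<^bsub>sec X U\<^esub> t) = germ X x U \<one>\<^bsub>sec X U\<^esub>"
      using u[OF x] by (simp add: germ_mult_add(1)[OF U x s t(1), symmetric] t(2)[OF x] germ_one_zero[OF U x])
  qed (use s t in auto)
  then show ?thesis using s t(1) by (rule U.UnitsI_right_inverse[rotated 2])
qed

lemma res_nonvanishing_unit:
  assumes U: "open_in X U" and s: "s \<in> carrier (sec X U)"
    and W: "open_in X W" "W \<subseteq> nonvanishing X U s"
  shows "res X U W s \<in> Units (sec X W)"
proof (rule section_unitI[OF W(1)])
  have WU: "W \<subseteq> U" using W nonvanishing_subset by blast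
  then show "res X U W s \<in> carrier (sec X W)" using U s W by (intro res_closed)
  fix x assume "x \<in> W"
  then show "germ X x W (res X U W s) \<in> Units (stalk X x)"
    using W WU U s germ_res nonvanishing_iff_unit by (metis subset_iff)
qed

lemma nonvanishing_mult:
  assumes U: "open_in X U" and s: "s \<in> carrier (sec X U)" and t: "t \<in> carrier (sec X U)"
  shows "nonvanishing X U (s \<otimes>\<^bsub>sec X U\<^esub> t) = nonvanishing X U s \<inter> nonvanishing X U t"
proof -
  have "germ X x U (s \<otimes>\<^bsub>sec X U\<^esub> t) \<in> max_ideal (stalk X x) \<longleftrightarrow>
      germ X x U s \<in> max_ideal (stalk X x) \<or> germ X x U t \<in> max_ideal (stalk X x)" if x: "x \<in> U" for x
  proof -
    have "x \<in> points X" using x U openin_subset by blast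
    then interpret P: primeideal "max_ideal (stalk X x)" "stalk X x"
      by (intro max_ideal_prime local_stalk)
    show ?thesis
      unfolding germ_mult_add(1)[OF U x s t, symmetric]
      using P.I_prime[OF germ_closed[OF U x s] germ_closed[OF U x t]]
        P.I_l_closed[OF _ germ_closed[OF U x s]] P.I_r_closed[OF _ germ_closed[OF U x t]] by blast
  qed
  then show ?thesis unfolding nonvanishing_def by blast
qed

lemma nonvanishing_one:
  assumes U: "open_in X U"
  shows "nonvanishing X U \<one>\<^bsub>sec X U\<^esub> = U"
proof -
  have "\<one>\<^bsub>sec X U\<^esub> \<in> carrier (sec X U)" using sec_cring[OF U] by (simp add: cring.cring_simprules)
  moreover have "\<one>\<^bsub>stalk X x\<^esub> \<in> Units (stalk X x)" if "x \<in> U" for x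
  proof -
    have "x \<in> points X" using that U openin_subset by blast
    then interpret cring "stalk X x" by (rule stalk_cring)
    show ?thesis by simp
  qed
  ultimately show ?thesis
    using nonvanishing_iff_unit[OF U] nonvanishing_subset germ_one_zero[OF U] by (metis subsetI subset_antisym)
qed

text \<open>Only an inclusion, because for the exponent 0 the right side is all of
  \<open>U\<close>.\<close>

lemma nonvanishing_pow:
  assumes U: "open_in X U" and s: "s \<in> carrier (sec X U)"
  shows "nonvanishing X U s \<subseteq> nonvanishing X U (s [^]\<^bsub>sec X U\<^esub> (n::nat))"
proof (induction n)
  case 0
  then show ?case using nonvanishing_one[OF U] nonvanishing_subset by simp
next
  case (Suc n)
  interpret cring "sec X U" by (rule sec_cring[OF U])
  show ?case using Suc nonvanishing_mult[OF U, of "s [^]\<^bsub>sec X U\<^esub> n" s] s by auto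
qed

end

section \<open>Morphisms\<close>

locale rs_mor =
  fixes X :: "('a, 'b) rspace" and Y :: "('c, 'd) rspace" and f :: "('a, 'b, 'c, 'd) rs_map"
  assumes mor: "rs_morphism X Y f"

sublocale rs_mor \<subseteq> src: sheaf X
  using mor by unfold_locales (simp add: rs_morphism_def)

sublocale rs_mor \<subseteq> tgt: sheaf Y
  using mor by unfold_locales (simp add: rs_morphism_def)

lemma mem_preim [simp]: "x \<in> preim X f V \<longleftrightarrow> x \<in> points X \<and> pt f x \<in> V"
  by (simp add: preim_def)

lemma preim_mono: "V \<subseteq> W \<Longrightarrow> preim X f V \<subseteq> preim X f W"
  by auto

context rs_mor
begin

lemma pt_closed: "x \<in> points X \<Longrightarrow> pt f x \<in> points Y"
  using mor unfolding rs_morphism_def continuous_map_def by blast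

lemma preim_open: "open_in Y V \<Longrightarrow> open_in X (preim X f V)"
  using mor by (simp add: rs_morphism_def continuous_map_def preim_def)

lemma shm_hom: "open_in Y V \<Longrightarrow> shm f V \<in> ring_hom (sec Y V) (sec X (preim X f V))"
  using mor by (simp add: rs_morphism_def)

lemma shm_closed:
  "open_in Y V \<Longrightarrow> s \<in> carrier (sec Y V) \<Longrightarrow> shm f V s \<in> carrier (sec X (preim X f V))"
  by (rule ring_hom_closed[OF shm_hom])

lemma shm_res:
  "open_in Y V \<Longrightarrow> open_in Y W \<Longrightarrow> W \<subseteq> V \<Longrightarrow> s \<in> carrier (sec Y V) \<Longrightarrow>
    shm f W (res Y V W s) = res X (preim X f V) (preim X f W) (shm f V s)"
  using mor by (simp add: rs_morphism_def)

lemma shm_ring_hom_cring: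
  assumes "open_in Y V"
  shows "ring_hom_cring (sec Y V) (sec X (preim X f V)) (shm f V)"
  using assms shm_hom tgt.sec_cring src.sec_cring preim_open
  by (intro ring_hom_cringI ring_hom_ringI2) (auto intro: cring.axioms)

lemma stalk_map_germ:
  assumes x: "x \<in> points X" and V: "open_in Y V" "pt f x \<in> V" "s \<in> carrier (sec Y V)"
  shows "stalk_map X f x (germ Y (pt f x) V s) = germ X x (preim X f V) (shm f V s)"
proof -
  have "germ X x (preim X f V') (shm f V' s') = germ X x (preim X f V) (shm f V s)"
    if m: "(V', s') \<in> germ Y (pt f x) V s" for V' s'
  proof -
    note M = tgt.germ_memD[OF V m]
    obtain W where W: "open_in Y W" "pt f x \<in> W" "W \<subseteq> V' \<inter> V" "res Y V' W s' = res Y V W s"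
      using M(4) tgt.germ_eq_iff[OF M(1-3) V] by blast
    have "germ X x (preim X f V') (shm f V' s')
        = germ X x (preim X f W) (res X (preim X f V') (preim X f W) (shm f V' s'))"
      using x M W by (intro src.germ_res[symmetric] preim_open shm_closed preim_mono) auto
    also have "\<dots> = germ X x (preim X f W) (shm f W (res Y V' W s'))"
      using M W by (subst shm_res) auto
    also have "\<dots> = germ X x (preim X f W) (res X (preim X f V) (preim X f W) (shm f V s))"
      unfolding W(4) using V W by (subst shm_res) auto
    also have "\<dots> = germ X x (preim X f V) (shm f V s)"
      using x V W by (intro src.germ_res preim_open shm_closed preim_mono) auto
    finally show ?thesis .
  qed
  moreover have "germ Y (pt f x) V s \<noteq> {}" using tgt.germ_self[OF V] by blast
  ultimately show ?thesis
    unfolding stalk_map_def by (intro UN_pairs_const)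
qed

lemma stalk_map_hom:
  assumes x: "x \<in> points X"
  shows "stalk_map X f x \<in> ring_hom (stalk Y (pt f x)) (stalk X x)"
proof (rule ring_hom_memI)
  show "stalk_map X f x \<alpha> \<in> carrier (stalk X x)" if \<alpha>: "\<alpha> \<in> carrier (stalk Y (pt f x))" for \<alpha>
    using \<alpha> x by (elim tgt.stalk_cases)
      (auto simp: stalk_map_germ intro!: src.germ_closed shm_closed preim_open)
  show "stalk_map X f x (\<alpha> \<otimes>\<^bsub>stalk Y (pt f x)\<^esub> \<beta>) = stalk_map X f x \<alpha> \<otimes>\<^bsub>stalk X x\<^esub> stalk_map X f x \<beta>"
    "stalk_map X f x (\<alpha> \<oplus>\<^bsub>stalk Y (pt f x)\<^esub> \<beta>) = stalk_map X f x \<alpha> \<oplus>\<^bsub>stalk X x\<^esub> stalk_map X f x \<beta>"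
    if ab: "\<alpha> \<in> carrier (stalk Y (pt f x))" "\<beta> \<in> carrier (stalk Y (pt f x))" for \<alpha> \<beta>
  proof -
    obtain V s t where V: "open_in Y V" "pt f x \<in> V" "s \<in> carrier (sec Y V)" "t \<in> carrier (sec Y V)"
        "\<alpha> = germ Y (pt f x) V s" "\<beta> = germ Y (pt f x) V t"
      using tgt.stalk_cases_two[OF ab] .
    interpret h: ring_hom_cring "sec Y V" "sec X (preim X f V)" "shm f V"
      by (rule shm_ring_hom_cring[OF V(1)])
    have x': "x \<in> preim X f V" using x V by simp
    show "stalk_map X f x (\<alpha> \<otimes>\<^bsub>stalk Y (pt f x)\<^esub> \<beta>) = stalk_map X f x \<alpha> \<otimes>\<^bsub>stalk X x\<^esub> stalk_map X f x \<beta>"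
      "stalk_map X f x (\<alpha> \<oplus>\<^bsub>stalk Y (pt f x)\<^esub> \<beta>) = stalk_map X f x \<alpha> \<oplus>\<^bsub>stalk X x\<^esub> stalk_map X f x \<beta>"
      unfolding V(5,6) using V(1-4) x x' preim_open[OF V(1)]
      by (simp_all add: tgt.germ_mult_add src.germ_mult_add stalk_map_germ)
  qed
  interpret h: ring_hom_cring "sec Y (points Y)" "sec X (preim X f (points Y))" "shm f (points Y)"
    by (rule shm_ring_hom_cring) simp
  have "x \<in> preim X f (points Y)" using x pt_closed by simp
  then have "stalk_map X f x (germ Y (pt f x) (points Y) \<one>\<^bsub>sec Y (points Y)\<^esub>) = \<one>\<^bsub>stalk X x\<^esub>"
    using x preim_open[of "points Y"] pt_closed src.germ_one_zero by (simp add: stalk_map_germ)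
  then show "stalk_map X f x \<one>\<^bsub>stalk Y (pt f x)\<^esub> = \<one>\<^bsub>stalk X x\<^esub>"
    using tgt.germ_one_zero(1)[of "points Y"] x pt_closed by simp
qed

lemma stalk_map_ring_hom_cring:
  assumes "x \<in> points X"
  shows "ring_hom_cring (stalk Y (pt f x)) (stalk X x) (stalk_map X f x)"
  using assms stalk_map_hom tgt.stalk_cring src.stalk_cring pt_closed
  by (intro ring_hom_cringI ring_hom_ringI2) (auto intro: cring.axioms)

end

section \<open>Composition of morphisms and equality up to \<open>rs_eq\<close>\<close>

lemma rs_eq_sym: "rs_eq X Y f g \<Longrightarrow> rs_eq X Y g f"
  and rs_eq_trans: "rs_eq X Y f g \<Longrightarrow> rs_eq X Y g h \<Longrightarrow> rs_eq X Y f h"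
  by (simp_all add: rs_eq_def)

lemma rs_eq_preim: "rs_eq X Y f g \<Longrightarrow> preim X f V = preim X g V"
  by (auto simp: rs_eq_def)

text \<open>Raw maps that are equal as morphisms may differ outside points, open sets and sections,
  so each property of morphisms has to be carried across \<open>rs_eq\<close> explicitly.\<close>

lemma rs_morphism_cong:
  assumes f: "rs_morphism X Y f" and fg: "rs_eq X Y f g"
  shows "rs_morphism X Y g"
proof -
  interpret rs_mor X Y f by unfold_locales fact
  have shm: "shm g V s = shm f V s" if "open_in Y V" "s \<in> carrier (sec Y V)" for V s
    using fg that by (simp add: rs_eq_def)
  have "continuous_map (top_sp X) (top_sp Y) (pt g)"
    using f fg by (auto simp: rs_morphism_def rs_eq_def intro: continuous_map_eq)
  moreover have "shm g V \<in> ring_hom (sec Y V) (sec X (preim X f V))" if V: "open_in Y V" for V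
  proof -
    interpret cring "sec Y V" by (rule tgt.sec_cring[OF V])
    show ?thesis
      using shm[OF V] shm_hom[OF V] unfolding ring_hom_def by auto
  qed
  ultimately show ?thesis
    using src.ringed tgt.ringed shm shm_res tgt.res_closed
    by (simp add: rs_morphism_def rs_eq_preim[OF fg, symmetric])
qed

lemma stalk_map_cong:
  assumes f: "rs_morphism X Y f" and fg: "rs_eq X Y f g" and x: "x \<in> points X"
    and \<alpha>: "\<alpha> \<in> carrier (stalk Y (pt f x))"
  shows "stalk_map X g x \<alpha> = stalk_map X f x \<alpha>"
proof -
  interpret f: rs_mor X Y f by unfold_locales fact
  interpret g: rs_mor X Y g by unfold_locales (rule rs_morphism_cong[OF f fg])
  obtain V s where V: "open_in Y V" "pt f x \<in> V" "s \<in> carrier (sec Y V)" "\<alpha> = germ Y (pt f x) V s"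
    using f.tgt.stalk_cases[OF \<alpha>] .
  have "pt g x = pt f x" using fg x by (simp add: rs_eq_def)
  then show ?thesis
    using f.stalk_map_germ[OF x V(1-3)] g.stalk_map_germ[OF x V(1), of s] V fg
    by (simp add: rs_eq_preim[OF fg] rs_eq_def)
qed

lemma lrs_morphism_cong:
  assumes f: "lrs_morphism X Y f" and fg: "rs_eq X Y f g"
  shows "lrs_morphism X Y g"
proof -
  have m: "rs_morphism X Y f" using f by (simp add: lrs_morphism_def)
  interpret g: rs_mor X Y g by unfold_locales (rule rs_morphism_cong[OF m fg])
  have "local_hom (stalk Y (pt g x)) (stalk X x) (stalk_map X g x)" if x: "x \<in> points X" for x
  proof -
    have e: "pt g x = pt f x" using fg x by (simp add: rs_eq_def)
    have "contraction (stalk Y (pt f x)) (stalk_map X g x) z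
        = contraction (stalk Y (pt f x)) (stalk_map X f x) z" for z
      using stalk_map_cong[OF m fg x] unfolding contraction_def by auto
    then show ?thesis
      using f x g.stalk_map_hom[OF x] unfolding lrs_morphism_def local_hom_def e by simp
  qed
  then show ?thesis using f g.mor unfolding lrs_morphism_def by blast
qed

lemma preim_comp:
  assumes "rs_morphism X Y f"
  shows "preim X (rs_comp Y g f) W = preim X f (preim Y g W)"
proof -
  interpret rs_mor X Y f by unfold_locales fact
  show ?thesis using pt_closed by (auto simp: rs_comp_def)
qed

lemma rs_morphism_comp:
  assumes f: "rs_morphism X Y f" and g: "rs_morphism Y Z g"
  shows "rs_morphism X Z (rs_comp Y g f)"
proof -
  interpret f: rs_mor X Y f by unfold_locales fact
  interpret g: rs_mor Y Z g by unfold_locales fact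
  have "continuous_map (top_sp X) (top_sp Z) (pt g \<circ> pt f)"
    using f g by (intro continuous_map_compose) (auto simp: rs_morphism_def)
  moreover have "(shm f (preim Y g W) \<circ> shm g W) \<in> ring_hom (sec Z W) (sec X (preim X f (preim Y g W)))"
    if "open_in Z W" for W
    using that by (intro ring_hom_trans[OF g.shm_hom f.shm_hom] g.preim_open)
  ultimately show ?thesis
    using f.src.ringed g.tgt.ringed
    unfolding rs_morphism_def preim_comp[OF f]
    by (simp add: rs_comp_def comp_def g.shm_res f.shm_res g.shm_closed g.preim_open preim_mono)
qed

lemma stalk_map_comp:
  assumes f: "rs_morphism X Y f" and g: "rs_morphism Y Z g" and x: "x \<in> points X"
    and \<alpha>: "\<alpha> \<in> carrier (stalk Z (pt g (pt f x)))"
  shows "stalk_map X (rs_comp Y g f) x \<alpha> = stalk_map X f x (stalk_map Y g (pt f x) \<alpha>)"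
proof -
  interpret f: rs_mor X Y f by unfold_locales fact
  interpret g: rs_mor Y Z g by unfold_locales fact
  interpret gf: rs_mor X Z "rs_comp Y g f" by unfold_locales (rule rs_morphism_comp[OF f g])
  obtain V s where V: "open_in Z V" "pt g (pt f x) \<in> V" "s \<in> carrier (sec Z V)"
      "\<alpha> = germ Z (pt g (pt f x)) V s"
    using g.tgt.stalk_cases[OF \<alpha>] .
  have "stalk_map X (rs_comp Y g f) x \<alpha> = germ X x (preim X f (preim Y g V)) (shm f (preim Y g V) (shm g V s))"
    using gf.stalk_map_germ[OF x V(1), of s] V by (simp add: preim_comp[OF f]) (simp add: rs_comp_def)
  also have "\<dots> = stalk_map X f x (stalk_map Y g (pt f x) \<alpha>)"
    using V x f.pt_closed[OF x] by (simp add: g.stalk_map_germ f.stalk_map_germ g.preim_open g.shm_closed)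
  finally show ?thesis .
qed

lemma rs_morphism_id: "ringed_space X \<Longrightarrow> rs_morphism X X rs_id"
proof -
  assume X: "ringed_space X"
  interpret sheaf X by unfold_locales fact
  have "preim X rs_id V = V" if "open_in X V" for V
    using openin_subset[OF that] by (auto simp: rs_id_def)
  then show ?thesis
    using X by (auto simp: rs_morphism_def rs_id_def intro!: ring_hom_memI)
qed

lemma stalk_map_id:
  assumes X: "ringed_space X" and x: "x \<in> points X" and \<alpha>: "\<alpha> \<in> carrier (stalk X x)"
  shows "stalk_map X rs_id x \<alpha> = \<alpha>"
proof -
  interpret rs_mor X X rs_id by unfold_locales (rule rs_morphism_id[OF X])
  obtain V s where V: "open_in X V" "x \<in> V" "s \<in> carrier (sec X V)" "\<alpha> = germ X x V s"
    using src.stalk_cases[OF \<alpha>] .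
  have "preim X rs_id V = V" using openin_subset[OF V(1)] by (auto simp: rs_id_def)
  then show ?thesis using stalk_map_germ[OF x V(1), of s] V by (simp add: rs_id_def)
qed

lemma contraction_comp:
  fixes R :: "'r ring" and S :: "'s ring"
  assumes "\<And>r. r \<in> carrier R \<Longrightarrow> h r = k (g r)" and "\<And>r. r \<in> carrier R \<Longrightarrow> g r \<in> carrier S"
  shows "contraction R h z = contraction R g (contraction S k z)"
  using assms by (auto simp: contraction_def)

lemma lrs_morphism_comp:
  assumes f: "lrs_morphism X Y f" and g: "lrs_morphism Y Z g"
  shows "lrs_morphism X Z (rs_comp Y g f)"
proof -
  have fm: "rs_morphism X Y f" and gm: "rs_morphism Y Z g" using f g by (simp_all add: lrs_morphism_def)
  interpret f: rs_mor X Y f by unfold_locales fact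
  interpret g: rs_mor Y Z g by unfold_locales fact
  interpret gf: rs_mor X Z "rs_comp Y g f" by unfold_locales (rule rs_morphism_comp[OF fm gm])
  have "local_hom (stalk Z (pt (rs_comp Y g f) x)) (stalk X x) (stalk_map X (rs_comp Y g f) x)"
    if x: "x \<in> points X" for x
  proof -
    have e: "pt (rs_comp Y g f) x = pt g (pt f x)" by (simp add: rs_comp_def)
    have "contraction (stalk Z (pt g (pt f x))) (stalk_map X (rs_comp Y g f) x) z =
        contraction (stalk Z (pt g (pt f x))) (stalk_map Y g (pt f x))
          (contraction (stalk Y (pt f x)) (stalk_map X f x) z)" for z
      using stalk_map_comp[OF fm gm x] ring_hom_closed[OF g.stalk_map_hom[OF f.pt_closed[OF x]]]
      by (intro contraction_comp)
    then show ?thesis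
      using f g x f.pt_closed[OF x] gf.stalk_map_hom[OF x] unfolding lrs_morphism_def local_hom_def e by simp
  qed
  then show ?thesis using f g gf.mor unfolding lrs_morphism_def by blast
qed

lemma rs_comp_cong_left:
  assumes "rs_morphism X Y f" and g: "rs_eq Y Z g g'"
  shows "rs_eq X Z (rs_comp Y g f) (rs_comp Y g' f)"
proof -
  interpret rs_mor X Y f by unfold_locales fact
  show ?thesis using g pt_closed by (simp add: rs_eq_def[of X] rs_comp_def rs_eq_preim[OF g]) (simp add: rs_eq_def)
qed

lemma rs_comp_cong_right:
  assumes "rs_morphism Y Z g" and f: "rs_eq X Y f f'"
  shows "rs_eq X Z (rs_comp Y g f) (rs_comp Y g f')"
proof -
  interpret rs_mor Y Z g by unfold_locales fact
  show ?thesis using f shm_closed preim_open by (simp add: rs_eq_def rs_comp_def)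
qed

lemma rs_comp_assoc:
  assumes "rs_morphism Y Z g"
  shows "rs_eq X W (rs_comp Z h (rs_comp Y g f)) (rs_comp Y (rs_comp Z h g) f)"
  using preim_comp[OF assms, of h] by (simp add: rs_eq_def rs_comp_def)

lemma rs_comp_id_left:
  assumes "rs_morphism X Y f"
  shows "rs_eq X Y (rs_comp Y rs_id f) f"
proof -
  have "preim Y rs_id V = V" if "open_in Y V" for V
    using openin_subset[OF that] by (auto simp: rs_id_def)
  then show ?thesis by (simp add: rs_eq_def rs_comp_def) (simp add: rs_id_def)
qed

lemma rs_comp_id_right: "rs_eq X Y (rs_comp X f rs_id) f"
  by (simp add: rs_eq_def rs_comp_def rs_id_def)

section \<open>Morphisms of locally ringed spaces and nonvanishing sets\<close>

locale lrs_mor =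
  fixes X :: "('a, 'b) rspace" and Y :: "('c, 'd) rspace" and f :: "('a, 'b, 'c, 'd) rs_map"
  assumes lrs_mor: "lrs_morphism X Y f"

sublocale lrs_mor \<subseteq> rs_mor
  using lrs_mor by unfold_locales (simp add: lrs_morphism_def)

sublocale lrs_mor \<subseteq> src: lrs X
  using lrs_mor by unfold_locales (simp add: lrs_morphism_def)

sublocale lrs_mor \<subseteq> tgt: lrs Y
  using lrs_mor by unfold_locales (simp add: lrs_morphism_def)

context lrs_mor
begin

lemma stalk_map_mem_max_ideal_iff:
  assumes "x \<in> points X" "\<alpha> \<in> carrier (stalk Y (pt f x))"
  shows "stalk_map X f x \<alpha> \<in> max_ideal (stalk X x) \<longleftrightarrow> \<alpha> \<in> max_ideal (stalk Y (pt f x))"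
  using lrs_mor assms unfolding lrs_morphism_def local_hom_def contraction_def by blast

lemma preim_nonvanishing:
  assumes "open_in Y V" "s \<in> carrier (sec Y V)"
  shows "preim X f (nonvanishing Y V s) = nonvanishing X (preim X f V) (shm f V s)"
  using assms stalk_map_mem_max_ideal_iff
  by (auto simp: nonvanishing_def stalk_map_germ[symmetric] tgt.germ_closed)

end

section \<open>Transport of structure\<close>

text \<open>The isomorphism is given as a pair of homomorphisms that are inverse on the carriers,
  because mutually inverse morphisms of spaces yield their stalk maps in this form.\<close>

lemma maximalideal_contraction_iso:
  fixes R :: "'r ring" and S :: "'s ring"
  assumes R: "cring R" and S: "cring S" and h: "h \<in> ring_hom R S" and k: "k \<in> ring_hom S R"
    and kh: "\<And>r. r \<in> carrier R \<Longrightarrow> k (h r) = r" and hk: "\<And>s. s \<in> carrier S \<Longrightarrow> h (k s) = s"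
    and n: "maximalideal n S"
  shows "maximalideal (contraction R h n) R"
proof -
  interpret h: ring_hom_cring R S h
    using R S h by (intro ring_hom_cringI ring_hom_ringI2) (auto intro: cring.axioms)
  interpret k: ring_hom_cring S R k
    using R S k by (intro ring_hom_cringI ring_hom_ringI2) (auto intro: cring.axioms)
  interpret n: maximalideal n S by fact
  show ?thesis
  proof (rule maximalidealI)
    show "ideal (contraction R h n) R"
      unfolding contraction_def by (rule h.ring.ideal_vimage[OF n.is_ideal])
    have "h \<one>\<^bsub>R\<^esub> \<notin> n" using n.one_imp_carrier n.I_notcarr by auto
    then have "\<one>\<^bsub>R\<^esub> \<notin> contraction R h n" by (simp add: contraction_def)
    then show "carrier R \<noteq> contraction R h n" using h.R.one_closed by blast
    fix J assume J: "ideal J R" "contraction R h n \<subseteq> J" "J \<subseteq> carrier R"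
    have i: "ideal (contraction S k J) S"
      unfolding contraction_def by (rule k.ring.ideal_vimage[OF J(1)])
    have "n \<subseteq> contraction S k J"
      using J(2) n.a_subset hk by (auto simp: contraction_def subset_iff)
    moreover have "contraction S k J \<subseteq> carrier S" by (auto simp: contraction_def)
    ultimately have "contraction S k J = n \<or> contraction S k J = carrier S"
      using n.I_maximal[OF i] by blast
    moreover have "J = contraction R h (contraction S k J)"
      using J(3) kh by (auto simp: contraction_def)
    moreover have "contraction R h (carrier S) = carrier R" by (auto simp: contraction_def)
    ultimately show "J = contraction R h n \<or> J = carrier R" by metis
  qed
qed

text \<open>Locality is assumed of \<open>R\<close> only. That \<open>S\<close> is local is part of
  the conclusion, hidden in \<open>local_hom\<close>, and it is the source of the local stalks of
  the localization.\<close>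

lemma local_ring_transport:
  fixes R :: "'r ring" and S :: "'s ring"
  assumes R: "local_ring R" and S: "cring S" and h: "h \<in> ring_hom R S" and k: "k \<in> ring_hom S R"
    and kh: "\<And>r. r \<in> carrier R \<Longrightarrow> k (h r) = r" and hk: "\<And>s. s \<in> carrier S \<Longrightarrow> h (k s) = s"
  shows "local_hom R S h" and "local_hom S R k"
proof -
  have Rc: "cring R" using R by (simp add: local_ring_def)
  have 1: "maximalideal (contraction R h n) R" if "maximalideal n S" for n
    by (rule maximalideal_contraction_iso[OF Rc S h k kh hk that])
  have 2: "maximalideal (contraction S k n) S" if "maximalideal n R" for n
    by (rule maximalideal_contraction_iso[OF S Rc k h hk kh that])
  have 3: "contraction S k (contraction R h n) = n" if "n \<subseteq> carrier S" for n
    using that hk ring_hom_closed[OF k] by (auto simp: contraction_def)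
  have 4: "contraction R h (contraction S k n) = n" if "n \<subseteq> carrier R" for n
    using that kh ring_hom_closed[OF h] by (auto simp: contraction_def)
  have mR: "maximalideal (max_ideal R) R" by (rule max_ideal_maximal[OF R])
  have m: "maximalideal (contraction S k (max_ideal R)) S" by (rule 2[OF mR])
  moreover have "n = contraction S k (max_ideal R)" if n: "maximalideal n S" for n
  proof -
    have "n \<subseteq> carrier S"
      using n by (metis additive_subgroup.a_subset ideal.axioms(1) maximalideal.axioms(1))
    then show ?thesis using 3 max_ideal_eqI[OF R 1[OF n]] by metis
  qed
  ultimately have S': "local_ring S" using S unfolding local_ring_def by blast
  have e: "max_ideal S = contraction S k (max_ideal R)" by (rule max_ideal_eqI[OF S' m])
  have "max_ideal R \<subseteq> carrier R"
    using mR by (metis additive_subgroup.a_subset ideal.axioms(1) maximalideal.axioms(1))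
  then show "local_hom R S h" "local_hom S R k"
    using R S' h k e 4 by (auto simp: local_hom_def)
qed

text \<open>No structure is assumed on \<open>Z\<close>: that it is a locally ringed space is a conclusion.\<close>

locale lrs_transport = lrs X for X :: "('a, 'b) rspace" +
  fixes Z :: "('c, 'd) rspace" and D :: "('c, 'd, 'a, 'b) rs_map"
  assumes bij: "bij_betw (pt D) (points Z) (points X)"
    and open_preim: "\<And>U. open_in X U \<Longrightarrow> open_in Z (preim Z D U)"
    and open_image: "\<And>V. open_in Z V \<Longrightarrow> open_in X (pt D ` V)"
    and sec_bij: "\<And>U. open_in X U \<Longrightarrow>
      bij_betw (shm D U) (carrier (sec X U)) (carrier (sec Z (preim Z D U)))"
    and sec_mult: "\<And>U a b. open_in X U \<Longrightarrow> a \<in> carrier (sec X U) \<Longrightarrow> b \<in> carrier (sec X U) \<Longrightarrow>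
      shm D U (a \<otimes>\<^bsub>sec X U\<^esub> b) = shm D U a \<otimes>\<^bsub>sec Z (preim Z D U)\<^esub> shm D U b"
    and sec_add: "\<And>U a b. open_in X U \<Longrightarrow> a \<in> carrier (sec X U) \<Longrightarrow> b \<in> carrier (sec X U) \<Longrightarrow>
      shm D U (a \<oplus>\<^bsub>sec X U\<^esub> b) = shm D U a \<oplus>\<^bsub>sec Z (preim Z D U)\<^esub> shm D U b"
    and sec_one: "\<And>U. open_in X U \<Longrightarrow> shm D U \<one>\<^bsub>sec X U\<^esub> = \<one>\<^bsub>sec Z (preim Z D U)\<^esub>"
    and sec_zero: "\<And>U. open_in X U \<Longrightarrow> shm D U \<zero>\<^bsub>sec X U\<^esub> = \<zero>\<^bsub>sec Z (preim Z D U)\<^esub>"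
    and sec_res: "\<And>U U' a. open_in X U \<Longrightarrow> open_in X U' \<Longrightarrow> U' \<subseteq> U \<Longrightarrow> a \<in> carrier (sec X U) \<Longrightarrow>
      shm D U' (res X U U' a) = res Z (preim Z D U) (preim Z D U') (shm D U a)"
begin

text \<open>The inverse of \<open>D\<close>. An open \<open>V\<close> of \<open>Z\<close> is the
  preimage of its image under \<open>pt D\<close>, so sections over \<open>V\<close> are pulled back
  through \<open>shm D\<close> at that image.\<close>

definition E :: "('a, 'b, 'c, 'd) rs_map" where
  "E = \<lparr>pt = inv_into (points Z) (pt D),
        shm = (\<lambda>V. inv_into (carrier (sec X (pt D ` V))) (shm D (pt D ` V)))\<rparr>"

lemma inj_D: "inj_on (pt D) (points Z)"
  and image_D: "pt D ` points Z = points X"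
  using bij by (simp_all add: bij_betw_def)

lemma preim_image: "open_in Z V \<Longrightarrow> preim Z D (pt D ` V) = V"
proof -
  assume "open_in Z V"
  then have V: "V \<subseteq> points Z" by (rule openin_subset)
  have "x \<in> preim Z D (pt D ` V) \<longleftrightarrow> x \<in> V" for x
    using V inj_on_image_mem_iff[OF inj_D _ V, of x] by (cases "x \<in> points Z") (simp_all, blast)
  then show ?thesis by blast
qed

lemma image_preim:
  assumes "open_in X U" shows "pt D ` preim Z D U = U"
proof -
  have "pt D ` preim Z D U = U \<inter> pt D ` points Z" by auto
  then show ?thesis using openin_subset[OF assms] image_D by auto
qed

lemma preim_E:
  assumes "open_in Z V" shows "preim X E V = pt D ` V"
proof -
  have V: "V \<subseteq> points Z" by (rule openin_subset[OF assms])
  show ?thesis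
  proof (intro equalityI subsetI)
    fix x assume "x \<in> preim X E V"
    then have i: "inv_into (points Z) (pt D) x \<in> V" and x: "x \<in> pt D ` points Z"
      by (simp_all add: E_def image_D)
    have "pt D (inv_into (points Z) (pt D) x) = x" by (rule f_inv_into_f[OF x])
    then show "x \<in> pt D ` V" using imageI[OF i, of "pt D"] by simp
  next
    fix x assume "x \<in> pt D ` V"
    then show "x \<in> preim X E V"
      using V inj_D image_D by (auto simp: E_def subset_iff)
  qed
qed

lemma sec_ring_iso: "open_in X U \<Longrightarrow> shm D U \<in> ring_iso (sec X U) (sec Z (preim Z D U))"
  using sec_bij[of U] sec_mult sec_add sec_one
  by (auto simp: ring_iso_def intro!: ring_hom_memI dest: bij_betwE)

text \<open>Transport along a ring isomorphism yields a ring whose zero is the image of zero. The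
  zero field of the record in \<open>Z\<close> is independent data, and \<open>sec_zero\<close>
  identifies the two.\<close>

lemma sec_cring_target: "open_in X U \<Longrightarrow> cring (sec Z (preim Z D U))"
  using cring.ring_iso_imp_img_cring[OF sec_cring sec_ring_iso] sec_zero by simp

lemma sec_cring': "open_in Z V \<Longrightarrow> cring (sec Z V)"
  using sec_cring_target[OF open_image] preim_image by metis

lemma shmD_hom: "open_in X U \<Longrightarrow> shm D U \<in> ring_hom (sec X U) (sec Z (preim Z D U))"
  using sec_ring_iso by (simp add: ring_iso_def)

lemma shmE_hom:
  assumes V: "open_in Z V"
  shows "shm E V \<in> ring_hom (sec Z V) (sec X (pt D ` V))"
  using ring_iso_set_sym[OF cring.axioms(1)[OF sec_cring[OF open_image[OF V]]] sec_ring_iso[OF open_image[OF V]]]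
  by (simp add: E_def ring_iso_def preim_image[OF V])

lemma shmE_D: "open_in X U \<Longrightarrow> a \<in> carrier (sec X U) \<Longrightarrow> shm E (preim Z D U) (shm D U a) = a"
  using sec_bij[of U] by (simp add: E_def image_preim bij_betw_def)

lemma shmD_E: "open_in Z V \<Longrightarrow> s \<in> carrier (sec Z V) \<Longrightarrow> shm D (pt D ` V) (shm E V s) = s"
  using sec_bij[OF open_image, of V]
  by (auto simp: E_def preim_image bij_betw_def intro!: f_inv_into_f)

lemma shmE_closed:
  "open_in Z V \<Longrightarrow> s \<in> carrier (sec Z V) \<Longrightarrow> shm E V s \<in> carrier (sec X (pt D ` V))"
  by (rule ring_hom_closed[OF shmE_hom])

lemma shmD_closed:
  "open_in X U \<Longrightarrow> s \<in> carrier (sec X U) \<Longrightarrow> shm D U s \<in> carrier (sec Z (preim Z D U))"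
  by (rule ring_hom_closed[OF shmD_hom])

text \<open>Restriction in \<open>Z\<close> is conjugate to restriction in \<open>X\<close>. With
  this formula the presheaf and sheaf axioms of \<open>Z\<close> are those of
  \<open>X\<close>.\<close>

lemma resZ_eq:
  assumes V: "open_in Z V" "open_in Z W" "W \<subseteq> V" and s: "s \<in> carrier (sec Z V)"
  shows "res Z V W s = shm D (pt D ` W) (res X (pt D ` V) (pt D ` W) (shm E V s))"
  using sec_res[OF open_image[OF V(1)] open_image[OF V(2)] image_mono[OF V(3)] shmE_closed[OF V(1) s]]
  by (simp add: preim_image V shmD_E s)

section \<open>The sheaf axioms, the inverse morphism and the stalks of the target\<close>

lemma presheaf_target: "presheaf_of_rings Z"
  unfolding presheaf_of_rings_def
proof (intro conjI allI impI ballI)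
  show "cring (sec Z U)" if "open_in Z U" for U using that by (rule sec_cring')
next
  fix U V assume a: "open_in Z U \<and> open_in Z V \<and> V \<subseteq> U"
  have "shm D (pt D ` V) \<circ> res X (pt D ` U) (pt D ` V) \<circ> shm E U \<in> ring_hom (sec Z U) (sec Z V)"
    using a shmD_hom[OF open_image, of V]
    by (intro ring_hom_trans[OF shmE_hom] ring_hom_trans[OF res_hom])
      (auto intro: open_image simp: preim_image)
  then show "res Z U V \<in> ring_hom (sec Z U) (sec Z V)"
    using resZ_eq[of U V] a cring.cring_simprules[OF sec_cring'[of U]]
    by (auto simp: ring_hom_def)
next
  fix U s assume "open_in Z U" "s \<in> carrier (sec Z U)"
  then show "res Z U U s = s"
    by (simp add: resZ_eq res_id open_image shmE_closed shmD_E)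
next
  fix U V W s assume a: "open_in Z U \<and> open_in Z V \<and> open_in Z W \<and> W \<subseteq> V \<and> V \<subseteq> U"
    and s: "s \<in> carrier (sec Z U)"
  let ?t = "res X (pt D ` U) (pt D ` V) (shm E U s)"
  have t: "?t \<in> carrier (sec X (pt D ` V))" using a s by (intro res_closed open_image shmE_closed) auto
  have r: "res Z U V s = shm D (pt D ` V) ?t" using a s by (simp add: resZ_eq)
  have "res Z V W (res Z U V s) = shm D (pt D ` W) (res X (pt D ` V) (pt D ` W) ?t)"
    unfolding r using sec_res[of "pt D ` V" "pt D ` W", OF _ _ _ t] a
    by (simp add: open_image preim_image image_mono)
  also have "\<dots> = shm D (pt D ` W) (res X (pt D ` U) (pt D ` W) (shm E U s))"
    using a s by (subst res_res) (auto intro: open_image shmE_closed)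
  also have "\<dots> = res Z U W s" using a s by (subst resZ_eq) auto
  finally show "res Z V W (res Z U V s) = res Z U W s" .
qed

lemma ringed_target: "ringed_space Z"
  unfolding ringed_space_def
proof (intro conjI allI impI ballI)
  show "presheaf_of_rings Z" by (rule presheaf_target)
next
  fix C s t assume C: "\<forall>U\<in>C. open_in Z U" and s: "s \<in> carrier (sec Z (\<Union>C))"
    and t: "t \<in> carrier (sec Z (\<Union>C))" and e: "\<forall>U\<in>C. res Z (\<Union>C) U s = res Z (\<Union>C) U t"
  have o: "open_in Z (\<Union>C)" using C by blast
  have "shm E (\<Union>C) s = shm E (\<Union>C) t"
  proof (rule sections_eqI[OF open_image[OF o] shmE_closed[OF o s] shmE_closed[OF o t]])
    fix x assume "x \<in> pt D ` \<Union>C"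
    then obtain V where V: "V \<in> C" "x \<in> pt D ` V" by blast
    have VC: "V \<subseteq> \<Union>C" using V by blast
    have oV: "open_in Z V" using C V by blast
    have "shm D (pt D ` V) (res X (pt D ` \<Union>C) (pt D ` V) (shm E (\<Union>C) s)) =
        shm D (pt D ` V) (res X (pt D ` \<Union>C) (pt D ` V) (shm E (\<Union>C) t))"
      using e[rule_format, OF V(1)] resZ_eq[OF o oV VC s] resZ_eq[OF o oV VC t] by simp
    moreover have "res X (pt D ` \<Union>C) (pt D ` V) (shm E (\<Union>C) r) \<in> carrier (sec X (pt D ` V))"
      if "r \<in> carrier (sec Z (\<Union>C))" for r
      using that oV o VC by (intro res_closed open_image image_mono shmE_closed)
    ultimately have "res X (pt D ` \<Union>C) (pt D ` V) (shm E (\<Union>C) s) =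
        res X (pt D ` \<Union>C) (pt D ` V) (shm E (\<Union>C) t)"
      using sec_bij[OF open_image[OF oV]] s t unfolding bij_betw_def inj_on_def by blast
    then show "\<exists>W. open_in X W \<and> x \<in> W \<and> W \<subseteq> pt D ` \<Union>C \<and>
        res X (pt D ` \<Union>C) W (shm E (\<Union>C) s) = res X (pt D ` \<Union>C) W (shm E (\<Union>C) t)"
      using V(2) open_image[OF oV] image_mono[OF VC]
      by (intro exI[of _ "pt D ` V"] conjI)
  qed
  then show "s = t" using shmD_E[OF o] s t by metis
next
  fix C s assume "(\<forall>U\<in>C. open_in Z U \<and> s U \<in> carrier (sec Z U)) \<and>
      (\<forall>U\<in>C. \<forall>V\<in>C. res Z U (U \<inter> V) (s U) = res Z V (U \<inter> V) (s V))"
  then have C: "\<And>U. U \<in> C \<Longrightarrow> open_in Z U" and s: "\<And>U. U \<in> C \<Longrightarrow> s U \<in> carrier (sec Z U)"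
    and e: "\<And>U V. U \<in> C \<Longrightarrow> V \<in> C \<Longrightarrow> res Z U (U \<inter> V) (s U) = res Z V (U \<inter> V) (s V)" by blast+
  have o: "open_in Z (\<Union>C)" using C by blast
  \<comment> \<open>The family \<open>s\<close> is indexed by open sets of \<open>Z\<close>, but the
    gluing takes place in \<open>X\<close>. Preimages under \<open>D\<close> translate the index
    back.\<close>
  define a where "a U = shm E (preim Z D U) (s (preim Z D U))" for U
  have a: "a (pt D ` V) = shm E V (s V)" if "V \<in> C" for V
    using C[OF that] by (simp add: a_def preim_image)
  have un: "\<Union>((`) (pt D) ` C) = pt D ` \<Union>C" by blast
  have "\<exists>t\<in>carrier (sec X (\<Union>((`) (pt D) ` C))). \<forall>U\<in>(`) (pt D) ` C.
      res X (\<Union>((`) (pt D) ` C)) U t = a U"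
  proof (rule glue)
    show "open_in X U" "a U \<in> carrier (sec X U)" if "U \<in> (`) (pt D) ` C" for U
      using that a open_image[OF C] shmE_closed[OF C s] by auto
    fix U U' assume "U \<in> (`) (pt D) ` C" "U' \<in> (`) (pt D) ` C"
    then obtain V W where V: "V \<in> C" "U = pt D ` V" and W: "W \<in> C" "U' = pt D ` W" by blast
    have o: "open_in Z (V \<inter> W)" "open_in Z V" "open_in Z W" using V W C by auto
    \<comment> \<open>Without injectivity the image of \<open>V \<inter> W\<close> could be smaller
      than the intersection of the images, and agreement on overlaps would not transfer.\<close>
    have "inj_on (pt D) (V \<union> W)"
      using bij o openin_subset[of "top_sp Z"] unfolding bij_betw_def by (meson inj_on_subset Un_least)
    then have int: "U \<inter> U' = pt D ` (V \<inter> W)"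
      unfolding V(2) W(2) by (intro inj_on_image_Int[symmetric]) auto
    have *: "res X (pt D ` V) (pt D ` (V \<inter> W)) (shm E V (s V)) \<in> carrier (sec X (pt D ` (V \<inter> W)))"
      "res X (pt D ` W) (pt D ` (V \<inter> W)) (shm E W (s W)) \<in> carrier (sec X (pt D ` (V \<inter> W)))"
      using o s V W by (auto intro!: res_closed open_image shmE_closed)
    have "shm D (pt D ` (V \<inter> W)) (res X (pt D ` V) (pt D ` (V \<inter> W)) (shm E V (s V)))
       = shm D (pt D ` (V \<inter> W)) (res X (pt D ` W) (pt D ` (V \<inter> W)) (shm E W (s W)))"
      using e[OF V(1) W(1)] resZ_eq[OF o(2,1) _ s[OF V(1)]] resZ_eq[OF o(3,1) _ s[OF W(1)]] by simp
    then have "res X (pt D ` V) (pt D ` (V \<inter> W)) (shm E V (s V))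
        = res X (pt D ` W) (pt D ` (V \<inter> W)) (shm E W (s W))"
      using sec_bij[OF open_image[OF o(1)]] * unfolding bij_betw_def inj_on_def by blast
    then show "res X U (U \<inter> U') (a U) = res X U' (U \<inter> U') (a U')"
      unfolding int unfolding V(2) W(2) a[OF V(1)] a[OF W(1)] .
  qed
  then obtain t where t: "t \<in> carrier (sec X (pt D ` \<Union>C))"
    and tC: "\<And>V. V \<in> C \<Longrightarrow> res X (pt D ` \<Union>C) (pt D ` V) t = shm E V (s V)"
    unfolding un using a by auto
  have c: "shm D (pt D ` \<Union>C) t \<in> carrier (sec Z (\<Union>C))"
    using shmD_closed[OF open_image[OF o] t] by (simp only: preim_image[OF o])
  moreover have "res Z (\<Union>C) V (shm D (pt D ` \<Union>C) t) = s V" if V: "V \<in> C" for V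
  proof -
    have VC: "V \<subseteq> \<Union>C" using V by blast
    have "res Z (\<Union>C) V (shm D (pt D ` \<Union>C) t) = shm D (pt D ` V) (res X (pt D ` \<Union>C) (pt D ` V) t)"
      using sec_res[OF open_image[OF o] open_image[OF C[OF V]] image_mono[OF VC] t]
      by (simp only: preim_image o C[OF V])
    then show ?thesis using shmD_E C s V tC by simp
  qed
  ultimately show "\<exists>t\<in>carrier (sec Z (\<Union>C)). \<forall>U\<in>C. res Z (\<Union>C) U t = s U" by blast
qed

lemma D_morphism: "rs_morphism Z X D"
  unfolding rs_morphism_def continuous_map_def
  using ringed_target ringed bij open_preim sec_res shmD_hom
  by (auto simp: preim_def[symmetric] dest: bij_betwE)

lemma E_morphism: "rs_morphism X Z E"
proof -
  have "{x \<in> points X. pt E x \<in> V} = pt D ` V" if "open_in Z V" for V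
    using preim_E[OF that] by (simp add: preim_def)
  moreover have "pt E x \<in> points Z" if "x \<in> points X" for x
    using that bij by (simp add: E_def bij_betw_def inv_into_into)
  moreover have "shm E W (res Z V W s) = res X (pt D ` V) (pt D ` W) (shm E V s)"
    if "open_in Z V" "open_in Z W" "W \<subseteq> V" "s \<in> carrier (sec Z V)" for V W s
  proof -
    have "res X (pt D ` V) (pt D ` W) (shm E V s) \<in> carrier (sec X (pt D ` W))"
      using that by (intro res_closed open_image image_mono shmE_closed)
    from shmE_D[OF open_image[OF that(2)] this] show ?thesis
      unfolding resZ_eq[OF that] preim_image[OF that(2)] .
  qed
  ultimately show ?thesis
    using ringed ringed_target shmE_hom open_image
    by (simp add: rs_morphism_def continuous_map_def preim_E)
qed

lemma D_E: "rs_eq X X (rs_comp Z D E) rs_id"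
  using bij f_inv_into_f[of _ "pt D" "points Z"] shmE_D
  by (auto simp: rs_eq_def rs_comp_def rs_id_def bij_betw_def) (simp add: E_def)

lemma E_D: "rs_eq Z Z (rs_comp X E D) rs_id"
  using bij shmD_E by (auto simp: rs_eq_def rs_comp_def rs_id_def bij_betw_def preim_E) (simp add: E_def)

text \<open>By functoriality of stalk maps, \<open>D\<close> and \<open>E\<close> induce mutually
  inverse isomorphisms between the stalks at z and at its image, so the stalks of \<open>Z\<close>
  inherit locality from \<open>X\<close>.\<close>

lemma D_local_hom:
  assumes z: "z \<in> points Z"
  shows "local_hom (stalk X (pt D z)) (stalk Z z) (stalk_map Z D z)"
    and "local_hom (stalk Z z) (stalk X (pt D z)) (stalk_map X E (pt D z))"
proof -
  interpret D: rs_mor Z X D by unfold_locales (rule D_morphism)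
  interpret E: rs_mor X Z E by unfold_locales (rule E_morphism)
  have Dz: "pt D z \<in> points X" by (rule D.pt_closed[OF z])
  have Ez: "pt E (pt D z) = z" using E_D z by (simp add: rs_eq_def rs_comp_def rs_id_def)
  have 1: "stalk_map X E (pt D z) (stalk_map Z D z \<alpha>) = \<alpha>" if \<alpha>: "\<alpha> \<in> carrier (stalk X (pt D z))" for \<alpha>
  proof -
    have "stalk_map X E (pt D z) (stalk_map Z D (pt E (pt D z)) \<alpha>) = stalk_map X (rs_comp Z D E) (pt D z) \<alpha>"
      by (rule stalk_map_comp[OF E_morphism D_morphism Dz, symmetric]) (simp add: Ez \<alpha>)
    also have "\<dots> = stalk_map X rs_id (pt D z) \<alpha>"
      using \<alpha> by (intro stalk_map_cong[OF rs_morphism_id[OF ringed] rs_eq_sym[OF D_E] Dz]) (simp add: rs_id_def)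
    also have "\<dots> = \<alpha>" by (rule stalk_map_id[OF ringed Dz \<alpha>])
    finally show ?thesis by (simp add: Ez)
  qed
  have 2: "stalk_map Z D z (stalk_map X E (pt D z) \<alpha>) = \<alpha>" if \<alpha>: "\<alpha> \<in> carrier (stalk Z z)" for \<alpha>
  proof -
    have "stalk_map Z D z (stalk_map X E (pt D z) \<alpha>) = stalk_map Z (rs_comp X E D) z \<alpha>"
      by (rule stalk_map_comp[OF D_morphism E_morphism z, symmetric]) (simp add: Ez \<alpha>)
    also have "\<dots> = stalk_map Z rs_id z \<alpha>"
      using \<alpha> by (intro stalk_map_cong[OF rs_morphism_id[OF ringed_target] rs_eq_sym[OF E_D] z]) (simp add: rs_id_def)
    also have "\<dots> = \<alpha>" by (rule stalk_map_id[OF ringed_target z \<alpha>])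
    finally show ?thesis .
  qed
  note hD = D.stalk_map_hom[OF z] and hE = E.stalk_map_hom[OF Dz, unfolded Ez]
  show "local_hom (stalk X (pt D z)) (stalk Z z) (stalk_map Z D z)"
    by (rule local_ring_transport(1)[OF local_stalk[OF Dz] D.src.stalk_cring[OF z] hD hE 1 2])
  show "local_hom (stalk Z z) (stalk X (pt D z)) (stalk_map X E (pt D z))"
    by (rule local_ring_transport(2)[OF local_stalk[OF Dz] D.src.stalk_cring[OF z] hD hE 1 2])
qed

lemma lrs_target: "locally_ringed_space Z"
  using ringed_target D_local_hom(1) by (simp add: locally_ringed_space_def local_hom_def)

lemma D_lrs_morphism: "lrs_morphism Z X D"
  using lrs lrs_target D_morphism D_local_hom(1) by (simp add: lrs_morphism_def)

lemma E_lrs_morphism: "lrs_morphism X Z E"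
proof -
  have "local_hom (stalk Z (pt E x)) (stalk X x) (stalk_map X E x)" if x: "x \<in> points X" for x
  proof -
    have "pt E x \<in> points Z" using x bij by (simp add: E_def bij_betw_def inv_into_into)
    moreover have "pt D (pt E x) = x" using D_E x by (simp add: rs_eq_def rs_comp_def rs_id_def)
    ultimately show ?thesis using D_local_hom(2) by metis
  qed
  then show ?thesis using lrs lrs_target E_morphism by (simp add: lrs_morphism_def)
qed

lemma D_iso: "lrs_iso Z X D"
  using D_lrs_morphism E_lrs_morphism D_E E_D by (auto simp: lrs_iso_def inverse_rs_maps_def)

end

section \<open>Localization of primed ringed spaces\<close>

lemma localize_hom_ring_hom:
  fixes R :: "'r ring" and S :: "'s ring"
  assumes R: "cring R" and S: "cring S" and h: "h \<in> ring_hom R S" and q: "primeideal q S"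
  shows "localize_hom S q h \<in> ring_hom (localize_at R (contraction R h q)) (localize_at S q)"
proof -
  let ?p = "contraction R h q"
  interpret h: ring_hom_cring R S h
    using R S h by (intro ring_hom_cringI ring_hom_ringI2) (auto intro: cring.axioms)
  interpret Rp: prime_localization R ?p
    by (intro prime_localization.intro prime_localization_axioms.intro R primeideal_contraction[OF assms])
  interpret Sq: prime_localization S q
    by (intro prime_localization.intro prime_localization_axioms.intro S q)
  have d: "b \<in> carrier R" "h b \<in> carrier S - q" if "b \<in> carrier R - ?p" for b
    using that by (auto simp: contraction_def)
  note f = localize_hom_fraction[OF assms]
  show ?thesis
  proof (rule ring_hom_memI)
    show "localize_hom S q h \<alpha> \<in> carrier (localize_at S q)" if "\<alpha> \<in> carrier (localize_at R ?p)" for \<alpha>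
      using that d by (elim Rp.fraction_cases) (simp add: f Sq.fraction_closed)
    show "localize_hom S q h (\<alpha> \<otimes>\<^bsub>localize_at R ?p\<^esub> \<beta>)
        = localize_hom S q h \<alpha> \<otimes>\<^bsub>localize_at S q\<^esub> localize_hom S q h \<beta>"
      "localize_hom S q h (\<alpha> \<oplus>\<^bsub>localize_at R ?p\<^esub> \<beta>)
        = localize_hom S q h \<alpha> \<oplus>\<^bsub>localize_at S q\<^esub> localize_hom S q h \<beta>"
      if ab: "\<alpha> \<in> carrier (localize_at R ?p)" "\<beta> \<in> carrier (localize_at R ?p)" for \<alpha> \<beta>
    proof -
      obtain a b where a: "a \<in> carrier R" "b \<in> carrier R - ?p" "\<alpha> = fraction R ?p a b"
        using Rp.fraction_cases[OF ab(1)] .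
      obtain c e where c: "c \<in> carrier R" "e \<in> carrier R - ?p" "\<beta> = fraction R ?p c e"
        using Rp.fraction_cases[OF ab(2)] .
      note be = d[OF a(2)] d[OF c(2)] d[OF Rp.mult_denom[OF a(2) c(2)]]
      show "localize_hom S q h (\<alpha> \<otimes>\<^bsub>localize_at R ?p\<^esub> \<beta>)
          = localize_hom S q h \<alpha> \<otimes>\<^bsub>localize_at S q\<^esub> localize_hom S q h \<beta>"
        "localize_hom S q h (\<alpha> \<oplus>\<^bsub>localize_at R ?p\<^esub> \<beta>)
          = localize_hom S q h \<alpha> \<oplus>\<^bsub>localize_at S q\<^esub> localize_hom S q h \<beta>"
        unfolding a(3) c(3) Rp.fraction_mult[OF a(1,2) c(1,2)] Rp.fraction_add[OF a(1,2) c(1,2)]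
        using a(1) c(1) be by (simp_all add: f Sq.fraction_mult Sq.fraction_add)
    qed
    show "localize_hom S q h \<one>\<^bsub>localize_at R ?p\<^esub> = \<one>\<^bsub>localize_at S q\<^esub>"
      using d[OF Rp.one_denom] f[of "\<one>\<^bsub>R\<^esub>" "\<one>\<^bsub>R\<^esub>"] by (simp add: Rp.localize_one Sq.localize_one)
  qed
qed

section \<open>Points, topology and sections of a localization\<close>

lemma sec_loc: "sec (loc A M) V = function_ring V (loc_ring_at A) (loc_sections A M V)"
  and res_loc: "res (loc A M) V W s = restrict s W"
  by (simp_all add: loc_def)

lemma carrier_sec_loc: "carrier (sec (loc A M) V) = loc_sections A M V"
  and mult_sec_loc: "s \<otimes>\<^bsub>sec (loc A M) V\<^esub> t = (\<lambda>w\<in>V. s w \<otimes>\<^bsub>loc_ring_at A w\<^esub> t w)"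
  and add_sec_loc: "s \<oplus>\<^bsub>sec (loc A M) V\<^esub> t = (\<lambda>w\<in>V. s w \<oplus>\<^bsub>loc_ring_at A w\<^esub> t w)"
  and one_sec_loc: "\<one>\<^bsub>sec (loc A M) V\<^esub> = (\<lambda>w\<in>V. \<one>\<^bsub>loc_ring_at A w\<^esub>)"
  and zero_sec_loc: "\<zero>\<^bsub>sec (loc A M) V\<^esub> = (\<lambda>w\<in>V. \<zero>\<^bsub>loc_ring_at A w\<^esub>)"
  by (simp_all add: sec_loc function_ring_def)

lemma loc_ring_at_pair: "loc_ring_at A (y, p) = localize_at (stalk A y) p"
  by (simp add: loc_ring_at_def)

locale primed = sheaf A for A :: "('a, 'b) rspace" +
  fixes M :: "('a, 'b) prime_sys"
  assumes prime_sys: "prime_system A M"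
begin

lemma prime_at: "y \<in> points A \<Longrightarrow> p \<in> M y \<Longrightarrow> primeideal p (stalk A y)"
  using prime_sys by (auto simp: prime_system_def prime_spectrum_def)

lemma prime_localization_at:
  assumes "y \<in> points A" "p \<in> M y" shows "prime_localization (stalk A y) p"
  by (intro prime_localization.intro prime_localization_axioms.intro stalk_cring prime_at assms)

text \<open>A generated topology has as points the union of its generators. The basic set of the
  global section 1 already contains every admissible pair, since a prime does not contain 1.\<close>

lemma points_loc: "(y, p) \<in> points (loc A M) \<longleftrightarrow> y \<in> points A \<and> p \<in> M y"
proof
  assume "(y, p) \<in> points (loc A M)"
  then obtain U s where "open_in A U" "(y, p) \<in> loc_basic A M U s"
    by (auto simp: loc_def)
  then show "y \<in> points A \<and> p \<in> M y"
    using openin_subset[of "top_sp A" U] by (auto simp: loc_basic_def)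
next
  assume y: "y \<in> points A \<and> p \<in> M y"
  then interpret prime_localization "stalk A y" p by (intro prime_localization_at) auto
  have "(y, p) \<in> loc_basic A M (points A) \<one>\<^bsub>sec A (points A)\<^esub>"
    using y one_denom by (simp add: loc_basic_def germ_one_zero)
  moreover have "\<one>\<^bsub>sec A (points A)\<^esub> \<in> carrier (sec A (points A))"
    using sec_cring[OF open_points] by (simp add: cring.cring_simprules)
  ultimately show "(y, p) \<in> points (loc A M)"
    using open_points by (auto simp: loc_def)
qed

lemma open_loc_basic:
  "open_in A U \<Longrightarrow> s \<in> carrier (sec A U) \<Longrightarrow> open_in (loc A M) (loc_basic A M U s)"
  by (auto simp: loc_def intro!: topology_generated_by_Basis)

lemma loc_basic_points: "open_in A U \<Longrightarrow> loc_basic A M U s \<subseteq> points (loc A M)"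
  using openin_subset[of "top_sp A" U] points_loc by (auto simp: loc_basic_def)

lemma continuous_to_loc:
  assumes "c ` topspace T \<subseteq> points (loc A M)"
    and "\<And>U s. open_in A U \<Longrightarrow> s \<in> carrier (sec A U) \<Longrightarrow>
      openin T {x \<in> topspace T. c x \<in> loc_basic A M U s}"
  shows "continuous_map T (top_sp (loc A M)) c"
proof -
  have "top_sp (loc A M) = topology_generated_by {loc_basic A M U s | U s. open_in A U \<and> s \<in> carrier (sec A U)}"
    by (simp add: loc_def)
  moreover have "c ` topspace T \<subseteq> \<Union>{loc_basic A M U s | U s. open_in A U \<and> s \<in> carrier (sec A U)}"
    using assms(1) by (simp add: loc_def)
  moreover have "openin T (c -` B \<inter> topspace T)"
    if "B \<in> {loc_basic A M U s | U s. open_in A U \<and> s \<in> carrier (sec A U)}" for B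
  proof -
    have "c -` B \<inter> topspace T = {x \<in> topspace T. c x \<in> B}" by auto
    then show ?thesis using that assms(2) by auto
  qed
  ultimately show ?thesis by (simp only:) (rule continuous_on_generated_topo)
qed

lemma loc_sections_value:
  "s \<in> loc_sections A M V \<Longrightarrow> w \<in> V \<Longrightarrow> s w \<in> carrier (loc_ring_at A w)"
  unfolding loc_sections_def by auto

lemma loc_sections_extensional: "s \<in> loc_sections A M V \<Longrightarrow> s \<in> extensional V"
  unfolding loc_sections_def by (auto simp: PiE_def)

lemma loc_sections_local:
  assumes "s \<in> loc_sections A M V" "w \<in> V"
  obtains U t a and n :: nat where "open_in A U" "t \<in> carrier (sec A U)" "a \<in> carrier (sec A U)"
    "w \<in> loc_basic A M U t" "loc_basic A M U t \<subseteq> V"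
    "\<And>y p. (y, p) \<in> loc_basic A M U t \<Longrightarrow>
      s (y, p) = fraction (stalk A y) p (germ A y U a) (germ A y U t [^]\<^bsub>stalk A y\<^esub> n)"
proof -
  have "\<exists>U t a (n::nat). open_in A U \<and> t \<in> carrier (sec A U) \<and> a \<in> carrier (sec A U) \<and>
          w \<in> loc_basic A M U t \<and> loc_basic A M U t \<subseteq> V \<and>
          (\<forall>(x, z) \<in> loc_basic A M U t.
             s (x, z) = fraction (stalk A x) z (germ A x U a) (germ A x U t [^]\<^bsub>stalk A x\<^esub> n))"
    using assms unfolding loc_sections_def by blast
  then show thesis using that by (elim exE conjE) blast
qed

lemma loc_sectionsI:
  assumes "s \<in> extensional V" and "\<And>w. w \<in> V \<Longrightarrow> s w \<in> carrier (loc_ring_at A w)"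
    and "\<And>w. w \<in> V \<Longrightarrow> \<exists>U t a (n::nat). open_in A U \<and> t \<in> carrier (sec A U) \<and> a \<in> carrier (sec A U) \<and>
          w \<in> loc_basic A M U t \<and> loc_basic A M U t \<subseteq> V \<and>
          (\<forall>y p. (y, p) \<in> loc_basic A M U t \<longrightarrow>
             s (y, p) = fraction (stalk A y) p (germ A y U a) (germ A y U t [^]\<^bsub>stalk A y\<^esub> n))"
  shows "s \<in> loc_sections A M V"
proof -
  have "\<forall>w\<in>V. \<exists>U t a (n::nat). open_in A U \<and> t \<in> carrier (sec A U) \<and> a \<in> carrier (sec A U) \<and>
          w \<in> loc_basic A M U t \<and> loc_basic A M U t \<subseteq> V \<and>
          (\<forall>(x, z) \<in> loc_basic A M U t.
             s (x, z) = fraction (stalk A x) z (germ A x U a) (germ A x U t [^]\<^bsub>stalk A x\<^esub> n))"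
  proof
    fix w assume "w \<in> V"
    from assms(3)[OF this] obtain U t a and n :: nat where
      "open_in A U \<and> t \<in> carrier (sec A U) \<and> a \<in> carrier (sec A U) \<and>
          w \<in> loc_basic A M U t \<and> loc_basic A M U t \<subseteq> V \<and>
          (\<forall>y p. (y, p) \<in> loc_basic A M U t \<longrightarrow>
             s (y, p) = fraction (stalk A y) p (germ A y U a) (germ A y U t [^]\<^bsub>stalk A y\<^esub> n))"
      by (elim exE)
    then show "\<exists>U t a (n::nat). open_in A U \<and> t \<in> carrier (sec A U) \<and> a \<in> carrier (sec A U) \<and>
          w \<in> loc_basic A M U t \<and> loc_basic A M U t \<subseteq> V \<and>
          (\<forall>(x, z) \<in> loc_basic A M U t.
             s (x, z) = fraction (stalk A x) z (germ A x U a) (germ A x U t [^]\<^bsub>stalk A x\<^esub> n))"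
      by (intro exI[of _ U] exI[of _ t] exI[of _ a] exI[of _ n]) auto
  qed
  then show ?thesis using assms(1,2) unfolding loc_sections_def by (simp add: PiE_def Pi_def)
qed

lemma loc_basic_denom:
  assumes "open_in A U" "t \<in> carrier (sec A U)" "(y, p) \<in> loc_basic A M U t"
  shows "y \<in> U" "y \<in> points A" "p \<in> M y"
    "germ A y U t [^]\<^bsub>stalk A y\<^esub> (n::nat) \<in> carrier (stalk A y) - p"
proof -
  show y: "y \<in> U" "y \<in> points A" "p \<in> M y"
    using assms openin_subset[of "top_sp A" U] by (auto simp: loc_basic_def)
  interpret prime_localization "stalk A y" p by (intro prime_localization_at y)
  show "germ A y U t [^]\<^bsub>stalk A y\<^esub> n \<in> carrier (stalk A y) - p"
    using assms by (intro pow_denom) (auto simp: loc_basic_def germ_closed)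
qed

end

section \<open>The map of localizations induced by a morphism of primed ringed spaces\<close>

locale prs_mor =
  fixes A :: "('a, 'b) rspace" and M :: "('a, 'b) prime_sys"
    and B :: "('c, 'd) rspace" and N :: "('c, 'd) prime_sys" and f :: "('a, 'b, 'c, 'd) rs_map"
  assumes prs_mor: "prs_morphism A M B N f"

sublocale prs_mor \<subseteq> rs_mor A B f
  using prs_mor by unfold_locales (simp add: prs_morphism_def)

sublocale prs_mor \<subseteq> src: primed A M
  using prs_mor by unfold_locales (simp add: prs_morphism_def)

sublocale prs_mor \<subseteq> tgt: primed B N
  using prs_mor by unfold_locales (simp add: prs_morphism_def)

context prs_mor
begin

lemma contraction_mem:
  "x \<in> points A \<Longrightarrow> z \<in> M x \<Longrightarrow> contraction (stalk B (pt f x)) (stalk_map A f x) z \<in> N (pt f x)"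
  using prs_mor by (simp add: prs_morphism_def)

lemma pt_loc_map: "pt (loc_map A M B f) (x, z) = (pt f x, contraction (stalk B (pt f x)) (stalk_map A f x) z)"
  by (simp add: loc_map_def loc_map_pt_def)

lemma pt_loc_map_closed: "w \<in> points (loc A M) \<Longrightarrow> pt (loc_map A M B f) w \<in> points (loc B N)"
  by (cases w) (simp add: pt_loc_map src.points_loc tgt.points_loc contraction_mem pt_closed)

lemma shm_loc_map:
  assumes "(x, z) \<in> preim (loc A M) (loc_map A M B f) V"
  shows "shm (loc_map A M B f) V s (x, z) =
    localize_hom (stalk A x) z (stalk_map A f x) (s (pt (loc_map A M B f) (x, z)))"
  using assms by (simp add: loc_map_def)

lemma shm_loc_map_extensional:
  "shm (loc_map A M B f) V s \<in> extensional (preim (loc A M) (loc_map A M B f) V)"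
  by (simp add: loc_map_def preim_def)

text \<open>A germ lies in the contraction of z exactly when its image lies in z. This yields
  continuity of the induced map and also the open sets on which pulled back fractions are
  valid.\<close>

lemma preim_loc_basic:
  assumes "open_in B U" "s \<in> carrier (sec B U)"
  shows "preim (loc A M) (loc_map A M B f) (loc_basic B N U s)
    = loc_basic A M (preim A f U) (shm f U s)"
proof -
  have "(x, z) \<in> preim (loc A M) (loc_map A M B f) (loc_basic B N U s)
      \<longleftrightarrow> (x, z) \<in> loc_basic A M (preim A f U) (shm f U s)" for x z
    using assms stalk_map_germ[of x U s] tgt.germ_closed[OF assms(1) _ assms(2), of "pt f x"] contraction_mem
    by (auto simp: src.points_loc pt_loc_map loc_basic_def contraction_def)
  then show ?thesis by (simp only: set_eq_iff split_paired_All) blast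
qed

lemma loc_map_continuous:
  "continuous_map (top_sp (loc A M)) (top_sp (loc B N)) (pt (loc_map A M B f))"
proof (rule tgt.continuous_to_loc)
  show "pt (loc_map A M B f) ` points (loc A M) \<subseteq> points (loc B N)" using pt_loc_map_closed by blast
  fix U s assume "open_in B U" "s \<in> carrier (sec B U)"
  then have "open_in (loc A M) (preim (loc A M) (loc_map A M B f) (loc_basic B N U s))"
    using preim_loc_basic src.open_loc_basic preim_open shm_closed by simp
  then show "open_in (loc A M) {x \<in> points (loc A M). pt (loc_map A M B f) x \<in> loc_basic B N U s}"
    by (simp add: preim_def)
qed

lemma localize_hom_at:
  assumes "(x, z) \<in> points (loc A M)"
  shows "localize_hom (stalk A x) z (stalk_map A f x)
    \<in> ring_hom (loc_ring_at B (pt (loc_map A M B f) (x, z))) (loc_ring_at A (x, z))"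
  using assms src.prime_at
  by (auto simp: pt_loc_map loc_ring_at_pair src.points_loc pt_closed
      intro!: localize_hom_ring_hom src.stalk_cring tgt.stalk_cring stalk_map_hom)

text \<open>A local expression with numerator \<open>a\<close>, denominator \<open>t\<close> and
  exponent \<open>n\<close> pulls back to the expression with \<open>shm f U a\<close>,
  \<open>shm f U t\<close> and the same exponent.\<close>

lemma shm_loc_map_closed:
  assumes s: "s \<in> loc_sections B N V"
  shows "shm (loc_map A M B f) V s \<in> loc_sections A M (preim (loc A M) (loc_map A M B f) V)"
    (is "?s \<in> loc_sections A M ?V")
proof (rule src.loc_sectionsI)
  show "?s \<in> extensional ?V" by (rule shm_loc_map_extensional)
  fix w assume w: "w \<in> ?V"
  obtain x z where xz: "w = (x, z)" by force
  have wV: "pt (loc_map A M B f) w \<in> V" "w \<in> points (loc A M)" using w by simp_all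
  show "?s w \<in> carrier (loc_ring_at A w)"
    using ring_hom_closed[OF localize_hom_at tgt.loc_sections_value[OF s]] w wV
    by (simp add: xz shm_loc_map)
  obtain U t a and n :: nat where U: "open_in B U" "t \<in> carrier (sec B U)" "a \<in> carrier (sec B U)"
    "pt (loc_map A M B f) w \<in> loc_basic B N U t" "loc_basic B N U t \<subseteq> V" and
    val: "\<And>y p. (y, p) \<in> loc_basic B N U t \<Longrightarrow>
      s (y, p) = fraction (stalk B y) p (germ B y U a) (germ B y U t [^]\<^bsub>stalk B y\<^esub> n)"
    using tgt.loc_sections_local[OF s wV(1)] by metis
  let ?U = "preim A f U"
  have pre: "loc_basic A M ?U (shm f U t) = preim (loc A M) (loc_map A M B f) (loc_basic B N U t)"
    using preim_loc_basic[OF U(1,2)] by simp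
  have "?s (x, z) = fraction (stalk A x) z (germ A x ?U (shm f U a))
      (germ A x ?U (shm f U t) [^]\<^bsub>stalk A x\<^esub> n)"
    if xz: "(x, z) \<in> loc_basic A M ?U (shm f U t)" for x z
  proof -
    let ?y = "pt f x" and ?p = "contraction (stalk B (pt f x)) (stalk_map A f x) z"
    have b: "(?y, ?p) \<in> loc_basic B N U t" and xV: "(x, z) \<in> ?V"
      using xz U(5) unfolding pre by (auto simp: pt_loc_map)
    have x: "x \<in> points A" "z \<in> M x" using xV by (simp_all add: src.points_loc)
    note d = tgt.loc_basic_denom[OF U(1,2) b]
    interpret h: ring_hom_cring "stalk B ?y" "stalk A x" "stalk_map A f x"
      by (rule stalk_map_ring_hom_cring[OF x(1)])
    have "?s (x, z) = localize_hom (stalk A x) z (stalk_map A f x)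
        (fraction (stalk B ?y) ?p (germ B ?y U a) (germ B ?y U t [^]\<^bsub>stalk B ?y\<^esub> n))"
      using xV val[OF b] by (simp add: shm_loc_map) (simp add: pt_loc_map)
    also have "\<dots> = fraction (stalk A x) z (stalk_map A f x (germ B ?y U a))
        (stalk_map A f x (germ B ?y U t [^]\<^bsub>stalk B ?y\<^esub> n))"
      using d(4) tgt.germ_closed[OF U(1) d(1) U(3)]
      by (intro localize_hom_fraction h.R.is_cring h.S.is_cring h.homh src.prime_at x)
        (auto simp: contraction_def)
    also have "stalk_map A f x (germ B ?y U t [^]\<^bsub>stalk B ?y\<^esub> n)
        = stalk_map A f x (germ B ?y U t) [^]\<^bsub>stalk A x\<^esub> n"
      using tgt.germ_closed[OF U(1) d(1) U(2)] by (rule h.ring.hom_nat_pow)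
    finally show ?thesis using x d(1) U by (simp add: stalk_map_germ)
  qed
  moreover have "w \<in> loc_basic A M ?U (shm f U t)" "loc_basic A M ?U (shm f U t) \<subseteq> ?V"
    unfolding pre using U(4,5) wV by auto
  ultimately show "\<exists>U t a (n::nat). open_in A U \<and> t \<in> carrier (sec A U) \<and> a \<in> carrier (sec A U) \<and>
        w \<in> loc_basic A M U t \<and> loc_basic A M U t \<subseteq> ?V \<and>
        (\<forall>y p. (y, p) \<in> loc_basic A M U t \<longrightarrow>
           ?s (y, p) = fraction (stalk A y) p (germ A y U a) (germ A y U t [^]\<^bsub>stalk A y\<^esub> n))"
    using U by (intro exI[of _ ?U] exI[of _ "shm f U t"] exI[of _ "shm f U a"] exI[of _ n])
      (simp add: preim_open shm_closed)
qed

text \<open>That the two localizations are ringed spaces is a hypothesis because it is obtained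
  elsewhere, by transport from a locally ringed space.\<close>

lemma loc_map_morphism:
  assumes "ringed_space (loc A M)" "ringed_space (loc B N)"
  shows "rs_morphism (loc A M) (loc B N) (loc_map A M B f)"
  unfolding rs_morphism_def
proof (intro conjI allI impI ballI assms loc_map_continuous)
  let ?g = "loc_map A M B f"
  fix V assume V: "open_in (loc B N) V"
  have hom: "localize_hom (stalk A x) z (stalk_map A f x)
      \<in> ring_hom (loc_ring_at B (pt ?g (x, z))) (loc_ring_at A (x, z))"
    if "(x, z) \<in> preim (loc A M) ?g V" for x z
    using that by (intro localize_hom_at) simp
  show "shm ?g V \<in> ring_hom (sec (loc B N) V) (sec (loc A M) (preim (loc A M) ?g V))"
  proof (rule ring_hom_memI)
    show "shm ?g V s \<in> carrier (sec (loc A M) (preim (loc A M) ?g V))" if "s \<in> carrier (sec (loc B N) V)" for s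
      using that shm_loc_map_closed by (simp add: carrier_sec_loc)
    fix s t assume st: "s \<in> carrier (sec (loc B N) V)" "t \<in> carrier (sec (loc B N) V)"
    then have v: "s w \<in> carrier (loc_ring_at B w)" "t w \<in> carrier (loc_ring_at B w)" if "w \<in> V" for w
      using that tgt.loc_sections_value by (auto simp: carrier_sec_loc)
    show "shm ?g V (s \<otimes>\<^bsub>sec (loc B N) V\<^esub> t)
        = shm ?g V s \<otimes>\<^bsub>sec (loc A M) (preim (loc A M) ?g V)\<^esub> shm ?g V t"
      unfolding mult_sec_loc
    proof (rule extensionalityI[OF shm_loc_map_extensional])
      fix w assume "w \<in> preim (loc A M) ?g V"
      then show "shm ?g V (\<lambda>w\<in>V. s w \<otimes>\<^bsub>loc_ring_at B w\<^esub> t w) w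
          = (\<lambda>w\<in>preim (loc A M) ?g V. shm ?g V s w \<otimes>\<^bsub>loc_ring_at A w\<^esub> shm ?g V t w) w"
        using v hom by (cases w) (simp add: shm_loc_map ring_hom_mult[OF hom])
    qed simp
    show "shm ?g V (s \<oplus>\<^bsub>sec (loc B N) V\<^esub> t)
        = shm ?g V s \<oplus>\<^bsub>sec (loc A M) (preim (loc A M) ?g V)\<^esub> shm ?g V t"
      unfolding add_sec_loc
    proof (rule extensionalityI[OF shm_loc_map_extensional])
      fix w assume "w \<in> preim (loc A M) ?g V"
      then show "shm ?g V (\<lambda>w\<in>V. s w \<oplus>\<^bsub>loc_ring_at B w\<^esub> t w) w
          = (\<lambda>w\<in>preim (loc A M) ?g V. shm ?g V s w \<oplus>\<^bsub>loc_ring_at A w\<^esub> shm ?g V t w) w"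
        using v hom by (cases w) (simp add: shm_loc_map ring_hom_add[OF hom])
    qed simp
  next
    show "shm ?g V \<one>\<^bsub>sec (loc B N) V\<^esub> = \<one>\<^bsub>sec (loc A M) (preim (loc A M) ?g V)\<^esub>"
      unfolding one_sec_loc
    proof (rule extensionalityI[OF shm_loc_map_extensional])
      fix w assume "w \<in> preim (loc A M) ?g V"
      then show "shm ?g V (\<lambda>w\<in>V. \<one>\<^bsub>loc_ring_at B w\<^esub>) w
          = (\<lambda>w\<in>preim (loc A M) ?g V. \<one>\<^bsub>loc_ring_at A w\<^esub>) w"
        using hom by (cases w) (simp add: shm_loc_map ring_hom_one[OF hom])
    qed simp
  qed
next
  let ?g = "loc_map A M B f"
  fix V W s assume a: "open_in (loc B N) V \<and> open_in (loc B N) W \<and> W \<subseteq> V" "s \<in> carrier (sec (loc B N) V)"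
  show "shm ?g W (res (loc B N) V W s)
      = res (loc A M) (preim (loc A M) ?g V) (preim (loc A M) ?g W) (shm ?g V s)"
    unfolding res_loc
  proof (rule extensionalityI[OF shm_loc_map_extensional])
    fix w assume w: "w \<in> preim (loc A M) ?g W"
    then have "w \<in> preim (loc A M) ?g V" using a(1) by auto
    then show "shm ?g W (restrict s W) w = restrict (shm ?g V s) (preim (loc A M) ?g W) w"
      using w by (cases w) (simp add: shm_loc_map)
  qed simp
qed

end

section \<open>Comparison of a locally ringed space with a localization\<close>

lemma (in lrs) local_prime_system: "prime_system X (local_prime_system X)"
  using max_ideal_prime[OF local_stalk]
  by (auto simp: prime_system_def local_prime_system_def prime_spectrum_def)

text \<open>In \<open>local_fractions\<close> the equation t^n a = b holds on a whole set D(t)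
  inside \<open>U\<close>. Pointwise it makes the localized stalk map surjective; uniformly it gives
  local expressions for sections of the localization and, for \<open>a\<close> the section 1,
  openness of \<open>c\<close>. \<open>kernel\<close> makes the localized stalk map injective. The
  parameter \<open>c\<close> merely abbreviates the induced map on points, composed with the
  identification of x with the pair of x and its maximal ideal.\<close>

locale loc_compare = lrs X + k: prs_mor X "local_prime_system X" A M k
  for X :: "('a, 'b) rspace" and A :: "('c, 'd) rspace" and M and k :: "('a, 'b, 'c, 'd) rs_map" +
  fixes c
  defines "c \<equiv> \<lambda>x. pt (loc_map X (local_prime_system X) A k) (x, max_ideal (stalk X x))"
  assumes bij: "bij_betw c (points X) (points (loc A M))"
    and local_fractions: "\<And>U a x. open_in X U \<Longrightarrow> a \<in> carrier (sec X U) \<Longrightarrow> x \<in> U \<Longrightarrow>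
      \<exists>V t b (n::nat). open_in A V \<and> t \<in> carrier (sec A V) \<and> b \<in> carrier (sec A V) \<and>
        x \<in> nonvanishing X (preim X k V) (shm k V t) \<and>
        nonvanishing X (preim X k V) (shm k V t) \<subseteq> U \<and>
        (\<forall>y \<in> nonvanishing X (preim X k V) (shm k V t).
          stalk_map X k y (germ A (pt k y) V t [^]\<^bsub>stalk A (pt k y)\<^esub> n) \<otimes>\<^bsub>stalk X y\<^esub> germ X y U a
          = stalk_map X k y (germ A (pt k y) V b))"
    and kernel: "\<And>x \<beta>. x \<in> points X \<Longrightarrow> \<beta> \<in> carrier (stalk A (pt k x)) \<Longrightarrow>
      stalk_map X k x \<beta> = \<zero>\<^bsub>stalk X x\<^esub> \<Longrightarrow>
      \<exists>u \<in> carrier (stalk A (pt k x)). stalk_map X k x u \<notin> max_ideal (stalk X x) \<and>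
        u \<otimes>\<^bsub>stalk A (pt k x)\<^esub> \<beta> = \<zero>\<^bsub>stalk A (pt k x)\<^esub>"
begin

section \<open>The stalks of \<open>X\<close> as localized stalks of \<open>A\<close>\<close>

abbreviation "\<pp> x \<equiv> contraction (stalk A (pt k x)) (stalk_map X k x) (max_ideal (stalk X x))"

lemma c_eq: "c x = (pt k x, \<pp> x)"
  by (simp add: c_def k.pt_loc_map)

lemma denom_iff:
  "\<gamma> \<in> carrier (stalk A (pt k x)) - \<pp> x \<longleftrightarrow>
    \<gamma> \<in> carrier (stalk A (pt k x)) \<and> stalk_map X k x \<gamma> \<notin> max_ideal (stalk X x)"
  by (auto simp: contraction_def)

lemma max_mem: "max_ideal (stalk X x) \<in> local_prime_system X x"
  by (simp add: local_prime_system_def)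

lemma local_fractionsE:
  assumes "open_in X U" "a \<in> carrier (sec X U)" "x \<in> U"
  obtains V t b and n :: nat where "open_in A V" "t \<in> carrier (sec A V)" "b \<in> carrier (sec A V)"
    "x \<in> nonvanishing X (preim X k V) (shm k V t)" "nonvanishing X (preim X k V) (shm k V t) \<subseteq> U"
    "\<And>y. y \<in> nonvanishing X (preim X k V) (shm k V t) \<Longrightarrow>
      stalk_map X k y (germ A (pt k y) V t [^]\<^bsub>stalk A (pt k y)\<^esub> n) \<otimes>\<^bsub>stalk X y\<^esub> germ X y U a
          = stalk_map X k y (germ A (pt k y) V b)"
proof -
  from local_fractions[OF assms] obtain V t b and n :: nat where
    "open_in A V \<and> t \<in> carrier (sec A V) \<and> b \<in> carrier (sec A V) \<and>
        x \<in> nonvanishing X (preim X k V) (shm k V t) \<and>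
        nonvanishing X (preim X k V) (shm k V t) \<subseteq> U \<and>
        (\<forall>y \<in> nonvanishing X (preim X k V) (shm k V t).
          stalk_map X k y (germ A (pt k y) V t [^]\<^bsub>stalk A (pt k y)\<^esub> n) \<otimes>\<^bsub>stalk X y\<^esub> germ X y U a
          = stalk_map X k y (germ A (pt k y) V b))"
    by (elim exE)
  then show thesis by (intro that[of V t b n]) simp_all
qed

lemma prime_loc: "x \<in> points X \<Longrightarrow> prime_localization (stalk A (pt k x)) (\<pp> x)"
  using k.contraction_mem[OF _ max_mem] by (intro k.tgt.prime_localization_at k.pt_closed)

lemma stalk_map_denom_unit:
  assumes x: "x \<in> points X" and \<gamma>: "\<gamma> \<in> carrier (stalk A (pt k x)) - \<pp> x"
  shows "stalk_map X k x \<gamma> \<in> Units (stalk X x)"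
  using max_ideal_iff_nonunit[OF local_stalk[OF x]] ring_hom_closed[OF k.stalk_map_hom[OF x]] \<gamma> denom_iff
  by blast

text \<open>\<open>\<delta> x\<close> is the inverse of the map \<open>\<beta> / \<gamma> \<mapsto> k\<^sub>x \<beta> / k\<^sub>x \<gamma>\<close> from the localized stalk of \<open>A\<close>
  to the stalk of \<open>X\<close>.\<close>

definition \<delta> where
  "\<delta> x \<alpha> = (SOME \<omega>. \<exists>\<beta> \<in> carrier (stalk A (pt k x)). \<exists>\<gamma> \<in> carrier (stalk A (pt k x)) - \<pp> x.
    \<omega> = fraction (stalk A (pt k x)) (\<pp> x) \<beta> \<gamma> \<and>
    stalk_map X k x \<gamma> \<otimes>\<^bsub>stalk X x\<^esub> \<alpha> = stalk_map X k x \<beta>)"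

text \<open>After cross-multiplication, the difference of the two products dies in the stalk of
  \<open>X\<close>. The element \<open>u\<close> supplied by \<open>kernel\<close> is then the
  witness for equality of the fractions.\<close>

lemma fraction_unique:
  assumes x: "x \<in> points X" and \<alpha>: "\<alpha> \<in> carrier (stalk X x)"
    and \<beta>: "\<beta> \<in> carrier (stalk A (pt k x))" "\<gamma> \<in> carrier (stalk A (pt k x)) - \<pp> x"
      "stalk_map X k x \<gamma> \<otimes>\<^bsub>stalk X x\<^esub> \<alpha> = stalk_map X k x \<beta>"
    and \<beta>': "\<beta>' \<in> carrier (stalk A (pt k x))" "\<gamma>' \<in> carrier (stalk A (pt k x)) - \<pp> x"
      "stalk_map X k x \<gamma>' \<otimes>\<^bsub>stalk X x\<^esub> \<alpha> = stalk_map X k x \<beta>'"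
  shows "fraction (stalk A (pt k x)) (\<pp> x) \<beta> \<gamma> = fraction (stalk A (pt k x)) (\<pp> x) \<beta>' \<gamma>'"
proof -
  let ?R = "stalk A (pt k x)" and ?S = "stalk X x" and ?h = "stalk_map X k x"
  interpret p: prime_localization ?R "\<pp> x" by (rule prime_loc[OF x])
  interpret h: ring_hom_cring ?R ?S ?h by (rule k.stalk_map_ring_hom_cring[OF x])
  have g: "\<gamma> \<in> carrier ?R" "\<gamma>' \<in> carrier ?R" using \<beta> \<beta>' by auto
  let ?d = "\<beta> \<otimes>\<^bsub>?R\<^esub> \<gamma>' \<ominus>\<^bsub>?R\<^esub> \<beta>' \<otimes>\<^bsub>?R\<^esub> \<gamma>"
  have "?h (\<beta> \<otimes>\<^bsub>?R\<^esub> \<gamma>') = (?h \<gamma> \<otimes>\<^bsub>?S\<^esub> \<alpha>) \<otimes>\<^bsub>?S\<^esub> ?h \<gamma>'" using \<beta> g by simp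
  also have "\<dots> = (?h \<gamma>' \<otimes>\<^bsub>?S\<^esub> \<alpha>) \<otimes>\<^bsub>?S\<^esub> ?h \<gamma>"
    using g \<alpha> by (simp add: h.S.m_ac)
  also have "\<dots> = ?h (\<beta>' \<otimes>\<^bsub>?R\<^esub> \<gamma>)" using \<beta>' g by simp
  finally have "?h ?d = \<zero>\<^bsub>?S\<^esub>"
    using \<beta>(1) \<beta>'(1) g by (simp add: a_minus_def h.S.r_neg del: h.hom_mult)
  moreover have d: "?d \<in> carrier ?R" using \<beta>(1) \<beta>'(1) g by simp
  ultimately obtain u where u: "u \<in> carrier ?R" "?h u \<notin> max_ideal ?S" "u \<otimes>\<^bsub>?R\<^esub> ?d = \<zero>\<^bsub>?R\<^esub>"
    using kernel[OF x] by blast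
  have "u \<otimes>\<^bsub>?R\<^esub> (\<beta> \<otimes>\<^bsub>?R\<^esub> \<gamma>') = u \<otimes>\<^bsub>?R\<^esub> ?d \<oplus>\<^bsub>?R\<^esub> u \<otimes>\<^bsub>?R\<^esub> (\<beta>' \<otimes>\<^bsub>?R\<^esub> \<gamma>)"
    using u(1) \<beta>(1) \<beta>'(1) g by algebra
  then have "u \<otimes>\<^bsub>?R\<^esub> (\<beta> \<otimes>\<^bsub>?R\<^esub> \<gamma>') = u \<otimes>\<^bsub>?R\<^esub> (\<beta>' \<otimes>\<^bsub>?R\<^esub> \<gamma>)"
    using u \<beta>(1) \<beta>'(1) g by simp
  then show ?thesis
    using u denom_iff \<beta> \<beta>' by (intro p.fraction_eqI[of _ _ _ _ u]) auto
qed

lemma fraction_exists: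
  assumes x: "x \<in> points X" and \<alpha>: "\<alpha> \<in> carrier (stalk X x)"
  obtains \<beta> \<gamma> where "\<beta> \<in> carrier (stalk A (pt k x))" "\<gamma> \<in> carrier (stalk A (pt k x)) - \<pp> x"
    "stalk_map X k x \<gamma> \<otimes>\<^bsub>stalk X x\<^esub> \<alpha> = stalk_map X k x \<beta>"
proof -
  obtain U a where U: "open_in X U" "x \<in> U" "a \<in> carrier (sec X U)" "\<alpha> = germ X x U a"
    using stalk_cases[OF \<alpha>] .
  obtain V t b and n :: nat where V: "open_in A V" "t \<in> carrier (sec A V)" "b \<in> carrier (sec A V)"
    and x': "x \<in> nonvanishing X (preim X k V) (shm k V t)" and
    eqs: "\<And>y. y \<in> nonvanishing X (preim X k V) (shm k V t) \<Longrightarrow>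
      stalk_map X k y (germ A (pt k y) V t [^]\<^bsub>stalk A (pt k y)\<^esub> n) \<otimes>\<^bsub>stalk X y\<^esub> germ X y U a
          = stalk_map X k y (germ A (pt k y) V b)"
    using local_fractionsE[OF U(1,3,2)] by metis
  note eq = eqs[OF x']
  interpret p: prime_localization "stalk A (pt k x)" "\<pp> x" by (rule prime_loc[OF x])
  have xV: "pt k x \<in> V" using x' by (simp add: nonvanishing_def)
  have t: "germ A (pt k x) V t \<in> carrier (stalk A (pt k x)) - \<pp> x"
    unfolding denom_iff using x' V xV x by (simp add: nonvanishing_def k.stalk_map_germ k.tgt.germ_closed)
  show thesis
    by (rule that[OF k.tgt.germ_closed[OF V(1) xV V(3)] p.pow_denom[OF t] eq[folded U(4)]])
qed

text \<open>By uniqueness every valid pair computes \<open>\<delta>\<close>, so the choice in its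
  definition disappears from here on: values are found by exhibiting a numerator and a
  denominator.\<close>

lemma \<delta>_eq:
  assumes x: "x \<in> points X" and \<alpha>: "\<alpha> \<in> carrier (stalk X x)"
    and \<beta>: "\<beta> \<in> carrier (stalk A (pt k x))" "\<gamma> \<in> carrier (stalk A (pt k x)) - \<pp> x"
      "stalk_map X k x \<gamma> \<otimes>\<^bsub>stalk X x\<^esub> \<alpha> = stalk_map X k x \<beta>"
  shows "\<delta> x \<alpha> = fraction (stalk A (pt k x)) (\<pp> x) \<beta> \<gamma>"
  unfolding \<delta>_def
proof (rule some_equality)
  show "\<exists>\<beta>'\<in>carrier (stalk A (pt k x)). \<exists>\<gamma>'\<in>carrier (stalk A (pt k x)) - \<pp> x.
      fraction (stalk A (pt k x)) (\<pp> x) \<beta> \<gamma> = fraction (stalk A (pt k x)) (\<pp> x) \<beta>' \<gamma>' \<and>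
      stalk_map X k x \<gamma>' \<otimes>\<^bsub>stalk X x\<^esub> \<alpha> = stalk_map X k x \<beta>'"
    by (intro bexI[of _ \<beta>] bexI[of _ \<gamma>] conjI refl) (rule \<beta>)+
next
  fix \<omega>
  assume "\<exists>\<beta>'\<in>carrier (stalk A (pt k x)). \<exists>\<gamma>'\<in>carrier (stalk A (pt k x)) - \<pp> x.
      \<omega> = fraction (stalk A (pt k x)) (\<pp> x) \<beta>' \<gamma>' \<and>
      stalk_map X k x \<gamma>' \<otimes>\<^bsub>stalk X x\<^esub> \<alpha> = stalk_map X k x \<beta>'"
  then obtain \<beta>' \<gamma>' where "\<beta>' \<in> carrier (stalk A (pt k x))" "\<gamma>' \<in> carrier (stalk A (pt k x)) - \<pp> x"
      "\<omega> = fraction (stalk A (pt k x)) (\<pp> x) \<beta>' \<gamma>'"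
      "stalk_map X k x \<gamma>' \<otimes>\<^bsub>stalk X x\<^esub> \<alpha> = stalk_map X k x \<beta>'" by (elim bexE conjE)
  then show "\<omega> = fraction (stalk A (pt k x)) (\<pp> x) \<beta> \<gamma>"
    using fraction_unique[OF x \<alpha> _ _ _ \<beta>] by simp
qed

lemma \<delta>_hom:
  assumes x: "x \<in> points X"
  shows "\<delta> x \<in> ring_hom (stalk X x) (localize_at (stalk A (pt k x)) (\<pp> x))"
proof -
  let ?R = "stalk A (pt k x)" and ?S = "stalk X x" and ?h = "stalk_map X k x"
  interpret p: prime_localization ?R "\<pp> x" by (rule prime_loc[OF x])
  interpret h: ring_hom_cring ?R ?S ?h by (rule k.stalk_map_ring_hom_cring[OF x])
  show ?thesis
  proof (rule ring_hom_memI)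
    show "\<delta> x \<alpha> \<in> carrier (localize_at ?R (\<pp> x))" if \<alpha>: "\<alpha> \<in> carrier ?S" for \<alpha>
    proof -
      obtain \<beta> \<gamma> where "\<beta> \<in> carrier ?R" "\<gamma> \<in> carrier ?R - \<pp> x" "?h \<gamma> \<otimes>\<^bsub>?S\<^esub> \<alpha> = ?h \<beta>"
        using fraction_exists[OF x \<alpha>] .
      then show ?thesis using \<delta>_eq[OF x \<alpha>] p.fraction_closed by metis
    qed
    show "\<delta> x (\<alpha> \<otimes>\<^bsub>?S\<^esub> \<alpha>') = \<delta> x \<alpha> \<otimes>\<^bsub>localize_at ?R (\<pp> x)\<^esub> \<delta> x \<alpha>'"
      "\<delta> x (\<alpha> \<oplus>\<^bsub>?S\<^esub> \<alpha>') = \<delta> x \<alpha> \<oplus>\<^bsub>localize_at ?R (\<pp> x)\<^esub> \<delta> x \<alpha>'"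
      if a: "\<alpha> \<in> carrier ?S" "\<alpha>' \<in> carrier ?S" for \<alpha> \<alpha>'
    proof -
      obtain \<beta> \<gamma> where b: "\<beta> \<in> carrier ?R" "\<gamma> \<in> carrier ?R - \<pp> x" "?h \<gamma> \<otimes>\<^bsub>?S\<^esub> \<alpha> = ?h \<beta>"
        using fraction_exists[OF x a(1)] .
      obtain \<beta>' \<gamma>' where b': "\<beta>' \<in> carrier ?R" "\<gamma>' \<in> carrier ?R - \<pp> x" "?h \<gamma>' \<otimes>\<^bsub>?S\<^esub> \<alpha>' = ?h \<beta>'"
        using fraction_exists[OF x a(2)] .
      have g: "\<gamma> \<in> carrier ?R" "\<gamma>' \<in> carrier ?R" using b b' by auto
      have hg: "?h \<gamma> \<in> carrier ?S" "?h \<gamma>' \<in> carrier ?S" using g by auto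
      have "?h (\<gamma> \<otimes>\<^bsub>?R\<^esub> \<gamma>') \<otimes>\<^bsub>?S\<^esub> (\<alpha> \<otimes>\<^bsub>?S\<^esub> \<alpha>') = (?h \<gamma> \<otimes>\<^bsub>?S\<^esub> \<alpha>) \<otimes>\<^bsub>?S\<^esub> (?h \<gamma>' \<otimes>\<^bsub>?S\<^esub> \<alpha>')"
        unfolding h.hom_mult[OF g] using hg a by algebra
      then have m: "?h (\<gamma> \<otimes>\<^bsub>?R\<^esub> \<gamma>') \<otimes>\<^bsub>?S\<^esub> (\<alpha> \<otimes>\<^bsub>?S\<^esub> \<alpha>') = ?h (\<beta> \<otimes>\<^bsub>?R\<^esub> \<beta>')"
        using b b' by simp
      have "?h (\<gamma> \<otimes>\<^bsub>?R\<^esub> \<gamma>') \<otimes>\<^bsub>?S\<^esub> (\<alpha> \<oplus>\<^bsub>?S\<^esub> \<alpha>')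
          = (?h \<gamma> \<otimes>\<^bsub>?S\<^esub> \<alpha>) \<otimes>\<^bsub>?S\<^esub> ?h \<gamma>' \<oplus>\<^bsub>?S\<^esub> (?h \<gamma>' \<otimes>\<^bsub>?S\<^esub> \<alpha>') \<otimes>\<^bsub>?S\<^esub> ?h \<gamma>"
        unfolding h.hom_mult[OF g] using hg a by algebra
      then have s: "?h (\<gamma> \<otimes>\<^bsub>?R\<^esub> \<gamma>') \<otimes>\<^bsub>?S\<^esub> (\<alpha> \<oplus>\<^bsub>?S\<^esub> \<alpha>')
          = ?h (\<beta> \<otimes>\<^bsub>?R\<^esub> \<gamma>' \<oplus>\<^bsub>?R\<^esub> \<beta>' \<otimes>\<^bsub>?R\<^esub> \<gamma>)"
        using b b' g by simp
      note e = \<delta>_eq[OF x a(1) b] \<delta>_eq[OF x a(2) b']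
      show "\<delta> x (\<alpha> \<otimes>\<^bsub>?S\<^esub> \<alpha>') = \<delta> x \<alpha> \<otimes>\<^bsub>localize_at ?R (\<pp> x)\<^esub> \<delta> x \<alpha>'"
        unfolding e p.fraction_mult[OF b(1,2) b'(1,2)]
        using a b(1) b'(1) p.mult_denom[OF b(2) b'(2)] m by (intro \<delta>_eq[OF x]) auto
      show "\<delta> x (\<alpha> \<oplus>\<^bsub>?S\<^esub> \<alpha>') = \<delta> x \<alpha> \<oplus>\<^bsub>localize_at ?R (\<pp> x)\<^esub> \<delta> x \<alpha>'"
        unfolding e p.fraction_add[OF b(1,2) b'(1,2)]
        using a b(1) b'(1) g p.mult_denom[OF b(2) b'(2)] s by (intro \<delta>_eq[OF x]) auto
    qed
    show "\<delta> x \<one>\<^bsub>?S\<^esub> = \<one>\<^bsub>localize_at ?R (\<pp> x)\<^esub>"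
      unfolding p.localize_one using p.one_denom by (intro \<delta>_eq[OF x]) auto
  qed
qed

lemma \<delta>_zero:
  assumes x: "x \<in> points X"
  shows "\<delta> x \<zero>\<^bsub>stalk X x\<^esub> = \<zero>\<^bsub>localize_at (stalk A (pt k x)) (\<pp> x)\<^esub>"
proof -
  interpret p: prime_localization "stalk A (pt k x)" "\<pp> x" by (rule prime_loc[OF x])
  interpret h: ring_hom_cring "stalk A (pt k x)" "stalk X x" "stalk_map X k x"
    by (rule k.stalk_map_ring_hom_cring[OF x])
  show ?thesis unfolding p.localize_zero using p.one_denom by (intro \<delta>_eq[OF x]) auto
qed

text \<open>Equal fractions give equal multiples of \<alpha> and \<alpha>' in the stalk of
  \<open>X\<close>. The common factor is the image of a product of denominators; it lies outside the
  maximal ideal, hence is a unit and cancels.\<close>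

lemma \<delta>_inj:
  assumes x: "x \<in> points X" and a: "\<alpha> \<in> carrier (stalk X x)" "\<alpha>' \<in> carrier (stalk X x)"
    and eq: "\<delta> x \<alpha> = \<delta> x \<alpha>'"
  shows "\<alpha> = \<alpha>'"
proof -
  let ?R = "stalk A (pt k x)" and ?S = "stalk X x" and ?h = "stalk_map X k x"
  interpret p: prime_localization ?R "\<pp> x" by (rule prime_loc[OF x])
  interpret h: ring_hom_cring ?R ?S ?h by (rule k.stalk_map_ring_hom_cring[OF x])
  obtain \<beta> \<gamma> where b: "\<beta> \<in> carrier ?R" "\<gamma> \<in> carrier ?R - \<pp> x" "?h \<gamma> \<otimes>\<^bsub>?S\<^esub> \<alpha> = ?h \<beta>"
    using fraction_exists[OF x a(1)] .
  obtain \<beta>' \<gamma>' where b': "\<beta>' \<in> carrier ?R" "\<gamma>' \<in> carrier ?R - \<pp> x" "?h \<gamma>' \<otimes>\<^bsub>?S\<^esub> \<alpha>' = ?h \<beta>'"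
    using fraction_exists[OF x a(2)] .
  obtain u where u: "u \<in> carrier ?R - \<pp> x" "u \<otimes>\<^bsub>?R\<^esub> (\<beta> \<otimes>\<^bsub>?R\<^esub> \<gamma>') = u \<otimes>\<^bsub>?R\<^esub> (\<beta>' \<otimes>\<^bsub>?R\<^esub> \<gamma>)"
    using eq unfolding \<delta>_eq[OF x a(1) b] \<delta>_eq[OF x a(2) b'] p.fraction_eq_iff[OF b(1,2) b'(1,2)] by blast
  have g: "\<gamma> \<in> carrier ?R" "\<gamma>' \<in> carrier ?R" "u \<in> carrier ?R" using b b' u by auto
  have hg: "?h \<gamma> \<in> carrier ?S" "?h \<gamma>' \<in> carrier ?S" "?h u \<in> carrier ?S" using g by auto
  have un: "?h u \<otimes>\<^bsub>?S\<^esub> (?h \<gamma> \<otimes>\<^bsub>?S\<^esub> ?h \<gamma>') \<in> Units ?S"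
    using stalk_map_denom_unit[OF x] u(1) b(2) b'(2) by (intro h.S.Units_m_closed)
  have "(?h u \<otimes>\<^bsub>?S\<^esub> (?h \<gamma> \<otimes>\<^bsub>?S\<^esub> ?h \<gamma>')) \<otimes>\<^bsub>?S\<^esub> \<alpha> = ?h u \<otimes>\<^bsub>?S\<^esub> ((?h \<gamma> \<otimes>\<^bsub>?S\<^esub> \<alpha>) \<otimes>\<^bsub>?S\<^esub> ?h \<gamma>')"
    using hg a by algebra
  also have "\<dots> = ?h (u \<otimes>\<^bsub>?R\<^esub> (\<beta> \<otimes>\<^bsub>?R\<^esub> \<gamma>'))" using b g by simp
  also have "\<dots> = ?h (u \<otimes>\<^bsub>?R\<^esub> (\<beta>' \<otimes>\<^bsub>?R\<^esub> \<gamma>))" by (simp only: u(2))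
  also have "\<dots> = ?h u \<otimes>\<^bsub>?S\<^esub> ((?h \<gamma>' \<otimes>\<^bsub>?S\<^esub> \<alpha>') \<otimes>\<^bsub>?S\<^esub> ?h \<gamma>)" using b' g by simp
  also have "\<dots> = (?h u \<otimes>\<^bsub>?S\<^esub> (?h \<gamma> \<otimes>\<^bsub>?S\<^esub> ?h \<gamma>')) \<otimes>\<^bsub>?S\<^esub> \<alpha>'" using hg a by algebra
  finally show ?thesis using h.S.Units_l_cancel[OF un a] by simp
qed

lemma \<delta>_surj:
  assumes x: "x \<in> points X" and \<omega>: "\<omega> \<in> carrier (localize_at (stalk A (pt k x)) (\<pp> x))"
  shows "\<exists>\<alpha>\<in>carrier (stalk X x). \<delta> x \<alpha> = \<omega>"
proof -
  let ?R = "stalk A (pt k x)" and ?S = "stalk X x" and ?h = "stalk_map X k x"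
  interpret p: prime_localization ?R "\<pp> x" by (rule prime_loc[OF x])
  interpret h: ring_hom_cring ?R ?S ?h by (rule k.stalk_map_ring_hom_cring[OF x])
  obtain \<beta> \<gamma> where b: "\<beta> \<in> carrier ?R" "\<gamma> \<in> carrier ?R - \<pp> x" "\<omega> = fraction ?R (\<pp> x) \<beta> \<gamma>"
    using p.fraction_cases[OF \<omega>] .
  note un = stalk_map_denom_unit[OF x b(2)]
  let ?\<alpha> = "inv\<^bsub>?S\<^esub> (?h \<gamma>) \<otimes>\<^bsub>?S\<^esub> ?h \<beta>"
  have hb: "?h \<beta> \<in> carrier ?S" using b by simp
  have "?h \<gamma> \<otimes>\<^bsub>?S\<^esub> ?\<alpha> = (?h \<gamma> \<otimes>\<^bsub>?S\<^esub> inv\<^bsub>?S\<^esub> (?h \<gamma>)) \<otimes>\<^bsub>?S\<^esub> ?h \<beta>"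
    using hb un h.S.Units_closed[OF un] h.S.Units_inv_closed[OF un] by (simp only: h.S.m_assoc)
  also have "\<dots> = ?h \<beta>" using hb un by simp
  finally have "\<delta> x ?\<alpha> = \<omega>"
    unfolding b(3) using b(1,2) hb un by (intro \<delta>_eq[OF x]) auto
  then show ?thesis using hb un by blast
qed

section \<open>The map from the localization back to \<open>X\<close>\<close>

definition D where
  "D = \<lparr>pt = inv_into (points X) c,
        shm = (\<lambda>U a. \<lambda>w\<in>{w \<in> points (loc A M). inv_into (points X) c w \<in> U}.
          \<delta> (inv_into (points X) c w) (germ X (inv_into (points X) c w) U a))\<rparr>"

lemma c_closed: "x \<in> points X \<Longrightarrow> c x \<in> points (loc A M)"
  using bij by (auto simp: bij_betw_def)

lemma pt_D_c: "x \<in> points X \<Longrightarrow> pt D (c x) = x"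
  using bij by (simp add: D_def bij_betw_def)

lemma loc_points_cases:
  assumes "w \<in> points (loc A M)"
  obtains x where "x \<in> points X" "w = c x"
  using assms bij by (auto simp: bij_betw_def)

lemma preim_D:
  assumes "open_in X U" shows "preim (loc A M) D U = c ` U"
proof -
  have U: "U \<subseteq> points X" by (rule openin_subset[OF assms])
  show ?thesis
  proof (intro equalityI subsetI)
    fix w assume w: "w \<in> preim (loc A M) D U"
    then have "w \<in> points (loc A M)" by simp
    then obtain x where x: "x \<in> points X" "w = c x" by (rule loc_points_cases)
    then show "w \<in> c ` U" using w pt_D_c by auto
  next
    fix w assume "w \<in> c ` U"
    then show "w \<in> preim (loc A M) D U" using U c_closed pt_D_c by auto
  qed
qed

lemma shm_D:
  assumes "open_in X U" "x \<in> U"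
  shows "shm D U a (c x) = \<delta> x (germ X x U a)"
proof -
  have x: "x \<in> points X" using assms openin_subset by blast
  have "inv_into (points X) c (c x) = x" using pt_D_c[OF x] by (simp add: D_def)
  then show ?thesis using assms c_closed[OF x] by (simp add: D_def)
qed

lemma shm_D_extensional: "open_in X U \<Longrightarrow> shm D U a \<in> extensional (c ` U)"
  unfolding preim_D[symmetric] by (simp add: D_def preim_def)

text \<open>A germ of \<open>A\<close> lies outside \<open>\<pp> x\<close> exactly when its image at
  \<open>x\<close> lies outside the maximal ideal. Thus basic open sets of the localization
  correspond to sets D(t), for the topology as well as for the domains of fractions.\<close>

lemma loc_basic_image:
  assumes V: "open_in A V" and t: "t \<in> carrier (sec A V)"
  shows "loc_basic A M V t = c ` nonvanishing X (preim X k V) (shm k V t)"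
proof -
  have *: "c x \<in> loc_basic A M V t \<longleftrightarrow> x \<in> nonvanishing X (preim X k V) (shm k V t)"
    if x: "x \<in> points X" for x
    using x k.contraction_mem[OF x max_mem] k.stalk_map_germ[OF x V _ t] k.tgt.germ_closed[OF V _ t]
    by (auto simp: c_eq loc_basic_def nonvanishing_def contraction_def)
  show ?thesis
  proof (intro equalityI subsetI)
    fix w assume w: "w \<in> loc_basic A M V t"
    then obtain x where "x \<in> points X" "w = c x"
      using loc_points_cases k.tgt.loc_basic_points[OF V] by blast
    then show "w \<in> c ` nonvanishing X (preim X k V) (shm k V t)" using * w by auto
  next
    fix w assume "w \<in> c ` nonvanishing X (preim X k V) (shm k V t)"
    then obtain x where "x \<in> nonvanishing X (preim X k V) (shm k V t)" "w = c x" by blast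
    then show "w \<in> loc_basic A M V t" using *[of x] by (auto simp: nonvanishing_def)
  qed
qed

text \<open>Applied to the section 1 of \<open>U\<close>, the condition on fractions retains only
  that sets D(t) with \<open>t\<close> from \<open>A\<close> and contained in \<open>U\<close> cover
  \<open>U\<close>.\<close>

lemma c_image_open:
  assumes U: "open_in X U"
  shows "open_in (loc A M) (c ` U)"
proof (subst openin_subopen, intro ballI)
  fix w assume "w \<in> c ` U"
  then obtain x where x: "x \<in> U" "w = c x" by blast
  have one: "\<one>\<^bsub>sec X U\<^esub> \<in> carrier (sec X U)" using sec_cring[OF U] by (simp add: cring.cring_simprules)
  obtain V t where V: "open_in A V" "t \<in> carrier (sec A V)"
    "x \<in> nonvanishing X (preim X k V) (shm k V t)" "nonvanishing X (preim X k V) (shm k V t) \<subseteq> U"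
    using local_fractionsE[OF U one x(1)] by metis
  have "w \<in> loc_basic A M V t"
    unfolding loc_basic_image[OF V(1,2)] x(2) by (rule imageI[OF V(3)])
  moreover have "loc_basic A M V t \<subseteq> c ` U"
    unfolding loc_basic_image[OF V(1,2)] by (rule image_mono[OF V(4)])
  ultimately show "\<exists>T. open_in (loc A M) T \<and> w \<in> T \<and> T \<subseteq> c ` U"
    using k.tgt.open_loc_basic[OF V(1,2)] by blast
qed

lemma pt_D_image_open:
  assumes V: "open_in (loc A M) V"
  shows "open_in X (pt D ` V)"
proof -
  have "continuous_map (top_sp X) (top_sp (loc A M)) c"
  proof (rule k.tgt.continuous_to_loc)
    show "c ` points X \<subseteq> points (loc A M)" using c_closed by blast
    fix U s assume U: "open_in A U" "s \<in> carrier (sec A U)"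
    let ?W = "nonvanishing X (preim X k U) (shm k U s)"
    have W: "open_in X ?W" using U by (intro nonvanishing_open k.preim_open k.shm_closed)
    have "{x \<in> points X. c x \<in> loc_basic A M U s} = ?W"
      unfolding loc_basic_image[OF U] using openin_subset[OF W] bij
      by (auto simp: bij_betw_def dest: inj_onD)
    then show "open_in X {x \<in> points X. c x \<in> loc_basic A M U s}" using W by simp
  qed
  then have "open_in X {x \<in> points X. c x \<in> V}" using V by (simp add: continuous_map_def)
  moreover have "pt D ` V = {x \<in> points X. c x \<in> V}"
  proof (intro equalityI subsetI)
    fix x assume "x \<in> pt D ` V"
    then obtain w where w: "w \<in> V" "x = pt D w" by blast
    obtain y where "y \<in> points X" "w = c y"
      using loc_points_cases[of w] w openin_subset[OF V] by blast
    then show "x \<in> {x \<in> points X. c x \<in> V}" using w pt_D_c by simp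
  next
    fix x assume "x \<in> {x \<in> points X. c x \<in> V}"
    then show "x \<in> pt D ` V" using pt_D_c by (force intro: rev_image_eqI)
  qed
  ultimately show ?thesis by simp
qed

lemma loc_ring_at_c: "loc_ring_at A (c x) = localize_at (stalk A (pt k x)) (\<pp> x)"
  by (simp add: c_eq loc_ring_at_pair)

lemma fraction_value:
  assumes V: "open_in A V" "t \<in> carrier (sec A V)" "b \<in> carrier (sec A V)"
    and y: "y \<in> nonvanishing X (preim X k V) (shm k V t)"
  shows "germ A (pt k y) V b \<in> carrier (stalk A (pt k y))"
    "germ A (pt k y) V t [^]\<^bsub>stalk A (pt k y)\<^esub> (n::nat) \<in> carrier (stalk A (pt k y)) - \<pp> y"
    "(pt k y, \<pp> y) \<in> loc_basic A M V t"
proof -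
  show l: "(pt k y, \<pp> y) \<in> loc_basic A M V t"
    unfolding loc_basic_image[OF V(1,2)] c_eq[symmetric] using y by blast
  then show "germ A (pt k y) V t [^]\<^bsub>stalk A (pt k y)\<^esub> (n::nat) \<in> carrier (stalk A (pt k y)) - \<pp> y"
    using k.tgt.loc_basic_denom[OF V(1,2)] by blast
  show "germ A (pt k y) V b \<in> carrier (stalk A (pt k y))"
    using k.tgt.loc_basic_denom(1)[OF V(1,2) l] V by (intro k.tgt.germ_closed)
qed

text \<open>The equation t^n a = b on D(t), read at a point, says that \<open>\<delta>\<close> takes
  the value b / t^n there, which is the local form required of a section.\<close>

lemma shm_D_closed:
  assumes U: "open_in X U" and a: "a \<in> carrier (sec X U)"
  shows "shm D U a \<in> loc_sections A M (c ` U)"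
proof (rule k.tgt.loc_sectionsI)
  show "shm D U a \<in> extensional (c ` U)" by (rule shm_D_extensional[OF U])
  fix w assume "w \<in> c ` U"
  then obtain x where x: "x \<in> U" "w = c x" by blast
  have xX: "x \<in> points X" using x U openin_subset by blast
  show "shm D U a w \<in> carrier (loc_ring_at A w)"
    unfolding x(2) shm_D[OF U x(1)] loc_ring_at_c
    by (rule ring_hom_closed[OF \<delta>_hom[OF xX] germ_closed[OF U x(1) a]])
  obtain V t b and n :: nat where V: "open_in A V" "t \<in> carrier (sec A V)" "b \<in> carrier (sec A V)"
    "x \<in> nonvanishing X (preim X k V) (shm k V t)" "nonvanishing X (preim X k V) (shm k V t) \<subseteq> U"
    and eq: "\<And>y. y \<in> nonvanishing X (preim X k V) (shm k V t) \<Longrightarrow>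
      stalk_map X k y (germ A (pt k y) V t [^]\<^bsub>stalk A (pt k y)\<^esub> n) \<otimes>\<^bsub>stalk X y\<^esub> germ X y U a
          = stalk_map X k y (germ A (pt k y) V b)"
    using local_fractionsE[OF U a x(1)] by metis
  have "shm D U a (y, p) = fraction (stalk A y) p (germ A y V b) (germ A y V t [^]\<^bsub>stalk A y\<^esub> n)"
    if yp: "(y, p) \<in> loc_basic A M V t" for y p
  proof -
    obtain z where z: "z \<in> nonvanishing X (preim X k V) (shm k V t)" "(y, p) = c z"
      using yp unfolding loc_basic_image[OF V(1,2)] by blast
    have zU: "z \<in> U" and zX: "z \<in> points X" using z V openin_subset[OF U] by auto
    have yz: "y = pt k z" "p = \<pp> z" using z(2) by (simp_all add: c_eq)
    show ?thesis
      unfolding z(2) shm_D[OF U zU]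
      unfolding yz using fraction_value[OF V(1-3) z(1)] eq[OF z(1)] germ_closed[OF U zU a]
      by (intro \<delta>_eq[OF zX]) auto
  qed
  moreover have "w \<in> loc_basic A M V t" "loc_basic A M V t \<subseteq> c ` U"
    unfolding loc_basic_image[OF V(1,2)] using x V(4,5) by auto
  ultimately show "\<exists>V t b (n::nat). open_in A V \<and> t \<in> carrier (sec A V) \<and> b \<in> carrier (sec A V) \<and>
        w \<in> loc_basic A M V t \<and> loc_basic A M V t \<subseteq> c ` U \<and>
        (\<forall>y p. (y, p) \<in> loc_basic A M V t \<longrightarrow>
          shm D U a (y, p) = fraction (stalk A y) p (germ A y V b) (germ A y V t [^]\<^bsub>stalk A y\<^esub> n))"
    using V(1-3) by (intro exI[of _ V] exI[of _ t] exI[of _ b] exI[of _ n]) simp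
qed

lemma shm_D_inj:
  assumes U: "open_in X U" and a: "a \<in> carrier (sec X U)" "b \<in> carrier (sec X U)"
    and eq: "shm D U a = shm D U b"
  shows "a = b"
proof (rule sections_eq_germsI[OF U a])
  fix x assume x: "x \<in> U"
  then have xX: "x \<in> points X" using U openin_subset by blast
  show "germ X x U a = germ X x U b"
    using fun_cong[OF eq, of "c x"] germ_closed[OF U x] a
    unfolding shm_D[OF U x] by (intro \<delta>_inj[OF xX])
qed

text \<open>The values of \<open>s\<close> have preimages under the maps \<open>\<delta>\<close>.
  Where \<open>s\<close> is b / t^n, these preimages are the germs of one section, the image of
  \<open>b\<close> multiplied by the inverse of t^n on D(t), so they glue.\<close>

lemma shm_D_surj:
  assumes U: "open_in X U" and s: "s \<in> loc_sections A M (c ` U)"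
  obtains a where "a \<in> carrier (sec X U)" "shm D U a = s"
proof -
  define \<sigma> where "\<sigma> x = (SOME \<alpha>. \<alpha> \<in> carrier (stalk X x) \<and> \<delta> x \<alpha> = s (c x))" for x
  have \<sigma>: "\<sigma> x \<in> carrier (stalk X x)" "\<delta> x (\<sigma> x) = s (c x)" if x: "x \<in> U" for x
  proof -
    have "x \<in> points X" using x U openin_subset by blast
    then have "\<exists>\<alpha>. \<alpha> \<in> carrier (stalk X x) \<and> \<delta> x \<alpha> = s (c x)"
      using \<delta>_surj[of x "s (c x)"] k.tgt.loc_sections_value[OF s, of "c x"] x by (auto simp: loc_ring_at_c)
    from someI_ex[OF this] show "\<sigma> x \<in> carrier (stalk X x)" "\<delta> x (\<sigma> x) = s (c x)"
      unfolding \<sigma>_def by auto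
  qed
  have "\<exists>a\<in>carrier (sec X U). \<forall>x\<in>U. germ X x U a = \<sigma> x"
  proof (rule glue_germs[OF U])
    fix x assume x: "x \<in> U"
    then have "c x \<in> c ` U" by blast
    then obtain V t b and n :: nat where V: "open_in A V" "t \<in> carrier (sec A V)" "b \<in> carrier (sec A V)"
      "c x \<in> loc_basic A M V t" "loc_basic A M V t \<subseteq> c ` U" and
      val: "\<And>y p. (y, p) \<in> loc_basic A M V t \<Longrightarrow>
        s (y, p) = fraction (stalk A y) p (germ A y V b) (germ A y V t [^]\<^bsub>stalk A y\<^esub> n)"
      using k.tgt.loc_sections_local[OF s] by metis
    let ?P = "preim X k V"
    let ?W = "nonvanishing X ?P (shm k V t)"
    have P: "open_in X ?P" "shm k V t \<in> carrier (sec X ?P)" "shm k V b \<in> carrier (sec X ?P)"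
      using V by (auto intro: k.preim_open k.shm_closed)
    have W: "open_in X ?W" "?W \<subseteq> ?P" using P nonvanishing_open nonvanishing_subset by auto
    have WX: "?W \<subseteq> points X" by (rule openin_subset[OF W(1)])
    have UX: "U \<subseteq> points X" by (rule openin_subset[OF U])
    have cW: "y \<in> ?W \<longleftrightarrow> c y \<in> loc_basic A M V t" if "y \<in> points X" for y
      unfolding loc_basic_image[OF V(1,2)] using bij that WX
      by (auto simp: bij_betw_def dest: inj_onD)
    have xW: "x \<in> ?W" using cW x UX V(4) by blast
    \<comment> \<open>Injectivity of \<open>c\<close> turns the inclusion of images in the
      localization into an inclusion in \<open>X\<close>.\<close>
    have WU: "?W \<subseteq> U"
    proof
      fix y assume y: "y \<in> ?W"
      then have "c y \<in> c ` U" using cW[of y] V(5) WX by blast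
      then show "y \<in> U" using bij y WX UX by (auto simp: bij_betw_def dest: inj_onD)
    qed
    interpret W: cring "sec X ?W" by (rule sec_cring[OF W(1)])
    let ?t = "res X ?P ?W (shm k V t)"
    have tu: "?t \<in> Units (sec X ?W)" by (rule res_nonvanishing_unit[OF P(1,2) W(1)]) simp
    have tn: "?t [^]\<^bsub>sec X ?W\<^esub> n \<in> Units (sec X ?W)" by (rule W.Units_pow_closed[OF tu])
    have bc: "res X ?P ?W (shm k V b) \<in> carrier (sec X ?W)"
      by (rule res_closed[OF P(1) W P(3)])
    \<comment> \<open>The denominator is invertible as a section on \<open>?W\<close>, not only at
      each point, so b / t^n is an honest section there.\<close>
    define e where "e = inv\<^bsub>sec X ?W\<^esub> (?t [^]\<^bsub>sec X ?W\<^esub> n) \<otimes>\<^bsub>sec X ?W\<^esub> res X ?P ?W (shm k V b)"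
    have e: "e \<in> carrier (sec X ?W)" using tn bc by (simp add: e_def)
    have te: "?t [^]\<^bsub>sec X ?W\<^esub> n \<otimes>\<^bsub>sec X ?W\<^esub> e = res X ?P ?W (shm k V b)"
      unfolding e_def using W.m_assoc[OF W.Units_closed[OF tn] W.Units_inv_closed[OF tn] bc] tn bc by simp
    have "germ X y ?W e = \<sigma> y" if y: "y \<in> ?W" for y
    proof -
      have yX: "y \<in> points X" and yU: "y \<in> U" and yP: "y \<in> ?P" using y WU UX W by auto
      note fv = fraction_value[OF V(1-3) y]
      have yV: "pt k y \<in> V" using yP by simp
      interpret h: ring_hom_cring "stalk A (pt k y)" "stalk X y" "stalk_map X k y"
        by (rule k.stalk_map_ring_hom_cring[OF yX])
      have "stalk_map X k y (germ A (pt k y) V t [^]\<^bsub>stalk A (pt k y)\<^esub> n)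
          = stalk_map X k y (germ A (pt k y) V t) [^]\<^bsub>stalk X y\<^esub> n"
        using k.tgt.germ_closed[OF V(1) yV V(2)] by (rule h.ring.hom_nat_pow)
      also have "\<dots> = germ X y ?W (?t [^]\<^bsub>sec X ?W\<^esub> n)"
        using germ_res[OF P(1) W y P(2)] k.stalk_map_germ[OF yX V(1) yV V(2)]
          germ_pow[OF W(1) y, of ?t n] W.Units_closed[OF tu] by simp
      finally have "stalk_map X k y (germ A (pt k y) V t [^]\<^bsub>stalk A (pt k y)\<^esub> n)
          \<otimes>\<^bsub>stalk X y\<^esub> germ X y ?W e = germ X y ?W (res X ?P ?W (shm k V b))"
        using germ_mult_add(1)[OF W(1) y W.Units_closed[OF tn] e] te by simp
      also have "\<dots> = stalk_map X k y (germ A (pt k y) V b)"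
        using germ_res[OF P(1) W y P(3)] k.stalk_map_germ[OF yX V(1) yV V(3)] by simp
      finally have "\<delta> y (germ X y ?W e) = s (pt k y, \<pp> y)"
        unfolding val[OF fv(3)] using fv(1,2) germ_closed[OF W(1) y e] by (intro \<delta>_eq[OF yX])
      then show ?thesis
        using \<delta>_inj[OF yX germ_closed[OF W(1) y e] \<sigma>(1)[OF yU]] \<sigma>(2)[OF yU] by (simp add: c_eq)
    qed
    then show "\<exists>W. open_in X W \<and> x \<in> W \<and> W \<subseteq> U \<and> (\<exists>s\<in>carrier (sec X W). \<forall>y\<in>W. germ X y W s = \<sigma> y)"
      using W(1) xW WU e by blast
  qed
  then obtain a where a: "a \<in> carrier (sec X U)" "\<And>x. x \<in> U \<Longrightarrow> germ X x U a = \<sigma> x" by blast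
  have "shm D U a = s"
  proof (rule extensionalityI[OF shm_D_extensional[OF U] k.tgt.loc_sections_extensional[OF s]])
    fix w assume "w \<in> c ` U"
    then show "shm D U a w = s w" using shm_D[OF U] a(2) \<sigma>(2) by auto
  qed
  then show thesis using that a(1) by blast
qed

lemma shm_D_pointwise:
  assumes U: "open_in X U"
    and "\<And>x. x \<in> U \<Longrightarrow> \<delta> x (germ X x U a) = g (c x)"
  shows "shm D U a = restrict g (c ` U)"
  using assms shm_D[OF U] by (intro extensionalityI[OF shm_D_extensional[OF U]]) auto

lemma transport: "lrs_transport X (loc A M) D"
proof
  show "bij_betw (pt D) (points (loc A M)) (points X)"
    using bij_betw_inv_into[OF bij] by (simp add: D_def)
  show "open_in (loc A M) (preim (loc A M) D U)" if "open_in X U" for U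
    using that c_image_open preim_D by simp
  show "open_in X (pt D ` V)" if "open_in (loc A M) V" for V
    using that by (rule pt_D_image_open)
  fix U assume U: "open_in X U"
  have UX: "x \<in> points X" if "x \<in> U" for x using that U openin_subset by blast
  note pre = preim_D[OF U]
  show "bij_betw (shm D U) (carrier (sec X U)) (carrier (sec (loc A M) (preim (loc A M) D U)))"
    unfolding pre carrier_sec_loc bij_betw_def
  proof (intro conjI inj_onI equalityI subsetI)
    show "a = b" if "a \<in> carrier (sec X U)" "b \<in> carrier (sec X U)" "shm D U a = shm D U b" for a b
      using shm_D_inj[OF U that] .
    show "s \<in> loc_sections A M (c ` U)" if "s \<in> shm D U ` carrier (sec X U)" for s
      using that shm_D_closed[OF U] by blast
    show "s \<in> shm D U ` carrier (sec X U)" if "s \<in> loc_sections A M (c ` U)" for s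
      using shm_D_surj[OF U that] by blast
  qed
  show "shm D U \<one>\<^bsub>sec X U\<^esub> = \<one>\<^bsub>sec (loc A M) (preim (loc A M) D U)\<^esub>"
    "shm D U \<zero>\<^bsub>sec X U\<^esub> = \<zero>\<^bsub>sec (loc A M) (preim (loc A M) D U)\<^esub>"
    unfolding pre one_sec_loc zero_sec_loc
    using UX by (auto intro!: shm_D_pointwise[OF U]
      simp: germ_one_zero[OF U] loc_ring_at_c \<delta>_zero ring_hom_one[OF \<delta>_hom])
  {
    fix a b assume a: "a \<in> carrier (sec X U)" and b: "b \<in> carrier (sec X U)"
    show "shm D U (a \<otimes>\<^bsub>sec X U\<^esub> b) = shm D U a \<otimes>\<^bsub>sec (loc A M) (preim (loc A M) D U)\<^esub> shm D U b"
      "shm D U (a \<oplus>\<^bsub>sec X U\<^esub> b) = shm D U a \<oplus>\<^bsub>sec (loc A M) (preim (loc A M) D U)\<^esub> shm D U b"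
      unfolding pre mult_sec_loc add_sec_loc
      using UX germ_closed[OF U _ a] germ_closed[OF U _ b]
      by (auto intro!: shm_D_pointwise[OF U] simp: germ_mult_add[OF U _ a b, symmetric] loc_ring_at_c shm_D[OF U]
          ring_hom_mult[OF \<delta>_hom] ring_hom_add[OF \<delta>_hom])
  }
  fix U' a assume U': "open_in X U'" "U' \<subseteq> U" and a: "a \<in> carrier (sec X U)"
  show "shm D U' (res X U U' a) = res (loc A M) (preim (loc A M) D U) (preim (loc A M) D U') (shm D U a)"
    unfolding preim_D[OF U'(1)] res_loc
    using U' germ_res[OF U U'] a shm_D[OF U] by (intro shm_D_pointwise[OF U'(1)]) auto
qed

section \<open>Relation of \<open>D\<close> to the induced map of localizations\<close>

sublocale tr: lrs_transport X "loc A M" D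
  by (rule transport)

lemma points_loc_local: "(x, z) \<in> points (loc X (local_prime_system X)) \<longleftrightarrow>
    x \<in> points X \<and> z = max_ideal (stalk X x)"
  by (simp add: k.src.points_loc local_prime_system_def)

lemma pt_D_loc_map:
  assumes "w \<in> points (loc X (local_prime_system X))"
  shows "pt D (pt (loc_map X (local_prime_system X) A k) w) = fst w"
proof -
  obtain x where "x \<in> points X" "w = (x, max_ideal (stalk X x))"
    using assms points_loc_local by (cases w) auto
  then show ?thesis using pt_D_c by (simp add: c_def)
qed

text \<open>On points both sides are the first projection. On values, a fraction with numerator
  \<beta> and denominator \<gamma> is carried to the quotient of their images in the stalk of
  \<open>X\<close>, and the equation that characterizes \<open>\<delta>\<close> says that this
  quotient is the germ over 1.\<close>

lemma D_loc_map:
  "rs_eq (loc X (local_prime_system X)) X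
    (rs_comp (loc A M) D (loc_map X (local_prime_system X) A k)) (loc_proj X (local_prime_system X))"
  unfolding rs_eq_def
proof (intro conjI ballI allI impI)
  let ?L = "loc X (local_prime_system X)" and ?l = "loc_map X (local_prime_system X) A k"
  show "pt (rs_comp (loc A M) D ?l) w = pt (loc_proj X (local_prime_system X)) w" if "w \<in> points ?L" for w
    using pt_D_loc_map[OF that] by (simp add: rs_comp_def loc_proj_def)
  fix U a assume U: "open_in X U" and a: "a \<in> carrier (sec X U)"
  have pre: "preim ?L ?l (preim (loc A M) D U) = {w \<in> points ?L. fst w \<in> U}"
    using pt_D_loc_map k.pt_loc_map_closed by auto
  have "shm ?l (preim (loc A M) D U) (shm D U a)
      = (\<lambda>(x, z)\<in>{w \<in> points ?L. fst w \<in> U}. fraction (stalk X x) z (germ X x U a) \<one>\<^bsub>stalk X x\<^esub>)"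
  proof (rule extensionalityI[OF k.shm_loc_map_extensional[of _ "shm D U a"]])
    show "(\<lambda>(x, z)\<in>{w \<in> points ?L. fst w \<in> U}. fraction (stalk X x) z (germ X x U a) \<one>\<^bsub>stalk X x\<^esub>)
      \<in> extensional (preim ?L ?l (preim (loc A M) D U))"
      unfolding pre by simp
    fix w assume w: "w \<in> preim ?L ?l (preim (loc A M) D U)"
    then have "fst w \<in> U" "w \<in> points ?L" unfolding pre by auto
    then obtain x where x: "x \<in> U" "x \<in> points X" and wx: "w = (x, max_ideal (stalk X x))"
      using points_loc_local by (cases w) auto
    let ?R = "stalk A (pt k x)" and ?S = "stalk X x" and ?h = "stalk_map X k x" and ?m = "max_ideal (stalk X x)"
    interpret h: ring_hom_cring ?R ?S ?h by (rule k.stalk_map_ring_hom_cring[OF x(2)])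
    interpret m: prime_localization ?S ?m
      by (rule k.src.prime_localization_at[OF x(2) max_mem])
    note g = germ_closed[OF U x(1) a]
    obtain \<beta> \<gamma> where b: "\<beta> \<in> carrier ?R" "\<gamma> \<in> carrier ?R - \<pp> x" "?h \<gamma> \<otimes>\<^bsub>?S\<^esub> germ X x U a = ?h \<beta>"
      using fraction_exists[OF x(2) g] .
    have hg: "?h \<gamma> \<notin> ?m" "\<gamma> \<in> carrier ?R" using b(2) denom_iff by auto
    have "shm ?l (preim (loc A M) D U) (shm D U a) w = localize_hom ?S ?m ?h (shm D U a (c x))"
      using w unfolding wx by (simp add: k.shm_loc_map c_def)
    also have "\<dots> = localize_hom ?S ?m ?h (fraction ?R (\<pp> x) \<beta> \<gamma>)"
      unfolding shm_D[OF U x(1)] \<delta>_eq[OF x(2) g b] ..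
    also have "\<dots> = fraction ?S ?m (?h \<beta>) (?h \<gamma>)"
      using hg b(1) m.prime by (intro localize_hom_fraction h.R.is_cring h.S.is_cring h.homh)
    also have "\<dots> = fraction ?S ?m (germ X x U a) \<one>\<^bsub>?S\<^esub>"
      using hg b g m.one_denom h.S.m_comm by (intro m.fraction_eqI') auto
    finally show "shm ?l (preim (loc A M) D U) (shm D U a) w
      = (\<lambda>(x, z)\<in>{w \<in> points ?L. fst w \<in> U}. fraction (stalk X x) z (germ X x U a) \<one>\<^bsub>stalk X x\<^esub>) w"
      using w unfolding pre by (simp add: wx)
  qed
  then show "shm (rs_comp (loc A M) D ?l) U a = shm (loc_proj X (local_prime_system X)) U a"
    by (simp add: rs_comp_def loc_proj_def)
qed

text \<open>Any inverse of the projection is allowed, because \<open>lrs_inverse\<close> is only known up to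
  \<open>rs_eq\<close>.\<close>

lemma loc_map_inverse_eq_E:
  assumes L: "ringed_space (loc X (local_prime_system X))"
    and g: "rs_morphism X (loc X (local_prime_system X)) g"
    and pg: "rs_eq X X (rs_comp (loc X (local_prime_system X)) (loc_proj X (local_prime_system X)) g) rs_id"
  shows "rs_eq X (loc A M)
    (rs_comp (loc X (local_prime_system X)) (loc_map X (local_prime_system X) A k) g) tr.E"
proof -
  let ?L = "loc X (local_prime_system X)" and ?l = "loc_map X (local_prime_system X) A k"
  let ?Z = "loc A M" and ?p = "loc_proj X (local_prime_system X)"
  have l: "rs_morphism ?L ?Z ?l" by (rule k.loc_map_morphism[OF L tr.ringed_target])
  have lg: "rs_morphism X ?Z (rs_comp ?L ?l g)" by (rule rs_morphism_comp[OF g l])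
  \<comment> \<open>The computation: \<open>D\<close> after \<open>?l\<close> is the projection, so
    \<open>D\<close> after \<open>?l\<close> after \<open>g\<close> is the identity. Composing with
    \<open>tr.E\<close>, a left inverse of \<open>D\<close>, gives the claim.\<close>
  have "rs_eq X X (rs_comp ?Z D (rs_comp ?L ?l g)) (rs_comp ?L (rs_comp ?Z D ?l) g)"
    by (rule rs_comp_assoc[OF l])
  also have "rs_eq X X \<dots> (rs_comp ?L ?p g)" by (rule rs_comp_cong_left[OF g D_loc_map])
  finally (rs_eq_trans) have 1: "rs_eq X X (rs_comp ?Z D (rs_comp ?L ?l g)) rs_id"
    using pg rs_eq_trans by blast
  have "rs_eq X ?Z (rs_comp ?L ?l g) (rs_comp ?Z rs_id (rs_comp ?L ?l g))"
    by (rule rs_eq_sym[OF rs_comp_id_left[OF lg]])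
  also have "rs_eq X ?Z \<dots> (rs_comp ?Z (rs_comp X tr.E D) (rs_comp ?L ?l g))"
    by (rule rs_comp_cong_left[OF lg rs_eq_sym[OF tr.E_D]])
  also (rs_eq_trans) have "rs_eq X ?Z \<dots> (rs_comp X tr.E (rs_comp ?Z D (rs_comp ?L ?l g)))"
    by (rule rs_eq_sym[OF rs_comp_assoc[OF tr.D_morphism]])
  also (rs_eq_trans) have "rs_eq X ?Z \<dots> (rs_comp X tr.E rs_id)"
    by (rule rs_comp_cong_right[OF tr.E_morphism 1])
  also (rs_eq_trans) have "rs_eq X ?Z \<dots> tr.E" by (rule rs_comp_id_right)
  finally (rs_eq_trans) show ?thesis .
qed

end

section \<open>The spectrum of a ring\<close>

lemma (in cring) idealI_cring:
  assumes "I \<subseteq> carrier R" "\<zero> \<in> I"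
    and "\<And>a b. a \<in> I \<Longrightarrow> b \<in> I \<Longrightarrow> a \<oplus> b \<in> I"
    and mult: "\<And>a r. a \<in> I \<Longrightarrow> r \<in> carrier R \<Longrightarrow> r \<otimes> a \<in> I"
  shows "ideal I R"
proof (rule idealI)
  show "subgroup I (add_monoid R)"
  proof (rule add.subgroupI)
    show "\<ominus> a \<in> I" if "a \<in> I" for a
    proof -
      have "a \<in> carrier R" using that assms(1) by blast
      then have "\<ominus> a = (\<ominus> \<one>) \<otimes> a" using l_minus by simp
      then show ?thesis using mult[OF that, of "\<ominus> \<one>"] by simp
    qed
  qed (use assms in auto)
  show "a \<otimes> x \<in> I" if "a \<in> I" "x \<in> carrier R" for a x
    using mult[OF that] that assms(1) m_comm[of a x] by auto
qed (use mult ring_axioms in auto)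

text \<open>Replaces the choice of a finite subcover of D(f). To prove a statement on D(f), collect
  in an ideal the elements for which it holds, show that the ideal meets the complement of each
  prime in D(f), and conclude for a power of \<open>f\<close>.\<close>

lemma (in cring) power_mem_idealI:
  assumes "ideal I R" "f \<in> carrier R"
    and "\<And>P. primeideal P R \<Longrightarrow> f \<notin> P \<Longrightarrow> \<exists>b\<in>I. b \<notin> P"
  shows "\<exists>n::nat. f [^] n \<in> I"
proof (rule ccontr)
  assume "\<not> ?thesis"
  then obtain P where "primeideal P R" "I \<subseteq> P" "f \<notin> P"
    using exists_prime_avoiding_powers[OF assms(1,2)] by blast
  then show False using assms(3) by blast
qed

locale ring_spec = cring R for R :: "'r ring" (structure)
begin

definition basic :: "'r \<Rightarrow> 'r set set" where
  "basic b = {q \<in> prime_spectrum R. b \<notin> q}"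

abbreviation \<iota> :: "'r set \<Rightarrow> 'r \<Rightarrow> ('r \<times> 'r) set" where
  "\<iota> q r \<equiv> fraction R q r \<one>"

lemma basicD: "q \<in> basic b \<Longrightarrow> primeideal q R" "q \<in> basic b \<Longrightarrow> b \<notin> q"
  by (auto simp: basic_def prime_spectrum_def)

lemma prime_loc: "primeideal q R \<Longrightarrow> prime_localization R q"
  by (intro prime_localization.intro prime_localization_axioms.intro is_cring)

lemma spec_primeD: "q \<in> prime_spectrum R \<Longrightarrow> primeideal q R"
  by (simp add: prime_spectrum_def)

lemma prime_mult_iff:
  assumes "primeideal q R" "a \<in> carrier R" "b \<in> carrier R"
  shows "a \<otimes> b \<in> q \<longleftrightarrow> a \<in> q \<or> b \<in> q"
proof -
  interpret primeideal q R by fact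
  show ?thesis using I_prime[OF assms(2,3)] I_l_closed[OF _ assms(2)] I_r_closed[OF _ assms(3)] by blast
qed

lemma basic_mult:
  "a \<in> carrier R \<Longrightarrow> b \<in> carrier R \<Longrightarrow> basic (a \<otimes> b) = basic a \<inter> basic b"
  using prime_mult_iff by (auto simp: basic_def prime_spectrum_def)

lemma basic_one: "basic \<one> = prime_spectrum R"
proof -
  have "\<one> \<notin> q" if "q \<in> prime_spectrum R" for q
    using prime_localization.one_denom[OF prime_loc[OF spec_primeD[OF that]]] by blast
  then show ?thesis by (auto simp: basic_def)
qed

lemma top_Spec: "top_sp (Spec R) = topology_generated_by {basic b | b. b \<in> carrier R}"
  by (simp add: Spec_def basic_def)

lemma points_Spec: "points (Spec R) = prime_spectrum R"
proof -
  have "basic b \<subseteq> prime_spectrum R" for b by (auto simp: basic_def)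
  then have "\<Union>{basic b | b. b \<in> carrier R} = prime_spectrum R" using basic_one by blast
  then show ?thesis by (simp add: top_Spec)
qed

lemma basic_open: "b \<in> carrier R \<Longrightarrow> open_in (Spec R) (basic b)"
  unfolding top_Spec by (rule topology_generated_by_Basis) blast

text \<open>The basic sets are closed under binary intersection, since D(a) and D(b) meet in D(ab),
  so they are a basis of the topology they generate.\<close>

lemma basic_basis:
  assumes "open_in (Spec R) V" "q \<in> V"
  shows "\<exists>b\<in>carrier R. q \<in> basic b \<and> basic b \<subseteq> V"
proof -
  have "generate_topology_on {basic b | b. b \<in> carrier R} V"
    using assms(1) unfolding top_Spec by (rule openin_topology_generated_by)
  then show ?thesis using assms(2)
  proof (induction arbitrary: q)
    case (Int A B)
    obtain a where "a \<in> carrier R" "q \<in> basic a" "basic a \<subseteq> A" using Int by blast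
    moreover obtain b where "b \<in> carrier R" "q \<in> basic b" "basic b \<subseteq> B" using Int by blast
    ultimately show ?case by (intro bexI[of _ "a \<otimes> b"]) (auto simp: basic_mult)
  next
    case (UN K)
    then show ?case by (meson Union_iff Sup_upper order_trans)
  qed auto
qed

section \<open>Sections of the spectrum over a basic open set\<close>

text \<open>The multipliers that equalize \<open>r\<close> and \<open>r'\<close> form an ideal, and
  equality in the localization at q provides such a multiplier outside q. Up to a power of
  \<open>f\<close>, this is injectivity of the map from R_f to the sections over D(f).\<close>

lemma spec_zero:
  assumes f: "f \<in> carrier R" and r: "r \<in> carrier R" "r' \<in> carrier R"
    and eq: "\<And>q. q \<in> basic f \<Longrightarrow> \<iota> q r = \<iota> q r'"
  shows "\<exists>n::nat. f [^] n \<otimes> r = f [^] n \<otimes> r'"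
proof -
  let ?I = "{u \<in> carrier R. u \<otimes> r = u \<otimes> r'}"
  have "ideal ?I R"
    by (rule idealI_cring) (use r in \<open>auto simp: l_distr m_assoc\<close>)
  moreover have "\<exists>b\<in>?I. b \<notin> P" if P: "primeideal P R" "f \<notin> P" for P
  proof -
    interpret prime_localization R P by (rule prime_loc[OF P(1)])
    have "P \<in> basic f" using P by (simp add: basic_def prime_spectrum_def)
    then show ?thesis
      using fraction_eq_iff[OF r(1) one_denom r(2) one_denom] eq[of P] r by auto
  qed
  ultimately have "\<exists>n::nat. f [^] n \<in> ?I" by (rule power_mem_idealI[OF _ f])
  then obtain n :: nat where "f [^] n \<in> ?I" ..
  then show ?thesis by blast
qed

lemma spec_sections_value:
  assumes "s \<in> spec_sections R V" "q \<in> V" shows "s q \<in> carrier (localize_at R q)"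
  using assms unfolding spec_sections_def by auto

lemma spec_sections_local:
  assumes "s \<in> spec_sections R V" "p \<in> V"
  obtains a b where "a \<in> carrier R" "b \<in> carrier R" "p \<in> basic b" "basic b \<subseteq> V"
    "\<And>q. q \<in> basic b \<Longrightarrow> s q = fraction R q a b"
proof -
  have "\<forall>p\<in>V. \<exists>a \<in> carrier R. \<exists>b \<in> carrier R. p \<in> basic b \<and> basic b \<subseteq> V \<and> (\<forall>q \<in> basic b. s q = fraction R q a b)"
    using assms(1) unfolding spec_sections_def basic_def by blast
  from this[rule_format, OF assms(2)] obtain a b where
    "a \<in> carrier R" "b \<in> carrier R" "p \<in> basic b" "basic b \<subseteq> V" "\<forall>q \<in> basic b. s q = fraction R q a b"
    by (elim bexE conjE)
  then show thesis by (intro that[of a b]) auto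
qed

lemma spec_sectionsI:
  assumes "s \<in> extensional V" "\<And>q. q \<in> V \<Longrightarrow> s q \<in> carrier (localize_at R q)"
    and "\<And>p. p \<in> V \<Longrightarrow> \<exists>a \<in> carrier R. \<exists>b \<in> carrier R. p \<in> basic b \<and> basic b \<subseteq> V \<and>
      (\<forall>q \<in> basic b. s q = fraction R q a b)"
  shows "s \<in> spec_sections R V"
  using assms unfolding spec_sections_def basic_def by (simp add: PiE_def Pi_def)

text \<open>Quasi-compactness of \<open>basic f\<close> enters through \<open>power_mem_idealI\<close>: the ideal \<open>?J\<close> below
  consists of those \<open>r\<close> for which a single exponent works on \<open>basic f \<inter> basic r\<close>.\<close>

lemma spec_torsion:
  assumes f: "f \<in> carrier R" and s: "s \<in> spec_sections R (basic f)"
    and a: "a \<in> carrier R" and b: "b \<in> carrier R"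
    and eq: "\<And>q. q \<in> basic f \<Longrightarrow> q \<in> basic b \<Longrightarrow> \<iota> q b \<otimes>\<^bsub>localize_at R q\<^esub> s q = \<iota> q a"
  shows "\<exists>N::nat. \<forall>q\<in>basic f. \<iota> q (b [^] N \<otimes> b) \<otimes>\<^bsub>localize_at R q\<^esub> s q = \<iota> q (b [^] N \<otimes> a)"
proof -
  \<comment> \<open>The equation b s = a is given only where \<open>b\<close> does not vanish.
    \<open>P N q\<close> is this equation at q after multiplication by b^N, and the aim is one
    \<open>N\<close> for all of D(f).\<close>
  define P where "P N q \<longleftrightarrow> \<iota> q (b [^] N \<otimes> b) \<otimes>\<^bsub>localize_at R q\<^esub> s q = \<iota> q (b [^] N \<otimes> a)"
    for N :: nat and q
  \<comment> \<open>Larger exponents remain valid, so exponents belonging to two elements of the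
    ideal can be replaced by their sum.\<close>
  have mono: "P (M + N) q" if q: "q \<in> basic f" and PN: "P N q" for M N q
  proof -
    interpret q: prime_localization R q by (rule prime_loc[OF basicD(1)[OF q]])
    interpret L: cring "localize_at R q" by (rule q.localize_cring)
    note h = ring_hom_mult[OF q.fraction_one_hom] ring_hom_closed[OF q.fraction_one_hom]
    have sq: "s q \<in> carrier (localize_at R q)" by (rule spec_sections_value[OF s q])
    have 1: "b [^] (M + N) \<otimes> c = b [^] M \<otimes> (b [^] N \<otimes> c)" if "c \<in> carrier R" for c
      using b that by (simp add: nat_pow_mult[symmetric] m_assoc)
    have "\<iota> q (b [^] (M + N) \<otimes> b) \<otimes>\<^bsub>localize_at R q\<^esub> s q
        = \<iota> q (b [^] M) \<otimes>\<^bsub>localize_at R q\<^esub> (\<iota> q (b [^] N \<otimes> b) \<otimes>\<^bsub>localize_at R q\<^esub> s q)"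
      unfolding 1[OF b] using b sq h(1)[of "b [^] M" "b [^] N \<otimes> b"] h(2)[of "b [^] M"] h(2)[of "b [^] N \<otimes> b"]
      by (simp add: L.m_assoc)
    also have "\<dots> = \<iota> q (b [^] (M + N) \<otimes> a)"
      unfolding 1[OF a] using PN b a h(1)[of "b [^] M" "b [^] N \<otimes> a"] by (simp add: P_def)
    finally show ?thesis by (simp add: P_def)
  qed
  let ?J = "{r \<in> carrier R. \<exists>N. \<forall>q\<in>basic f. r \<notin> q \<longrightarrow> P N q}"
  have "ideal ?J R"
  proof (rule idealI_cring)
    have "\<zero> \<in> q" if "q \<in> basic f" for q
      using basicD(1)[OF that] by (simp add: primeideal_def ideal_def additive_subgroup.zero_closed)
    then show "\<zero> \<in> ?J" by auto
    fix r r' assume "r \<in> ?J" "r' \<in> ?J"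
    then obtain N N' where r: "r \<in> carrier R" "r' \<in> carrier R" and
      N: "\<And>q. q \<in> basic f \<Longrightarrow> r \<notin> q \<Longrightarrow> P N q" "\<And>q. q \<in> basic f \<Longrightarrow> r' \<notin> q \<Longrightarrow> P N' q" by blast
    have "P (N + N') q" if q: "q \<in> basic f" "r \<oplus> r' \<notin> q" for q
    proof -
      have "r \<notin> q \<or> r' \<notin> q"
        using basicD(1)[OF q(1)] q(2) by (auto simp: primeideal_def ideal_def additive_subgroup.a_closed)
      then show ?thesis using N mono[OF q(1), of N' N] mono[OF q(1), of N N'] q(1) by (auto simp: add.commute)
    qed
    then show "r \<oplus> r' \<in> ?J" using r by blast
  next
    fix r c assume "r \<in> ?J" "c \<in> carrier R"
    then show "c \<otimes> r \<in> ?J" using prime_mult_iff[OF basicD(1)] by auto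
  qed blast
  moreover have "\<exists>b'\<in>?J. b' \<notin> Q" if Q: "primeideal Q R" "f \<notin> Q" for Q
  proof -
    have "Q \<in> basic f" using Q by (simp add: basic_def prime_spectrum_def)
    then obtain a' b' where b': "a' \<in> carrier R" "b' \<in> carrier R" "Q \<in> basic b'" "basic b' \<subseteq> basic f"
      and val: "\<And>q. q \<in> basic b' \<Longrightarrow> s q = fraction R q a' b'"
      using spec_sections_local[OF s] by metis
    \<comment> \<open>Near Q the section is a' / b'. On D(b b') the given equation says that b a'
      and b' a have the same image, and \<open>spec_zero\<close> makes this an identity in
      \<open>R\<close> up to a power.\<close>
    have "\<exists>m::nat. (b \<otimes> b') [^] m \<otimes> (b \<otimes> a') = (b \<otimes> b') [^] m \<otimes> (b' \<otimes> a)"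
    proof (rule spec_zero)
      fix q assume "q \<in> basic (b \<otimes> b')"
      then have q: "q \<in> basic b" "q \<in> basic b'" using b b' by (auto simp: basic_mult)
      interpret q: prime_localization R q by (rule prime_loc[OF basicD(1)[OF q(1)]])
      have d: "b' \<in> carrier R - q" using q(2) b' basicD by blast
      have "fraction R q (b \<otimes> a') b' = \<iota> q a"
        using eq[of q] q b' b d q.one_denom val[OF q(2)] q.fraction_mult[of b \<one> a' b'] by auto
      then obtain u where u: "u \<in> carrier R - q" "u \<otimes> (b \<otimes> a' \<otimes> \<one>) = u \<otimes> (a \<otimes> b')"
        using q.fraction_eq_iff[of "b \<otimes> a'" b' a \<one>] b b' a d q.one_denom by auto
      then show "\<iota> q (b \<otimes> a') = \<iota> q (b' \<otimes> a)"
        using a b b' q.one_denom by (intro q.fraction_eqI[of _ _ _ _ u]) (auto simp: m_comm)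
    qed (use a b b' in auto)
    then obtain m :: nat where m: "(b \<otimes> b') [^] m \<otimes> (b \<otimes> a') = (b \<otimes> b') [^] m \<otimes> (b' \<otimes> a)" by blast
    have "P m q" if q: "q \<in> basic f" "b' \<notin> q" for q
    proof -
      interpret q: prime_localization R q by (rule prime_loc[OF basicD(1)[OF q(1)]])
      have qb: "q \<in> basic b'" using q by (auto simp: basic_def)
      have d: "b' \<in> carrier R - q" using q(2) b' by blast
      have bm: "b [^] m \<in> carrier R" "b' [^] m \<in> carrier R" using b b' by auto
      \<comment> \<open>The power of \<open>b'\<close> is invertible on D(b') and serves as the
        witness, so only the power of \<open>b\<close> remains in the equation of fractions.\<close>
      have "b' [^] m \<otimes> ((b [^] m \<otimes> b \<otimes> a') \<otimes> \<one>) = (b \<otimes> b') [^] m \<otimes> (b \<otimes> a')"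
        using b b' bm by (simp add: pow_mult_distrib m_comm m_lcomm m_assoc)
      also have "\<dots> = b' [^] m \<otimes> ((b [^] m \<otimes> a) \<otimes> b')"
        unfolding m using a b b' bm by (simp add: pow_mult_distrib m_comm m_lcomm m_assoc)
      finally have "fraction R q (b [^] m \<otimes> b \<otimes> a') b' = \<iota> q (b [^] m \<otimes> a)"
        using a b b' bm d q.one_denom q.pow_denom[OF d]
        by (intro q.fraction_eqI[of _ _ _ _ "b' [^] m"]) auto
      then show ?thesis
        using b b' bm d q.one_denom q.fraction_mult[of "b [^] m \<otimes> b" \<one> a' b']
        by (simp add: P_def val[OF qb])
    qed
    then have "b' \<in> ?J" using b' by blast
    then show ?thesis using basicD(2)[OF b'(3)] by blast
  qed
  ultimately have "\<exists>n::nat. f [^] n \<in> ?J" by (rule power_mem_idealI[OF _ f])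
  then obtain n :: nat where "f [^] n \<in> ?J" ..
  then obtain N where N: "\<And>q. q \<in> basic f \<Longrightarrow> f [^] n \<notin> q \<Longrightarrow> P N q" by blast
  have "P N q" if q: "q \<in> basic f" for q
  proof -
    interpret q: prime_localization R q by (rule prime_loc[OF basicD(1)[OF q]])
    have "f [^] n \<notin> q" using q.pow_denom[of f n] f basicD(2)[OF q] by blast
    then show ?thesis by (rule N[OF q])
  qed
  then show ?thesis unfolding P_def by blast
qed

text \<open>The \<open>r\<close> for which r s comes from \<open>R\<close> on all of D(f) form an
  ideal. Near a prime Q, where s = a / b on D(b), the equation b s = a is extended from D(b) to D(f)
  by \<open>spec_torsion\<close>, at the cost of a power of \<open>b\<close>; this power is still
  outside Q.\<close>

lemma spec_sections_basic:
  assumes f: "f \<in> carrier R" and s: "s \<in> spec_sections R (basic f)"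
  shows "\<exists>n::nat. \<exists>a\<in>carrier R. \<forall>q\<in>basic f. \<iota> q (f [^] n) \<otimes>\<^bsub>localize_at R q\<^esub> s q = \<iota> q a"
proof -
  let ?I = "{r \<in> carrier R. \<exists>a\<in>carrier R. \<forall>q\<in>basic f. \<iota> q r \<otimes>\<^bsub>localize_at R q\<^esub> s q = \<iota> q a}"
  have "ideal ?I R"
  proof (rule idealI_cring)
    have "\<iota> q \<zero> \<otimes>\<^bsub>localize_at R q\<^esub> s q = \<iota> q \<zero>" if q: "q \<in> basic f" for q
    proof -
      interpret q: prime_localization R q by (rule prime_loc[OF basicD(1)[OF q]])
      interpret L: cring "localize_at R q" by (rule q.localize_cring)
      show ?thesis
        using spec_sections_value[OF s q] by (simp add: q.localize_zero[symmetric])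
    qed
    then show "\<zero> \<in> ?I" by blast
    fix r r' assume I: "r \<in> ?I" "r' \<in> ?I"
    from I(1) obtain a where r1: "r \<in> carrier R" "a \<in> carrier R"
      and e1: "\<And>q. q \<in> basic f \<Longrightarrow> \<iota> q r \<otimes>\<^bsub>localize_at R q\<^esub> s q = \<iota> q a" by blast
    from I(2) obtain a' where r2: "r' \<in> carrier R" "a' \<in> carrier R"
      and e2: "\<And>q. q \<in> basic f \<Longrightarrow> \<iota> q r' \<otimes>\<^bsub>localize_at R q\<^esub> s q = \<iota> q a'" by blast
    note r = r1 r2 and e = e1 e2
    have "\<iota> q (r \<oplus> r') \<otimes>\<^bsub>localize_at R q\<^esub> s q = \<iota> q (a \<oplus> a')" if q: "q \<in> basic f" for q
    proof -
      interpret q: prime_localization R q by (rule prime_loc[OF basicD(1)[OF q]])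
      interpret L: cring "localize_at R q" by (rule q.localize_cring)
      note h = ring_hom_add[OF q.fraction_one_hom] ring_hom_closed[OF q.fraction_one_hom]
      show ?thesis
        using spec_sections_value[OF s q] r e[OF q] h(2)[of r] h(2)[of r']
        by (simp add: h(1) L.l_distr)
    qed
    then show "r \<oplus> r' \<in> ?I" using r by blast
  next
    fix r c assume "r \<in> ?I" and c: "c \<in> carrier R"
    then obtain a where r: "r \<in> carrier R" "a \<in> carrier R"
      and e: "\<And>q. q \<in> basic f \<Longrightarrow> \<iota> q r \<otimes>\<^bsub>localize_at R q\<^esub> s q = \<iota> q a" by blast
    have "\<iota> q (c \<otimes> r) \<otimes>\<^bsub>localize_at R q\<^esub> s q = \<iota> q (c \<otimes> a)" if q: "q \<in> basic f" for q
    proof -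
      interpret q: prime_localization R q by (rule prime_loc[OF basicD(1)[OF q]])
      interpret L: cring "localize_at R q" by (rule q.localize_cring)
      note h = ring_hom_mult[OF q.fraction_one_hom] ring_hom_closed[OF q.fraction_one_hom]
      show ?thesis
        using spec_sections_value[OF s q] r c e[OF q] h(2)[of r] h(2)[of c]
        by (simp add: h(1) L.m_assoc)
    qed
    then show "c \<otimes> r \<in> ?I" using r c by blast
  qed blast
  moreover have "\<exists>b\<in>?I. b \<notin> Q" if Q: "primeideal Q R" "f \<notin> Q" for Q
  proof -
    have "Q \<in> basic f" using Q by (simp add: basic_def prime_spectrum_def)
    then obtain a b where b: "a \<in> carrier R" "b \<in> carrier R" "Q \<in> basic b" "basic b \<subseteq> basic f"
      and val: "\<And>q. q \<in> basic b \<Longrightarrow> s q = fraction R q a b"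
      using spec_sections_local[OF s] by metis
    have "\<iota> q b \<otimes>\<^bsub>localize_at R q\<^esub> s q = \<iota> q a" if q: "q \<in> basic b" for q
    proof -
      interpret q: prime_localization R q by (rule prime_loc[OF basicD(1)[OF q]])
      show ?thesis unfolding val[OF q] using b basicD(2)[OF q] by (intro q.fraction_mult_denom) auto
    qed
    then obtain N :: nat where
      N: "\<forall>q\<in>basic f. \<iota> q (b [^] N \<otimes> b) \<otimes>\<^bsub>localize_at R q\<^esub> s q = \<iota> q (b [^] N \<otimes> a)"
      using spec_torsion[OF f s b(1,2)] by blast
    interpret Q: prime_localization R Q by (rule prime_loc[OF Q(1)])
    have "b [^] N \<otimes> b \<in> ?I" using N b by blast
    moreover have "b [^] N \<otimes> b \<notin> Q"
      using Q.mult_denom[OF Q.pow_denom[of b N], of b] b basicD(2)[OF b(3)] by blast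
    ultimately show ?thesis by blast
  qed
  ultimately have "\<exists>n::nat. f [^] n \<in> ?I" by (rule power_mem_idealI[OF _ f])
  then obtain n :: nat where "f [^] n \<in> ?I" ..
  then show ?thesis by blast
qed

section \<open>Sections of the spectrum that come from ring elements\<close>

definition const :: "'r \<Rightarrow> 'r set set \<Rightarrow> 'r set \<Rightarrow> ('r \<times> 'r) set" where
  "const r V = (\<lambda>q\<in>V. \<iota> q r)"

lemma open_Spec_prime: "open_in (Spec R) V \<Longrightarrow> q \<in> V \<Longrightarrow> primeideal q R"
  using openin_subset[of "top_sp (Spec R)" V] points_Spec spec_primeD by blast

text \<open>In \<open>spec_sections\<close> the neighbourhood is cut out by the denominator itself.
  The fraction is therefore expanded by some \<open>b\<close> with D(b) inside \<open>V\<close>,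
  which shrinks D(d) to D(d b).\<close>

lemma spec_fraction_section:
  assumes V: "open_in (Spec R) V" and a: "a \<in> carrier R" and d: "d \<in> carrier R"
    and Vd: "V \<subseteq> basic d"
  shows "(\<lambda>q\<in>V. fraction R q a d) \<in> spec_sections R V"
proof (rule spec_sectionsI)
  have loc: "prime_localization R q" and dq: "d \<in> carrier R - q" if "q \<in> V" for q
    using that Vd basicD d prime_loc by blast+
  show "(\<lambda>q\<in>V. fraction R q a d) q \<in> carrier (localize_at R q)" if q: "q \<in> V" for q
    using prime_localization.fraction_closed[OF loc[OF q] a dq[OF q]] q by simp
  fix p assume p: "p \<in> V"
  obtain b where b: "b \<in> carrier R" "p \<in> basic b" "basic b \<subseteq> V" using basic_basis[OF V p] by blast
  have "fraction R q a d = fraction R q (a \<otimes> b) (d \<otimes> b)" if q: "q \<in> basic (d \<otimes> b)" for q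
  proof -
    have qb: "q \<in> basic b" using q basic_mult[OF d b(1)] by blast
    then have qV: "q \<in> V" using b by blast
    interpret q: prime_localization R q by (rule loc[OF qV])
    have bq: "b \<in> carrier R - q" using basicD(2)[OF qb] b by blast
    show ?thesis
      using a d b dq[OF qV] bq q.mult_denom[OF dq[OF qV] bq]
      by (intro q.fraction_eqI') (auto simp: m_comm m_lcomm m_assoc)
  qed
  moreover have "p \<in> basic (d \<otimes> b)" "basic (d \<otimes> b) \<subseteq> V" using b d p Vd basic_mult[OF d b(1)] by blast+
  ultimately show "\<exists>a'\<in>carrier R. \<exists>b\<in>carrier R. p \<in> basic b \<and> basic b \<subseteq> V \<and>
      (\<forall>q\<in>basic b. (\<lambda>q\<in>V. fraction R q a d) q = fraction R q a' b)"
    using a b d by (intro bexI[of _ "a \<otimes> b"] bexI[of _ "d \<otimes> b"]) auto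
qed simp

lemma const_section: "open_in (Spec R) V \<Longrightarrow> r \<in> carrier R \<Longrightarrow> const r V \<in> spec_sections R V"
  unfolding const_def using openin_subset[of "top_sp (Spec R)" V]
  by (intro spec_fraction_section) (auto simp: basic_one points_Spec)

lemma sec_Spec: "sec (Spec R) V = function_ring V (localize_at R) (spec_sections R V)"
  by (simp add: Spec_def)

lemma const_hom:
  assumes V: "open_in (Spec R) V"
  shows "(\<lambda>r. const r V) \<in> ring_hom R (sec (Spec R) V)"
proof (rule ring_hom_memI)
  have h: "\<iota> q \<in> ring_hom R (localize_at R q)" if "q \<in> V" for q
    using prime_localization.fraction_one_hom[OF prime_loc[OF open_Spec_prime[OF V that]]] .
  show "const r V \<in> carrier (sec (Spec R) V)" if "r \<in> carrier R" for r
    using const_section[OF V that] by (simp add: sec_Spec function_ring_def)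
  show "const (r \<otimes> r') V = const r V \<otimes>\<^bsub>sec (Spec R) V\<^esub> const r' V"
    "const (r \<oplus> r') V = const r V \<oplus>\<^bsub>sec (Spec R) V\<^esub> const r' V"
    if "r \<in> carrier R" "r' \<in> carrier R" for r r'
    using that ring_hom_mult[OF h] ring_hom_add[OF h]
    by (auto simp: sec_Spec function_ring_def const_def intro!: restrict_ext)
  show "const \<one> V = \<one>\<^bsub>sec (Spec R) V\<^esub>"
    using ring_hom_one[OF h] by (auto simp: sec_Spec function_ring_def const_def intro!: restrict_ext)
qed

lemma res_const: "W \<subseteq> V \<Longrightarrow> res (Spec R) V W (const r V) = const r W"
  by (auto simp: Spec_def const_def Int_absorb1)

text \<open>If \<open>r\<close> is invertible as a section near p, the value a / b of its inverse at
  p gives u a r = u b outside p, so r is outside p. Conversely 1 / r is a section on the part of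
  \<open>V\<close> where \<open>r\<close> does not vanish. That the spectrum is locally ringed is a
  hypothesis here; in a chart it is part of the isomorphism.\<close>

lemma nonvanishing_const:
  assumes lrs: "locally_ringed_space (Spec R)" and V: "open_in (Spec R) V" and r: "r \<in> carrier R"
  shows "nonvanishing (Spec R) V (const r V) = V \<inter> basic r"
proof -
  interpret S: lrs "Spec R" by unfold_locales fact
  have c: "const r V \<in> carrier (sec (Spec R) V)" by (rule ring_hom_closed[OF const_hom[OF V] r])
  show ?thesis
  proof (intro equalityI subsetI)
    fix p assume "p \<in> nonvanishing (Spec R) V (const r V)"
    then obtain W where W: "open_in (Spec R) W" "p \<in> W" "W \<subseteq> V" "res (Spec R) V W (const r V) \<in> Units (sec (Spec R) W)"
      using S.nonvanishing_iff[OF V c] by blast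
    then have u: "const r W \<in> Units (sec (Spec R) W)" by (simp add: res_const)
    then obtain t where t: "t \<in> carrier (sec (Spec R) W)" "t \<otimes>\<^bsub>sec (Spec R) W\<^esub> const r W = \<one>\<^bsub>sec (Spec R) W\<^esub>"
      unfolding Units_def by blast
    have p: "primeideal p R" by (rule open_Spec_prime[OF W(1,2)])
    interpret p: prime_localization R p by (rule prime_loc[OF p])
    have tp: "t p \<in> carrier (localize_at R p)"
      using t(1) spec_sections_value[OF _ W(2)] by (simp add: sec_Spec function_ring_def)
    then obtain a b where ab: "a \<in> carrier R" "b \<in> carrier R - p" "t p = fraction R p a b"
      by (rule p.fraction_cases)
    have "t p \<otimes>\<^bsub>localize_at R p\<^esub> \<iota> p r = \<iota> p \<one>"
      using fun_cong[OF t(2), of p] W(2) by (simp add: sec_Spec function_ring_def const_def p.localize_one)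
    then have "fraction R p (a \<otimes> r) b = \<iota> p \<one>"
      using ab r p.one_denom by (simp add: p.fraction_mult)
    then obtain u where u: "u \<in> carrier R - p" "u \<otimes> (a \<otimes> r \<otimes> \<one>) = u \<otimes> (\<one> \<otimes> b)"
      using p.fraction_eq_iff[of "a \<otimes> r" b \<one> \<one>] ab r p.one_denom by auto
    have "r \<notin> p"
    proof
      assume rp: "r \<in> p"
      then have "u \<otimes> b \<in> p"
        using u ab r prime_mult_iff[OF p] by (metis DiffD1 l_one m_closed one_closed)
      then show False using p.mult_denom[OF u(1) ab(2)] by blast
    qed
    then show "p \<in> V \<inter> basic r" using W p by (auto simp: basic_def prime_spectrum_def)
  next
    fix p assume p: "p \<in> V \<inter> basic r"
    let ?W = "V \<inter> basic r"
    have W: "open_in (Spec R) ?W" using V basic_open[OF r] by blast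
    interpret W: cring "sec (Spec R) ?W" by (rule S.sec_cring[OF W])
    have t: "(\<lambda>q\<in>?W. fraction R q \<one> r) \<in> spec_sections R ?W"
      using W r by (intro spec_fraction_section) auto
    have "(\<lambda>q\<in>?W. fraction R q \<one> r) \<otimes>\<^bsub>sec (Spec R) ?W\<^esub> const r ?W = \<one>\<^bsub>sec (Spec R) ?W\<^esub>"
    proof -
      have "fraction R q \<one> r \<otimes>\<^bsub>localize_at R q\<^esub> \<iota> q r = \<one>\<^bsub>localize_at R q\<^esub>" if q: "q \<in> ?W" for q
      proof -
        interpret q: prime_localization R q by (rule prime_loc[OF open_Spec_prime[OF W q]])
        show ?thesis using q r basicD by (intro q.fraction_denom_unit) blast
      qed
      then show ?thesis by (auto simp: sec_Spec function_ring_def const_def intro!: restrict_ext)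
    qed
    then have "const r ?W \<in> Units (sec (Spec R) ?W)"
      using t const_section[OF W r] W.m_comm[of "const r ?W" "\<lambda>q\<in>?W. fraction R q \<one> r"]
      by (intro W.UnitsI_right_inverse[of _ "\<lambda>q\<in>?W. fraction R q \<one> r"]) (auto simp: sec_Spec function_ring_def)
    then show "p \<in> nonvanishing (Spec R) V (const r V)"
      using S.nonvanishing_iff[OF V c] W p by (intro iffD2[OF S.nonvanishing_iff[OF V c]] exI[of _ ?W]) (auto simp: res_const)
  qed
qed

end

section \<open>Affine opens\<close>

locale affine_chart = lrs X for X :: "('a, 'b) rspace" +
  fixes U :: "'a set" and R :: "'r ring" and \<phi> \<psi>
  assumes U: "open_in X U" and R: "cring R"
    and \<phi>: "lrs_morphism (open_subspace X U) (Spec R) \<phi>"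
    and \<psi>: "lrs_morphism (Spec R) (open_subspace X U) \<psi>"
    and inverse: "inverse_rs_maps (open_subspace X U) (Spec R) \<phi> \<psi>"

sublocale affine_chart \<subseteq> spec: ring_spec R
  by (intro ring_spec.intro R)

sublocale affine_chart \<subseteq> \<phi>: lrs_mor "open_subspace X U" "Spec R" \<phi>
  by unfold_locales (rule \<phi>)

sublocale affine_chart \<subseteq> \<psi>: lrs_mor "Spec R" "open_subspace X U" \<psi>
  by unfold_locales (rule \<psi>)

context affine_chart
begin

abbreviation "Us \<equiv> open_subspace X U"
abbreviation "Sp \<equiv> Spec R"

lemma sub_simps [simp]: "sec Us = sec X" "res Us = res X"
  by (simp_all add: open_subspace_def)

lemma points_sub [simp]: "points Us = U"
  using openin_subset[OF U] by (auto simp: open_subspace_def)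

lemma open_sub: "open_in Us W \<longleftrightarrow> open_in X W \<and> W \<subseteq> U"
  using openin_open_subtopology[OF U] by (simp add: open_subspace_def)

text \<open>Germs in the open subspace are smaller equivalence classes than germs in
  \<open>X\<close>, so the stalks are different sets. The criterion by units on a neighbourhood
  mentions only sections, and these are shared.\<close>

lemma nonvanishing_sub:
  assumes W: "open_in X W" "W \<subseteq> U" and s: "s \<in> carrier (sec X W)"
  shows "nonvanishing Us W s = nonvanishing X W s"
proof -
  have W': "open_in Us W" and s': "s \<in> carrier (sec Us W)" using W s by (simp_all add: open_sub)
  show ?thesis
    unfolding set_eq_iff nonvanishing_iff[OF W(1) s] \<phi>.src.nonvanishing_iff[OF W' s']
    using W(2) by (auto simp: open_sub)
qed

lemma \<psi>_\<phi>: "x \<in> U \<Longrightarrow> pt \<psi> (pt \<phi> x) = x"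
  using inverse by (simp add: inverse_rs_maps_def rs_eq_def rs_comp_def rs_id_def)

lemma \<phi>_\<psi>: "p \<in> points Sp \<Longrightarrow> pt \<phi> (pt \<psi> p) = p"
  using inverse by (simp add: inverse_rs_maps_def rs_eq_def rs_comp_def rs_id_def)

lemma preim_\<psi>_\<phi>: "V \<subseteq> points Sp \<Longrightarrow> preim Sp \<psi> (preim Us \<phi> V) = V"
  using \<phi>_\<psi> \<psi>.pt_closed by auto

lemma preim_\<phi>_\<psi>: "W \<subseteq> U \<Longrightarrow> preim Us \<phi> (preim Sp \<psi> W) = W"
  using \<psi>_\<phi> \<phi>.pt_closed by auto

lemma shm_\<phi>_\<psi>:
  "open_in X W \<Longrightarrow> W \<subseteq> U \<Longrightarrow> s \<in> carrier (sec X W) \<Longrightarrow> shm \<phi> (preim Sp \<psi> W) (shm \<psi> W s) = s"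
  using inverse by (simp add: inverse_rs_maps_def rs_eq_def rs_comp_def rs_id_def open_sub)

lemma shm_\<psi>_\<phi>:
  "open_in Sp V \<Longrightarrow> s \<in> carrier (sec Sp V) \<Longrightarrow> shm \<psi> (preim Us \<phi> V) (shm \<phi> V s) = s"
  using inverse by (simp add: inverse_rs_maps_def rs_eq_def rs_comp_def rs_id_def)

text \<open>The canonical map from \<open>R\<close> to the sections over \<open>U\<close>. Its
  surjectivity, shown below, lets facts about \<open>R\<close> be read as facts about sections of
  \<open>X\<close>.\<close>

definition \<rho> where "\<rho> r = shm \<phi> (points Sp) (spec.const r (points Sp))"

lemma preim_points: "preim Us \<phi> (points Sp) = U"
  using \<phi>.pt_closed by auto

lemma const_closed: "open_in Sp V \<Longrightarrow> r \<in> carrier R \<Longrightarrow> spec.const r V \<in> carrier (sec Sp V)"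
  by (rule ring_hom_closed[OF spec.const_hom])

lemma \<rho>_hom: "\<rho> \<in> ring_hom R (sec X U)"
proof -
  have "shm \<phi> (points Sp) \<circ> (\<lambda>r. spec.const r (points Sp)) \<in> ring_hom R (sec X U)"
    using \<phi>.shm_hom[of "points Sp"] unfolding preim_points
    by (intro ring_hom_trans[OF spec.const_hom]) simp_all
  then show ?thesis by (simp add: \<rho>_def[abs_def] comp_def)
qed

lemma \<rho>_closed: "r \<in> carrier R \<Longrightarrow> \<rho> r \<in> carrier (sec X U)"
  by (rule ring_hom_closed[OF \<rho>_hom])

lemma \<rho>_ring_hom_cring: "ring_hom_cring R (sec X U) \<rho>"
  using \<rho>_hom sec_cring[OF U] R
  by (intro ring_hom_cringI ring_hom_ringI2) (auto intro: cring.axioms)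

lemma res_\<rho>:
  assumes V: "open_in Sp V" and r: "r \<in> carrier R"
  shows "res X U (preim Us \<phi> V) (\<rho> r) = shm \<phi> V (spec.const r V)"
proof -
  have "V \<subseteq> points Sp" by (rule openin_subset[OF V])
  then show ?thesis
    using \<phi>.shm_res[of "points Sp" V, OF _ V _ const_closed[OF _ r]]
    unfolding preim_points by (simp add: \<rho>_def spec.res_const)
qed

lemma nonvanishing_\<rho>:
  assumes r: "r \<in> carrier R"
  shows "nonvanishing X U (\<rho> r) = preim Us \<phi> (spec.basic r)"
proof -
  have "points Sp \<inter> spec.basic r = spec.basic r" by (auto simp: spec.points_Spec spec.basic_def)
  then have "nonvanishing Sp (points Sp) (spec.const r (points Sp)) = spec.basic r"
    using spec.nonvanishing_const[OF \<phi>.tgt.lrs _ r, of "points Sp"] by simp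
  then have "preim Us \<phi> (spec.basic r) = nonvanishing Us U (\<rho> r)"
    using \<phi>.preim_nonvanishing[of "points Sp" "spec.const r (points Sp)"] const_closed[OF _ r, of "points Sp"]
    unfolding preim_points \<rho>_def by simp
  then show ?thesis using nonvanishing_sub[OF U _ \<rho>_closed[OF r]] by simp
qed

text \<open>Carries \<open>spec_sections_basic\<close> through the chart: the section is moved to
  the spectrum by \<psi>, and the resulting equation is moved back by \<phi>.\<close>

lemma extend_section_\<rho>:
  assumes r: "r \<in> carrier R" and a: "a \<in> carrier (sec X (nonvanishing X U (\<rho> r)))"
  shows "\<exists>n::nat. \<exists>e\<in>carrier R. res X U (nonvanishing X U (\<rho> r)) (\<rho> e)
    = res X U (nonvanishing X U (\<rho> r)) (\<rho> r [^]\<^bsub>sec X U\<^esub> n) \<otimes>\<^bsub>sec X (nonvanishing X U (\<rho> r))\<^esub> a"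
proof -
  let ?B = "spec.basic r" and ?W = "nonvanishing X U (\<rho> r)"
  have B: "open_in Sp ?B" by (rule spec.basic_open[OF r])
  have W: "open_in X ?W" "?W \<subseteq> U"
    using nonvanishing_open[OF U \<rho>_closed[OF r]] nonvanishing_subset by auto
  have pB: "preim Us \<phi> ?B = ?W" by (rule nonvanishing_\<rho>[OF r, symmetric])
  have pW: "preim Sp \<psi> ?W = ?B"
    unfolding pB[symmetric] by (rule preim_\<psi>_\<phi>[OF openin_subset[OF B]])
  have a': "shm \<psi> ?W a \<in> carrier (sec Sp ?B)"
    using \<psi>.shm_closed[of ?W a] a W unfolding pW by (simp add: open_sub)
  then have "shm \<psi> ?W a \<in> spec_sections R ?B" by (simp add: spec.sec_Spec function_ring_def)
  then obtain n :: nat and e where e: "e \<in> carrier R"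
    "\<forall>q\<in>?B. fraction R q (r [^]\<^bsub>R\<^esub> n) \<one>\<^bsub>R\<^esub> \<otimes>\<^bsub>localize_at R q\<^esub> shm \<psi> ?W a q = fraction R q e \<one>\<^bsub>R\<^esub>"
    using spec.spec_sections_basic[OF r] by metis
  have rn: "r [^]\<^bsub>R\<^esub> n \<in> carrier R" using r by simp
  have eq: "spec.const (r [^]\<^bsub>R\<^esub> n) ?B \<otimes>\<^bsub>sec Sp ?B\<^esub> shm \<psi> ?W a = spec.const e ?B"
    using e(2) by (auto simp: spec.sec_Spec function_ring_def spec.const_def intro!: restrict_ext)
  have "res X U ?W (\<rho> (r [^]\<^bsub>R\<^esub> n)) \<otimes>\<^bsub>sec X ?W\<^esub> shm \<phi> ?B (shm \<psi> ?W a) = res X U ?W (\<rho> e)"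
    using res_\<rho>[OF B rn] res_\<rho>[OF B e(1)] ring_hom_mult[OF \<phi>.shm_hom[OF B] const_closed[OF B rn] a'] eq
    unfolding pB by simp
  moreover have "shm \<phi> ?B (shm \<psi> ?W a) = a"
    using shm_\<phi>_\<psi>[OF W a] unfolding pW .
  moreover have "\<rho> (r [^]\<^bsub>R\<^esub> n) = \<rho> r [^]\<^bsub>sec X U\<^esub> n"
  proof -
    interpret h: ring_hom_cring R "sec X U" \<rho> by (rule \<rho>_ring_hom_cring)
    show ?thesis using r by (rule h.ring.hom_nat_pow)
  qed
  ultimately show ?thesis using e(1) by metis
qed

text \<open>The extension property for the element 1: here D(1) is all of \<open>U\<close> and the
  powers of 1 disappear.\<close>

lemma \<rho>_surj:
  assumes a: "a \<in> carrier (sec X U)"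
  obtains r where "r \<in> carrier R" "a = \<rho> r"
proof -
  interpret h: ring_hom_cring R "sec X U" \<rho> by (rule \<rho>_ring_hom_cring)
  have W: "nonvanishing X U (\<rho> \<one>\<^bsub>R\<^esub>) = U" using nonvanishing_one[OF U] by simp
  obtain n :: nat and e where "e \<in> carrier R"
    "res X U U (\<rho> e) = res X U U (\<rho> \<one>\<^bsub>R\<^esub> [^]\<^bsub>sec X U\<^esub> n) \<otimes>\<^bsub>sec X U\<^esub> a"
    using extend_section_\<rho>[of "\<one>\<^bsub>R\<^esub>" a] a unfolding W by auto
  then show thesis using that[of e] a \<rho>_closed res_id[OF U] by simp
qed

lemma extend_section:
  assumes b: "b \<in> carrier (sec X U)" and a: "a \<in> carrier (sec X (nonvanishing X U b))"
  shows "\<exists>n::nat. \<exists>e\<in>carrier (sec X U). res X U (nonvanishing X U b) e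
    = res X U (nonvanishing X U b) (b [^]\<^bsub>sec X U\<^esub> n) \<otimes>\<^bsub>sec X (nonvanishing X U b)\<^esub> a"
proof -
  obtain r where r: "r \<in> carrier R" "b = \<rho> r" by (rule \<rho>_surj[OF b])
  show ?thesis using extend_section_\<rho>[OF r(1)] a \<rho>_closed unfolding r(2) by metis
qed

text \<open>Once both sections are lifted to \<open>R\<close>, this is \<open>spec_zero\<close> with
  zero as second element.\<close>

lemma section_torsion:
  assumes b: "b \<in> carrier (sec X U)" and a: "a \<in> carrier (sec X U)"
    and z: "res X U (nonvanishing X U b) a = \<zero>\<^bsub>sec X (nonvanishing X U b)\<^esub>"
  shows "\<exists>n::nat. b [^]\<^bsub>sec X U\<^esub> n \<otimes>\<^bsub>sec X U\<^esub> a = \<zero>\<^bsub>sec X U\<^esub>"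
proof -
  obtain r where r: "r \<in> carrier R" "b = \<rho> r" by (rule \<rho>_surj[OF b])
  obtain e where e: "e \<in> carrier R" "a = \<rho> e" by (rule \<rho>_surj[OF a])
  let ?B = "spec.basic r" and ?W = "nonvanishing X U (\<rho> r)"
  have B: "open_in Sp ?B" by (rule spec.basic_open[OF r(1)])
  have pB: "preim Us \<phi> ?B = ?W" by (rule nonvanishing_\<rho>[OF r(1), symmetric])
  interpret h: ring_hom_cring "sec Sp ?B" "sec X ?W" "shm \<phi> ?B"
    using \<phi>.shm_ring_hom_cring[OF B] unfolding pB by simp
  have "shm \<phi> ?B (spec.const e ?B) = shm \<phi> ?B \<zero>\<^bsub>sec Sp ?B\<^esub>"
    using z res_\<rho>[OF B e(1)] unfolding pB r(2) e(2) by simp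
  then have ce: "spec.const e ?B = \<zero>\<^bsub>sec Sp ?B\<^esub>"
    using shm_\<psi>_\<phi>[OF B const_closed[OF B e(1)]] shm_\<psi>_\<phi>[OF B h.R.zero_closed] by metis
  have "fraction R q e \<one>\<^bsub>R\<^esub> = fraction R q \<zero>\<^bsub>R\<^esub> \<one>\<^bsub>R\<^esub>" if "q \<in> ?B" for q
    using fun_cong[OF ce, of q] that
    by (simp add: spec.sec_Spec function_ring_def spec.const_def localize_at_def)
  then obtain n :: nat where n: "r [^]\<^bsub>R\<^esub> n \<otimes>\<^bsub>R\<^esub> e = r [^]\<^bsub>R\<^esub> n \<otimes>\<^bsub>R\<^esub> \<zero>\<^bsub>R\<^esub>"
    using spec.spec_zero[OF r(1) e(1) spec.zero_closed] by blast
  interpret \<rho>: ring_hom_cring R "sec X U" \<rho> by (rule \<rho>_ring_hom_cring)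
  have "\<rho> (r [^]\<^bsub>R\<^esub> n \<otimes>\<^bsub>R\<^esub> e) = \<zero>\<^bsub>sec X U\<^esub>" unfolding n using r by simp
  moreover have "\<rho> (r [^]\<^bsub>R\<^esub> n) = \<rho> r [^]\<^bsub>sec X U\<^esub> n"
    using r(1) by (rule \<rho>.ring.hom_nat_pow)
  ultimately show ?thesis using r e by auto
qed

text \<open>The prime corresponding to \<open>x\<close> consists of the \<open>r\<close> for which
  \<open>x\<close> is not in the nonvanishing set of \<open>\<rho> r\<close>.\<close>

lemma points_eqI:
  assumes x: "x \<in> U" "x' \<in> U"
    and eq: "\<And>b. b \<in> carrier (sec X U) \<Longrightarrow> x \<in> nonvanishing X U b \<longleftrightarrow> x' \<in> nonvanishing X U b"
  shows "x = x'"
proof -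
  have p: "primeideal (pt \<phi> x) R" "primeideal (pt \<phi> x') R"
    using \<phi>.pt_closed[of x] \<phi>.pt_closed[of x'] x by (simp_all add: spec.points_Spec spec.spec_primeD)
  have c: "pt \<phi> x \<subseteq> carrier R" "pt \<phi> x' \<subseteq> carrier R"
    using p by (metis additive_subgroup.a_subset ideal.axioms(1) primeideal.axioms(1))+
  have "r \<in> pt \<phi> x \<longleftrightarrow> r \<in> pt \<phi> x'" if r: "r \<in> carrier R" for r
    using eq[OF \<rho>_closed[OF r]] x p unfolding nonvanishing_\<rho>[OF r]
    by (simp add: spec.basic_def prime_spectrum_def)
  then have "pt \<phi> x = pt \<phi> x'" using c by blast
  then show ?thesis using \<psi>_\<phi> x by metis
qed

text \<open>The point is found by contracting \<open>q\<close> along \<rho> to a prime of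
  \<open>R\<close> and applying \<psi>.\<close>

lemma prime_point:
  assumes q: "primeideal q (sec X U)"
  shows "\<exists>x\<in>U. \<forall>b\<in>carrier (sec X U). b \<in> q \<longleftrightarrow> x \<notin> nonvanishing X U b"
proof -
  let ?q = "contraction R \<rho> q"
  have "primeideal ?q R" by (rule primeideal_contraction[OF R sec_cring[OF U] \<rho>_hom q])
  then have qs: "?q \<in> points Sp" by (simp add: spec.points_Spec prime_spectrum_def)
  have "pt \<psi> ?q \<in> U" using \<psi>.pt_closed[OF qs] by simp
  moreover have "b \<in> q \<longleftrightarrow> pt \<psi> ?q \<notin> nonvanishing X U b" if b: "b \<in> carrier (sec X U)" for b
  proof -
    obtain r where r: "r \<in> carrier R" "b = \<rho> r" by (rule \<rho>_surj[OF b])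
    show ?thesis
      unfolding r(2) nonvanishing_\<rho>[OF r(1)] using qs \<phi>_\<psi>[OF qs] r \<psi>.pt_closed[OF qs]
      by (simp add: spec.basic_def spec.points_Spec contraction_def)
  qed
  ultimately show ?thesis by blast
qed

lemma nonvanishing_basis:
  assumes W: "open_in X W" and x: "x \<in> W" "x \<in> U"
  shows "\<exists>b\<in>carrier (sec X U). x \<in> nonvanishing X U b \<and> nonvanishing X U b \<subseteq> W"
proof -
  have o: "open_in Us (W \<inter> U)" using W U by (auto simp: open_sub)
  have "pt \<phi> x \<in> preim Sp \<psi> (W \<inter> U)" using x \<psi>_\<phi> \<phi>.pt_closed[of x] by simp
  then obtain r where r: "r \<in> carrier R" "pt \<phi> x \<in> spec.basic r" "spec.basic r \<subseteq> preim Sp \<psi> (W \<inter> U)"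
    using spec.basic_basis[OF \<psi>.preim_open[OF o]] by blast
  have "preim Us \<phi> (spec.basic r) \<subseteq> preim Us \<phi> (preim Sp \<psi> (W \<inter> U))" by (rule preim_mono[OF r(3)])
  then have "nonvanishing X U (\<rho> r) \<subseteq> W"
    unfolding nonvanishing_\<rho>[OF r(1)] using preim_\<phi>_\<psi>[of "W \<inter> U"] by blast
  moreover have "x \<in> nonvanishing X U (\<rho> r)" unfolding nonvanishing_\<rho>[OF r(1)] using r x by simp
  ultimately show ?thesis using \<rho>_closed[OF r(1)] by blast
qed

end

text \<open>Affineness only asserts that a chart exists, so each proof below opens one. The five
  facts exported mention sections and nonvanishing sets alone, and the spectrum does not appear
  after this point.\<close>

locale affine_open_subset = lrs X for X :: "('a, 'b) rspace" +
  fixes U :: "'a set"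
  assumes affine: "affine_open X U"
begin

lemma open_U: "open_in X U"
  using affine by (simp add: affine_open_def)

lemma chart:
  obtains R :: "'b ring" and \<phi> \<psi> where "affine_chart X U R \<phi> \<psi>"
proof -
  obtain R :: "'b ring" and \<phi> where R: "cring R" and iso: "lrs_iso (open_subspace X U) (Spec R) \<phi>"
    using affine unfolding affine_open_def affine_scheme_def by blast
  obtain \<psi> where "lrs_morphism (open_subspace X U) (Spec R) \<phi>" "lrs_morphism (Spec R) (open_subspace X U) \<psi>"
    "inverse_rs_maps (open_subspace X U) (Spec R) \<phi> \<psi>"
    using iso unfolding lrs_iso_def by blast
  then show thesis
    using that[of R \<phi> \<psi>] R open_U lrs_axioms by (simp add: affine_chart_def affine_chart_axioms_def)
qed

lemma extend_section:
  assumes "b \<in> carrier (sec X U)" "a \<in> carrier (sec X (nonvanishing X U b))"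
  obtains n :: nat and e where "e \<in> carrier (sec X U)" "res X U (nonvanishing X U b) e
    = res X U (nonvanishing X U b) (b [^]\<^bsub>sec X U\<^esub> n) \<otimes>\<^bsub>sec X (nonvanishing X U b)\<^esub> a"
proof -
  obtain R :: "'b ring" and \<phi> \<psi> where "affine_chart X U R \<phi> \<psi>" by (rule chart)
  then interpret affine_chart X U R \<phi> \<psi> .
  show thesis using that extend_section[OF assms] by blast
qed

lemma section_torsion:
  assumes "b \<in> carrier (sec X U)" "a \<in> carrier (sec X U)"
    and "res X U (nonvanishing X U b) a = \<zero>\<^bsub>sec X (nonvanishing X U b)\<^esub>"
  obtains n :: nat where "b [^]\<^bsub>sec X U\<^esub> n \<otimes>\<^bsub>sec X U\<^esub> a = \<zero>\<^bsub>sec X U\<^esub>"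
proof -
  obtain R :: "'b ring" and \<phi> \<psi> where "affine_chart X U R \<phi> \<psi>" by (rule chart)
  then interpret affine_chart X U R \<phi> \<psi> .
  show thesis using that section_torsion[OF assms] by blast
qed

lemma points_eqI:
  assumes "x \<in> U" "x' \<in> U"
    and "\<And>b. b \<in> carrier (sec X U) \<Longrightarrow> x \<in> nonvanishing X U b \<longleftrightarrow> x' \<in> nonvanishing X U b"
  shows "x = x'"
proof -
  obtain R :: "'b ring" and \<phi> \<psi> where "affine_chart X U R \<phi> \<psi>" by (rule chart)
  then interpret affine_chart X U R \<phi> \<psi> .
  show ?thesis using points_eqI[OF assms] .
qed

lemma prime_point:
  assumes "primeideal q (sec X U)"
  obtains x where "x \<in> U" "\<And>b. b \<in> carrier (sec X U) \<Longrightarrow> b \<in> q \<longleftrightarrow> x \<notin> nonvanishing X U b"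
proof -
  obtain R :: "'b ring" and \<phi> \<psi> where "affine_chart X U R \<phi> \<psi>" by (rule chart)
  then interpret affine_chart X U R \<phi> \<psi> .
  show thesis using that prime_point[OF assms] by blast
qed

lemma nonvanishing_basis:
  assumes "open_in X W" "x \<in> W" "x \<in> U"
  obtains b where "b \<in> carrier (sec X U)" "x \<in> nonvanishing X U b" "nonvanishing X U b \<subseteq> W"
proof -
  obtain R :: "'b ring" and \<phi> \<psi> where "affine_chart X U R \<phi> \<psi>" by (rule chart)
  then interpret affine_chart X U R \<phi> \<psi> .
  show thesis using that nonvanishing_basis[OF assms] by blast
qed

end

section \<open>The relative spectrum of a direct image\<close>

lemma lrs_iso_cong:
  assumes f: "lrs_iso X Y f" and fg: "rs_eq X Y f g"
  shows "lrs_iso X Y g"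
proof -
  obtain h where h: "lrs_morphism Y X h" "inverse_rs_maps X Y f h" and fm: "lrs_morphism X Y f"
    using f unfolding lrs_iso_def by blast
  have m: "rs_morphism Y X h" using h by (simp add: lrs_morphism_def)
  have "rs_eq X X (rs_comp Y h g) rs_id"
    using rs_eq_trans[OF rs_comp_cong_right[OF m rs_eq_sym[OF fg]]] h(2) by (simp add: inverse_rs_maps_def)
  moreover have "rs_eq Y Y (rs_comp X g h) rs_id"
    using rs_eq_trans[OF rs_comp_cong_left[OF m rs_eq_sym[OF fg]]] h(2) by (simp add: inverse_rs_maps_def)
  ultimately show ?thesis
    using h(1) lrs_morphism_cong[OF fm fg] by (auto simp: lrs_iso_def inverse_rs_maps_def)
qed

lemma rs_id_simps [simp]: "pt rs_id x = x" "shm rs_id V s = s"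
  by (simp_all add: rs_id_def)

section \<open>A locally ringed space and its localization at the local prime system\<close>

context lrs
begin

lemma stalk_map_rs_id:
  assumes "x \<in> points X" "\<alpha> \<in> carrier (stalk X x)"
  shows "stalk_map X rs_id x \<alpha> = \<alpha>"
  by (rule stalk_map_id[OF ringed assms])

lemma contraction_id:
  assumes "x \<in> points X" "z \<subseteq> carrier (stalk X x)"
  shows "contraction (stalk X x) (stalk_map X rs_id x) z = z"
  using assms stalk_map_rs_id[OF assms(1)] by (auto simp: contraction_def)

lemma max_ideal_subset: "x \<in> points X \<Longrightarrow> max_ideal (stalk X x) \<subseteq> carrier (stalk X x)"
  using max_ideal_prime[OF local_stalk]
  by (metis additive_subgroup.a_subset ideal.axioms(1) primeideal.axioms(1))

text \<open>For the identity the localized stalks are those of a local ring at its maximal ideal,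
  where nothing new is inverted. A section is its own fraction with denominator 1, and an element of
  the kernel is already zero.\<close>

lemma loc_compare_id:
  "loc_compare X X (local_prime_system X) rs_id"
proof -
  have preim: "preim X rs_id V = V" if "open_in X V" for V
    using openin_subset[OF that] by auto
  have "prs_morphism X (local_prime_system X) X (local_prime_system X) rs_id"
    using local_prime_system rs_morphism_id[OF ringed] contraction_id max_ideal_subset
    by (auto simp: prs_morphism_def local_prime_system_def)
  then interpret k: prs_mor X "local_prime_system X" X "local_prime_system X" rs_id by unfold_locales
  have c: "pt (loc_map X (local_prime_system X) X rs_id) (x, max_ideal (stalk X x)) = (x, max_ideal (stalk X x))"
    if "x \<in> points X" for x
    using that contraction_id[OF that max_ideal_subset[OF that]] by (simp add: k.pt_loc_map)
  show ?thesis
  proof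
    show "bij_betw (\<lambda>x. pt (loc_map X (local_prime_system X) X rs_id) (x, max_ideal (stalk X x)))
        (points X) (points (loc X (local_prime_system X)))"
    proof (rule bij_betw_imageI)
      show "inj_on (\<lambda>x. pt (loc_map X (local_prime_system X) X rs_id) (x, max_ideal (stalk X x))) (points X)"
        using c by (auto intro!: inj_onI)
      have "w \<in> (\<lambda>x. (x, max_ideal (stalk X x))) ` points X \<longleftrightarrow> w \<in> points (loc X (local_prime_system X))" for w
        by (cases w) (auto simp: k.src.points_loc local_prime_system_def)
      then show "(\<lambda>x. pt (loc_map X (local_prime_system X) X rs_id) (x, max_ideal (stalk X x))) ` points X
          = points (loc X (local_prime_system X))"
        using c by (auto cong: image_cong)
    qed
  next
    fix U a x assume U: "open_in X U" and a: "a \<in> carrier (sec X U)" and x: "x \<in> U"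
    interpret U: cring "sec X U" by (rule sec_cring[OF U])
    have "stalk_map X rs_id y (germ X y U \<one>\<^bsub>sec X U\<^esub> [^]\<^bsub>stalk X y\<^esub> (0::nat)) \<otimes>\<^bsub>stalk X y\<^esub> germ X y U a
        = stalk_map X rs_id y (germ X y U a)" if y: "y \<in> U" for y
    proof -
      have yX: "y \<in> points X" using y U openin_subset by blast
      interpret S: cring "stalk X y" by (rule stalk_cring[OF yX])
      show ?thesis using stalk_map_rs_id[OF yX] germ_closed[OF U y a] by simp
    qed
    then show "\<exists>V t b (n::nat). open_in X V \<and> t \<in> carrier (sec X V) \<and> b \<in> carrier (sec X V) \<and>
        x \<in> nonvanishing X (preim X rs_id V) (shm rs_id V t) \<and>
        nonvanishing X (preim X rs_id V) (shm rs_id V t) \<subseteq> U \<and>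
        (\<forall>y \<in> nonvanishing X (preim X rs_id V) (shm rs_id V t).
          stalk_map X rs_id y (germ X (pt rs_id y) V t [^]\<^bsub>stalk X (pt rs_id y)\<^esub> n) \<otimes>\<^bsub>stalk X y\<^esub> germ X y U a
          = stalk_map X rs_id y (germ X (pt rs_id y) V b))"
      using U a x nonvanishing_one[OF U]
      by (intro exI[of _ U] exI[of _ "\<one>\<^bsub>sec X U\<^esub>"] exI[of _ a] exI[of _ 0]) (simp add: preim)
  next
    fix x \<beta> assume x: "x \<in> points X" and b: "\<beta> \<in> carrier (stalk X (pt rs_id x))"
      and z: "stalk_map X rs_id x \<beta> = \<zero>\<^bsub>stalk X x\<^esub>"
    interpret prime_localization "stalk X x" "max_ideal (stalk X x)"
      by (rule k.src.prime_localization_at[OF x]) (simp add: local_prime_system_def)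
    show "\<exists>u\<in>carrier (stalk X (pt rs_id x)). stalk_map X rs_id x u \<notin> max_ideal (stalk X x) \<and>
        u \<otimes>\<^bsub>stalk X (pt rs_id x)\<^esub> \<beta> = \<zero>\<^bsub>stalk X (pt rs_id x)\<^esub>"
      using z b stalk_map_rs_id[OF x] one_denom by (intro bexI[of _ "\<one>\<^bsub>stalk X x\<^esub>"]) auto
  qed
qed

text \<open>For the identity \<open>\<delta>\<close> sends a germ to that germ over 1, so the
  isomorphism \<open>D\<close> obtained by transport is the projection. This also shows that the
  inverse chosen in \<open>comparison\<close> exists.\<close>

lemma loc_proj_iso: "lrs_iso (loc X (local_prime_system X)) X (loc_proj X (local_prime_system X))"
proof -
  interpret i: loc_compare X X "local_prime_system X" rs_id
    "\<lambda>x. pt (loc_map X (local_prime_system X) X rs_id) (x, max_ideal (stalk X x))"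
    by (rule loc_compare_id)
  have "rs_eq (loc X (local_prime_system X)) X i.D (loc_proj X (local_prime_system X))"
    unfolding rs_eq_def
  proof (intro conjI ballI allI impI)
    have c: "pt (loc_map X (local_prime_system X) X rs_id) (x, max_ideal (stalk X x)) = (x, max_ideal (stalk X x))"
      if "x \<in> points X" for x
      using that contraction_id[OF that max_ideal_subset[OF that]] by (simp add: i.k.pt_loc_map)
    have cases: "\<exists>x\<in>points X. w = (x, max_ideal (stalk X x))" if "w \<in> points (loc X (local_prime_system X))" for w
      using that i.points_loc_local by (cases w) auto
    show pt: "pt i.D w = pt (loc_proj X (local_prime_system X)) w" if "w \<in> points (loc X (local_prime_system X))" for w
      using cases[OF that] c i.pt_D_c by (force simp: loc_proj_def)
    fix U a assume U: "open_in X U" and a: "a \<in> carrier (sec X U)"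
    let ?c = "\<lambda>x. pt (loc_map X (local_prime_system X) X rs_id) (x, max_ideal (stalk X x))"
    have "{w \<in> points (loc X (local_prime_system X)). fst w \<in> U} = preim (loc X (local_prime_system X)) i.D U"
      using pt by (auto simp: loc_proj_def)
    then have set: "{w \<in> points (loc X (local_prime_system X)). fst w \<in> U} = ?c ` U"
      by (simp only: i.preim_D[OF U])
    have val: "i.\<delta> x (germ X x U a) = fraction (stalk X x) (max_ideal (stalk X x)) (germ X x U a) \<one>\<^bsub>stalk X x\<^esub>"
      if x: "x \<in> U" for x
    proof -
      have xX: "x \<in> points X" using x U openin_subset by blast
      interpret S: cring "stalk X x" by (rule stalk_cring[OF xX])
      interpret prime_localization "stalk X x" "max_ideal (stalk X x)"
        by (rule i.k.src.prime_localization_at[OF xX]) (simp add: local_prime_system_def)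
      show ?thesis
        using i.\<delta>_eq[OF xX germ_closed[OF U x a], of "germ X x U a" "\<one>\<^bsub>stalk X x\<^esub>"] germ_closed[OF U x a] one_denom
        by (simp add: stalk_map_rs_id[OF xX] contraction_id[OF xX max_ideal_subset[OF xX]])
    qed
    have "shm i.D U a = restrict (\<lambda>(x, z). fraction (stalk X x) z (germ X x U a) \<one>\<^bsub>stalk X x\<^esub>) (?c ` U)"
    proof (rule i.shm_D_pointwise[OF U])
      fix x assume x: "x \<in> U"
      then have "x \<in> points X" using U openin_subset by blast
      then show "i.\<delta> x (germ X x U a) = (\<lambda>(x, z). fraction (stalk X x) z (germ X x U a) \<one>\<^bsub>stalk X x\<^esub>) (?c x)"
        using val[OF x] c by simp
    qed
    then show "shm i.D U a = shm (loc_proj X (local_prime_system X)) U a"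
      by (simp add: loc_proj_def set[symmetric])
  qed
  then show ?thesis by (rule lrs_iso_cong[OF i.tr.D_iso])
qed

end

section \<open>The direct image as a primed ringed space\<close>

locale affine_mor = lrs_mor X Y f
  for X :: "('a, 'b) rspace" and Y :: "('c, 'd) rspace" and f :: "('a, 'b, 'c, 'd) rs_map" +
  assumes affine: "affine_morphism X Y f"
begin

abbreviation "A \<equiv> direct_image X Y f"
abbreviation "g \<equiv> direct_image_alg f :: ('c, 'b, 'c, 'd) rs_map"
abbreviation "k \<equiv> to_direct_image f :: ('a, 'b, 'c, 'b) rs_map"
abbreviation "MA \<equiv> rel_prime_system Y A g"

lemma cover:
  assumes "y \<in> points Y"
  obtains V where "y \<in> V" "affine_open_subset Y V" "affine_open_subset X (preim X f V)"
proof -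
  obtain \<V> where "\<Union>\<V> = points Y" "\<And>V. V \<in> \<V> \<Longrightarrow> affine_open Y V \<and> affine_open X (preim X f V)"
    using affine unfolding affine_morphism_def by blast
  then show thesis
    using assms that src.lrs_axioms tgt.lrs_axioms
    by (metis UnionE affine_open_subset.intro affine_open_subset_axioms.intro)
qed

lemma A_simps [simp]:
  "top_sp A = top_sp Y" "sec A V = sec X (preim X f V)" "res A V W = res X (preim X f V) (preim X f W)"
  by (simp_all add: direct_image_def)

lemma g_simps [simp]: "pt g y = y" "shm g = shm f"
  by (simp_all add: direct_image_alg_def)

lemma k_simps [simp]: "pt k = pt f" "shm k V s = s" "preim X k = preim X f"
  by (simp_all add: to_direct_image_def preim_def[abs_def])

lemma preim_g: "open_in Y V \<Longrightarrow> preim A g V = V"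
  using openin_subset[of "top_sp Y" V] by auto

lemma presheaf_A: "presheaf_of_rings A"
  unfolding presheaf_of_rings_def
proof (intro conjI allI impI ballI)
  fix U assume "open_in A U"
  then show "cring (sec A U)" by (simp add: src.sec_cring preim_open)
next
  fix U V assume "open_in A U \<and> open_in A V \<and> V \<subseteq> U"
  then show "res A U V \<in> ring_hom (sec A U) (sec A V)"
    using src.res_hom[OF preim_open preim_open preim_mono] by simp
next
  fix U s assume "open_in A U" "s \<in> carrier (sec A U)"
  then show "res A U U s = s" by (simp add: src.res_id preim_open)
next
  fix U V W s assume "open_in A U \<and> open_in A V \<and> open_in A W \<and> W \<subseteq> V \<and> V \<subseteq> U" "s \<in> carrier (sec A U)"
  then show "res A V W (res A U V s) = res A U W s"
    using src.res_res[OF preim_open preim_open preim_open preim_mono preim_mono] by simp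
qed

lemma ringed_A: "ringed_space A"
  unfolding ringed_space_def
proof (intro conjI allI impI ballI)
  show "presheaf_of_rings A" by (rule presheaf_A)
next
  fix C s t assume C: "\<forall>U\<in>C. open_in A U" and s: "s \<in> carrier (sec A (\<Union>C))"
    and t: "t \<in> carrier (sec A (\<Union>C))" and e: "\<forall>U\<in>C. res A (\<Union>C) U s = res A (\<Union>C) U t"
  have o: "open_in X (preim X f (\<Union>C))" using C by (intro preim_open) auto
  show "s = t"
  proof (rule src.sections_eqI[OF o])
    fix x assume x: "x \<in> preim X f (\<Union>C)"
    then obtain U where U: "U \<in> C" "x \<in> preim X f U" by auto
    then show "\<exists>W. open_in X W \<and> x \<in> W \<and> W \<subseteq> preim X f (\<Union>C) \<and>
        res X (preim X f (\<Union>C)) W s = res X (preim X f (\<Union>C)) W t"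
      using C e by (intro exI[of _ "preim X f U"]) (auto intro!: preim_open)
  qed (use s t in simp_all)
next
  fix C s assume "(\<forall>U\<in>C. open_in A U \<and> s U \<in> carrier (sec A U)) \<and>
      (\<forall>U\<in>C. \<forall>V\<in>C. res A U (U \<inter> V) (s U) = res A V (U \<inter> V) (s V))"
  then have C: "\<And>U. U \<in> C \<Longrightarrow> open_in Y U" and s: "\<And>U. U \<in> C \<Longrightarrow> s U \<in> carrier (sec X (preim X f U))"
    and e: "\<And>U V. U \<in> C \<Longrightarrow> V \<in> C \<Longrightarrow>
      res X (preim X f U) (preim X f (U \<inter> V)) (s U) = res X (preim X f V) (preim X f (U \<inter> V)) (s V)" by auto
  \<comment> \<open>Different members of \<open>C\<close> can have the same preimage in
    \<open>X\<close>, where the gluing is done. One of them is picked; \<open>sr\<close> shows that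
    their sections coincide, since their overlap has that same preimage.\<close>
  define r where "r W = (SOME U. U \<in> C \<and> preim X f U = W)" for W
  have r: "r (preim X f U) \<in> C" "preim X f (r (preim X f U)) = preim X f U" if "U \<in> C" for U
    unfolding r_def by (rule someI2[of _ U]; use that in simp)+
  have int: "preim X f (U \<inter> V) = preim X f U \<inter> preim X f V" for U V by auto
  have sr: "s (r (preim X f U)) = s U" if U: "U \<in> C" for U
    using e[OF r(1)[OF U] U] unfolding int r(2)[OF U]
    using src.res_id[OF preim_open[OF C[OF U]]] s[OF U] s[OF r(1)[OF U]] r(2)[OF U] by simp
  have un: "\<Union>(preim X f ` C) = preim X f (\<Union>C)" by auto
  have "\<exists>t\<in>carrier (sec X (\<Union>(preim X f ` C))). \<forall>W\<in>preim X f ` C.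
      res X (\<Union>(preim X f ` C)) W t = s (r W)"
  proof (rule src.glue)
    show "open_in X W" "s (r W) \<in> carrier (sec X W)" if "W \<in> preim X f ` C" for W
      using that C s sr preim_open by auto
    show "res X W (W \<inter> W') (s (r W)) = res X W' (W \<inter> W') (s (r W'))"
      if "W \<in> preim X f ` C" "W' \<in> preim X f ` C" for W W'
      using that e sr by (auto simp: int)
  qed
  then obtain t where t: "t \<in> carrier (sec X (preim X f (\<Union>C)))"
    "\<And>U. U \<in> C \<Longrightarrow> res X (preim X f (\<Union>C)) (preim X f U) t = s U"
    unfolding un using sr by auto
  then show "\<exists>t\<in>carrier (sec A (\<Union>C)). \<forall>U\<in>C. res A (\<Union>C) U t = s U" by auto
qed

lemma g_morphism: "rs_morphism A Y g"
proof -
  have "continuous_map (top_sp A) (top_sp Y) (pt g)"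
    by (simp add: continuous_map_def) (simp add: openin_subset Collect_conj_eq openin_Int)
  then show ?thesis
    using ringed_A tgt.ringed shm_hom shm_res
    by (simp add: rs_morphism_def preim_g)
qed

lemma k_morphism: "rs_morphism X A k"
proof -
  have "continuous_map (top_sp X) (top_sp A) (pt k)" using mor by (simp add: rs_morphism_def)
  moreover have "(\<lambda>s. s) \<in> ring_hom R R" for R :: "'b ring" by (rule ring_hom_memI) simp_all
  ultimately show ?thesis
    using src.ringed ringed_A by (simp add: rs_morphism_def to_direct_image_def[THEN arg_cong[of _ _ shm]])
qed

sublocale g: rs_mor A Y g
  by unfold_locales (rule g_morphism)

sublocale km: rs_mor X A k
  by unfold_locales (rule k_morphism)

lemma MA_iff: "p \<in> MA y \<longleftrightarrow> primeideal p (stalk A y) \<and>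
    contraction (stalk Y y) (stalk_map A g y) p = max_ideal (stalk Y y)"
  by (simp add: rel_prime_system_def pullback_prime_system_def local_prime_system_def prime_spectrum_def)

lemma prime_system_MA: "prime_system A MA"
  by (auto simp: prime_system_def MA_iff prime_spectrum_def)

lemma stalk_map_k_g:
  assumes x: "x \<in> points X" and \<alpha>: "\<alpha> \<in> carrier (stalk Y (pt f x))"
  shows "stalk_map X k x (stalk_map A g (pt f x) \<alpha>) = stalk_map X f x \<alpha>"
proof -
  obtain V s where V: "open_in Y V" "pt f x \<in> V" "s \<in> carrier (sec Y V)" "\<alpha> = germ Y (pt f x) V s"
    using tgt.stalk_cases[OF \<alpha>] .
  have y: "pt f x \<in> points A" using pt_closed[OF x] by simp
  show ?thesis
    using g.stalk_map_germ[OF y, of V s] km.stalk_map_germ[OF x, of V "shm f V s"] stalk_map_germ[OF x V(1-3)] V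
      shm_closed[OF V(1,3)]
    by (simp add: preim_g)
qed

text \<open>Contracting the maximal ideal at x first to \<open>A\<close> and then to
  \<open>Y\<close> is contracting it along \<open>f\<close>, and \<open>f\<close> is local, so the
  result is the maximal ideal at the image point.\<close>

lemma k_prs_morphism: "prs_morphism X (local_prime_system X) A MA k"
proof -
  have "contraction (stalk A (pt f x)) (stalk_map X k x) (max_ideal (stalk X x)) \<in> MA (pt f x)"
    if x: "x \<in> points X" for x
  proof -
    have y: "pt f x \<in> points Y" by (rule pt_closed[OF x])
    have "contraction (stalk Y (pt f x)) (stalk_map A g (pt f x))
        (contraction (stalk A (pt f x)) (stalk_map X k x) (max_ideal (stalk X x)))
      = contraction (stalk Y (pt f x)) (stalk_map X f x) (max_ideal (stalk X x))"
      using stalk_map_k_g[OF x] ring_hom_closed[OF g.stalk_map_hom[of "pt f x"]] y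
      by (intro contraction_comp[symmetric]) simp_all
    also have "\<dots> = max_ideal (stalk Y (pt f x))"
      using lrs_mor x by (simp add: lrs_morphism_def local_hom_def)
    finally show ?thesis
      unfolding MA_iff using km.stalk_map_hom[OF x] g.src.stalk_cring[of "pt f x"] y x
      by (auto intro!: primeideal_contraction src.stalk_cring max_ideal_prime src.local_stalk)
  qed
  then show ?thesis
    using src.local_prime_system prime_system_MA k_morphism
    by (simp add: prs_morphism_def local_prime_system_def)
qed

sublocale k: prs_mor X "local_prime_system X" A MA k
  by unfold_locales (rule k_prs_morphism)

section \<open>Points and primes over an affine open with affine preimage\<close>

abbreviation "c \<equiv> \<lambda>x. pt (loc_map X (local_prime_system X) A k) (x, max_ideal (stalk X x))"

lemma c_eq: "c x = (pt f x, contraction (stalk A (pt f x)) (stalk_map X k x) (max_ideal (stalk X x)))"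
  by (simp add: k.pt_loc_map)

lemma germ_mem_c_iff:
  assumes x: "x \<in> points X" and V: "open_in Y V" "pt f x \<in> V" "s \<in> carrier (sec X (preim X f V))"
  shows "germ A (pt f x) V s \<in> snd (c x) \<longleftrightarrow> x \<notin> nonvanishing X (preim X f V) s"
  using km.stalk_map_germ[OF x, of V s] g.src.germ_closed[of V "pt f x" s] V x
  by (simp add: c_eq contraction_def nonvanishing_def)

text \<open>In classical terms, the stalk of \<open>A\<close> at \<open>y\<close> is the localization of \<open>A(V)\<close> at the functions
  on \<open>V\<close> that do not vanish at \<open>y\<close>.\<close>

lemma extend_germ:
  assumes V: "affine_open_subset Y V" "affine_open_subset X (preim X f V)" and y: "y \<in> V"
    and \<alpha>: "\<alpha> \<in> carrier (stalk A y)"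
  obtains r e W s and n :: nat where "r \<in> carrier (sec Y V)" "y \<in> nonvanishing Y V r"
    "open_in Y W" "y \<in> W" "nonvanishing Y V r \<subseteq> W" "W \<subseteq> V" "s \<in> carrier (sec X (preim X f W))"
    "\<alpha> = germ A y W s" "e \<in> carrier (sec X (preim X f V))"
    "germ A y V e = germ A y V (shm f V r [^]\<^bsub>sec A V\<^esub> n) \<otimes>\<^bsub>stalk A y\<^esub> \<alpha>"
proof -
  interpret V: affine_open_subset Y V by fact
  interpret P: affine_open_subset X "preim X f V" by fact
  let ?P = "preim X f V"
  note oV = V.open_U and oP = P.open_U
  obtain W s where W: "open_in A W" "y \<in> W" "W \<subseteq> V" "s \<in> carrier (sec A W)" "\<alpha> = germ A y W s"
    using g.src.stalk_cases_in[OF \<alpha>, of V] oV y by auto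
  have oW: "open_in Y W" using W by simp
  \<comment> \<open>Affineness of \<open>V\<close> shrinks the domain of the germ to D(r) with r
    defined on all of \<open>V\<close>. Its preimage is the nonvanishing set of
    \<open>shm f V r\<close>, so the extension property of the affine preimage applies.\<close>
  obtain r where r: "r \<in> carrier (sec Y V)" "y \<in> nonvanishing Y V r" "nonvanishing Y V r \<subseteq> W"
    using V.nonvanishing_basis[OF oW W(2) y] .
  let ?Z = "nonvanishing Y V r"
  have oZ: "open_in Y ?Z" by (rule tgt.nonvanishing_open[OF oV r(1)])
  have ZV: "?Z \<subseteq> V" by (rule tgt.nonvanishing_subset)
  have pZ: "preim X f ?Z = nonvanishing X ?P (shm f V r)" by (rule preim_nonvanishing[OF oV r(1)])
  note fr = shm_closed[OF oV r(1)]
  have s': "res A W ?Z s \<in> carrier (sec A ?Z)" using W oZ r by (intro g.src.res_closed) simp_all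
  then have s'': "res A W ?Z s \<in> carrier (sec X (preim X f ?Z))" by simp
  obtain n :: nat and e where e: "e \<in> carrier (sec X ?P)"
    "res X ?P (preim X f ?Z) e = res X ?P (preim X f ?Z) (shm f V r [^]\<^bsub>sec X ?P\<^esub> n)
       \<otimes>\<^bsub>sec X (preim X f ?Z)\<^esub> res A W ?Z s"
    by (rule P.extend_section[OF fr, folded pZ, OF s''])
  interpret P: cring "sec X ?P" by (rule src.sec_cring[OF oP])
  have frn: "shm f V r [^]\<^bsub>sec X ?P\<^esub> n \<in> carrier (sec A V)" using fr by simp
  have "germ A y V e = germ A y ?Z (res A V ?Z e)"
    using e oV oZ ZV r by (intro g.src.germ_res[symmetric]) simp_all
  also have "\<dots> = germ A y ?Z (res A V ?Z (shm f V r [^]\<^bsub>sec X ?P\<^esub> n) \<otimes>\<^bsub>sec A ?Z\<^esub> res A W ?Z s)"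
    using e(2) by simp
  also have "\<dots> = germ A y ?Z (res A V ?Z (shm f V r [^]\<^bsub>sec X ?P\<^esub> n)) \<otimes>\<^bsub>stalk A y\<^esub> germ A y ?Z (res A W ?Z s)"
    using frn oV oZ ZV r
    by (intro g.src.germ_mult_add(1)[OF _ _ _ s', symmetric] g.src.res_closed) simp_all
  also have "\<dots> = germ A y V (shm f V r [^]\<^bsub>sec A V\<^esub> n) \<otimes>\<^bsub>stalk A y\<^esub> \<alpha>"
    using g.src.germ_res[of V ?Z y] g.src.germ_res[of W ?Z y s] frn W oV oZ ZV r by simp
  finally show thesis using that[OF r(1,2) oW W(2) r(3) W(3) _ W(5) e(1)] W(4) by simp
qed

text \<open>A function on \<open>Y\<close> that does not vanish at \<open>y\<close> is outside every
  prime lying over the maximal ideal at \<open>y\<close>. Hence the denominators in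
  \<open>extend_germ\<close> are harmless for all primes in \<open>MA y\<close> at once.\<close>

lemma germ_shm_notin_prime:
  assumes p: "p \<in> MA y" and y: "y \<in> points Y" and V: "open_in Y V" and r: "r \<in> carrier (sec Y V)"
    and yr: "y \<in> nonvanishing Y V r"
  shows "germ A y V (shm f V r) \<in> carrier (stalk A y) - p"
proof -
  have yV: "y \<in> V" using yr by (simp add: nonvanishing_def)
  have "germ A y V (shm f V r) = stalk_map A g y (germ Y y V r)"
    using g.stalk_map_germ[of y V r] y V yV r by (simp add: preim_g)
  moreover have "germ Y y V r \<notin> contraction (stalk Y y) (stalk_map A g y) p"
    using p yr by (simp add: MA_iff nonvanishing_def)
  ultimately show ?thesis
    using tgt.germ_closed[OF V yV r] g.src.germ_closed[of V y "shm f V r"] V yV shm_closed[OF V r]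
    by (simp add: contraction_def)
qed

text \<open>By \<open>extend_germ\<close> every germ becomes the germ of a section over
  \<open>V\<close> after multiplication by a power of a germ that lies in none of the primes in
  \<open>MA y\<close>.\<close>

lemma prime_eqI:
  assumes V: "affine_open_subset Y V" "affine_open_subset X (preim X f V)" and y: "y \<in> V"
    and p: "p \<in> MA y" "p' \<in> MA y"
    and eq: "\<And>e. e \<in> carrier (sec X (preim X f V)) \<Longrightarrow> germ A y V e \<in> p \<longleftrightarrow> germ A y V e \<in> p'"
  shows "p = p'"
proof -
  have oV: "open_in Y V" using V(1) by (rule affine_open_subset.open_U)
  then have yY: "y \<in> points Y" using y openin_subset by blast
  have "\<alpha> \<in> p \<longleftrightarrow> \<alpha> \<in> p'" if \<alpha>: "\<alpha> \<in> carrier (stalk A y)" for \<alpha>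
  proof -
    obtain r e W s and n :: nat where r: "r \<in> carrier (sec Y V)" "y \<in> nonvanishing Y V r"
      and e: "e \<in> carrier (sec X (preim X f V))"
        "germ A y V e = germ A y V (shm f V r [^]\<^bsub>sec A V\<^esub> n) \<otimes>\<^bsub>stalk A y\<^esub> \<alpha>"
      by (rule extend_germ[OF V y \<alpha>])
    have "\<alpha> \<in> q \<longleftrightarrow> germ A y V e \<in> q" if q: "q \<in> MA y" for q
    proof -
      interpret q: prime_localization "stalk A y" q
        by (rule k.tgt.prime_localization_at) (use yY q in simp_all)
      interpret qi: primeideal q "stalk A y" by (rule q.prime)
      have "germ A y V (shm f V r [^]\<^bsub>sec A V\<^esub> n) = germ A y V (shm f V r) [^]\<^bsub>stalk A y\<^esub> n"
        using oV y shm_closed[OF oV r(1)] by (intro g.src.germ_pow) simp_all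
      moreover have "germ A y V (shm f V r) [^]\<^bsub>stalk A y\<^esub> n \<in> carrier (stalk A y) - q"
        by (intro q.pow_denom germ_shm_notin_prime[OF q yY oV r])
      ultimately show ?thesis
        unfolding e(2) using \<alpha> qi.I_prime qi.I_l_closed by (metis DiffD1 DiffD2)
    qed
    then show ?thesis using p eq[OF e(1)] by metis
  qed
  moreover have "p \<subseteq> carrier (stalk A y)" "p' \<subseteq> carrier (stalk A y)"
    using p unfolding MA_iff by (metis additive_subgroup.a_subset ideal.axioms(1) primeideal.axioms(1))+
  ultimately show ?thesis by blast
qed

text \<open>Injectivity: sections over the affine preimage of \<open>V\<close> separate its points.
  Surjectivity: a prime \<open>p\<close> at \<open>y\<close> is pulled back to the ring of sections
  over the preimage, where it corresponds to a point \<open>x\<close>; it remains to see that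
  \<open>x\<close> lies over \<open>y\<close> and that its prime is \<open>p\<close>.\<close>

lemma c_bij: "bij_betw c (points X) (points (loc A MA))"
proof (rule bij_betw_imageI)
  show "inj_on c (points X)"
  proof (rule inj_onI)
    fix x x' assume x: "x \<in> points X" "x' \<in> points X" and eq: "c x = c x'"
    have ff: "pt f x' = pt f x" using eq by (simp add: c_eq)
    obtain V where V: "pt f x \<in> V" "affine_open_subset Y V" "affine_open_subset X (preim X f V)"
      using cover[OF pt_closed[OF x(1)]] .
    have oV: "open_in Y V" using V(2) by (rule affine_open_subset.open_U)
    show "x = x'"
    proof (rule affine_open_subset.points_eqI[OF V(3)])
      show "x \<in> preim X f V" "x' \<in> preim X f V" using x V ff by simp_all
      fix b assume b: "b \<in> carrier (sec X (preim X f V))"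
      show "x \<in> nonvanishing X (preim X f V) b \<longleftrightarrow> x' \<in> nonvanishing X (preim X f V) b"
        using germ_mem_c_iff[OF x(1) oV _ b] germ_mem_c_iff[OF x(2) oV _ b] V(1) ff eq by metis
    qed
  qed
  show "c ` points X = points (loc A MA)"
  proof (intro equalityI subsetI)
    fix w assume "w \<in> c ` points X"
    then show "w \<in> points (loc A MA)"
      using k.pt_loc_map_closed by (auto simp: k.src.points_loc local_prime_system_def)
  next
    fix w assume w: "w \<in> points (loc A MA)"
    obtain y p where wyp: "w = (y, p)" by force
    have y: "y \<in> points Y" and p: "p \<in> MA y" using w by (simp_all add: wyp k.tgt.points_loc)
    obtain V where V: "y \<in> V" "affine_open_subset Y V" "affine_open_subset X (preim X f V)"
      using cover[OF y] .
    interpret V: affine_open_subset Y V by (rule V(2))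
    interpret P: affine_open_subset X "preim X f V" by (rule V(3))
    let ?P = "preim X f V"
    have pp: "primeideal p (stalk A y)" using p by (simp add: MA_iff)
    have yA: "y \<in> points A" using y by simp
    have "primeideal (contraction (sec A V) (germ A y V) p) (sec A V)"
      using V.open_U V(1) y
      by (intro primeideal_contraction[OF _ g.src.stalk_cring[OF yA] g.src.germ_hom pp] g.src.sec_cring) simp_all
    then obtain x where x: "x \<in> ?P" and
      xb: "\<And>b. b \<in> carrier (sec X ?P) \<Longrightarrow> germ A y V b \<in> p \<longleftrightarrow> x \<notin> nonvanishing X ?P b"
      using P.prime_point[of "contraction (sec A V) (germ A y V) p"] by (auto simp: contraction_def)
    have xX: "x \<in> points X" and fxV: "pt f x \<in> V" using x by simp_all
    \<comment> \<open>In the affine \<open>V\<close> points are told apart by functions. Such an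
      \<open>r\<close> is nonzero at the image of \<open>x\<close> exactly when its pullback is
      nonzero at \<open>x\<close>, hence when the germ of the pullback is outside \<open>p\<close>,
      hence when \<open>r\<close> is nonzero at \<open>y\<close>.\<close>
    have fx: "pt f x = y"
    proof (rule V.points_eqI[OF fxV V(1)])
      fix r assume r: "r \<in> carrier (sec Y V)"
      have "pt f x \<in> nonvanishing Y V r \<longleftrightarrow> x \<in> nonvanishing X ?P (shm f V r)"
        using preim_nonvanishing[OF V.open_U r] xX by (metis mem_preim)
      also have "\<dots> \<longleftrightarrow> germ A y V (shm f V r) \<notin> p" using xb[OF shm_closed[OF V.open_U r]] by blast
      also have "germ A y V (shm f V r) = stalk_map A g y (germ Y y V r)"
        using g.stalk_map_germ[of y V r] y V.open_U V(1) r by (simp add: preim_g)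
      also have "stalk_map A g y (germ Y y V r) \<notin> p
          \<longleftrightarrow> germ Y y V r \<notin> contraction (stalk Y y) (stalk_map A g y) p"
        using tgt.germ_closed[OF V.open_U V(1) r] by (simp add: contraction_def)
      also have "\<dots> \<longleftrightarrow> y \<in> nonvanishing Y V r"
        using p V(1) by (simp add: MA_iff nonvanishing_def)
      finally show "pt f x \<in> nonvanishing Y V r \<longleftrightarrow> y \<in> nonvanishing Y V r" .
    qed
    have "snd (c x) \<in> MA y"
      using k.contraction_mem[OF xX, of "max_ideal (stalk X x)"] by (simp add: c_eq local_prime_system_def fx)
    then have "p = snd (c x)"
      using xb germ_mem_c_iff[OF xX V.open_U fxV] fx
      by (intro prime_eqI[OF V(2,3,1) p]) auto
    then have "w = c x" by (simp add: wyp c_eq fx)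
    then show "w \<in> c ` points X" using xX by blast
  qed
qed

text \<open>A power of \<open>r\<close> turns \<beta> into the germ of a section \<open>e\<close>
  over the affine preimage. Since \<open>e\<close> vanishes near \<open>x\<close>, it vanishes on
  some D(b), so a power of \<open>b\<close> kills it on the whole preimage.\<close>

lemma kernel_k:
  assumes x: "x \<in> points X" and \<beta>: "\<beta> \<in> carrier (stalk A (pt f x))"
    and z: "stalk_map X k x \<beta> = \<zero>\<^bsub>stalk X x\<^esub>"
  shows "\<exists>u \<in> carrier (stalk A (pt f x)). stalk_map X k x u \<notin> max_ideal (stalk X x) \<and>
        u \<otimes>\<^bsub>stalk A (pt f x)\<^esub> \<beta> = \<zero>\<^bsub>stalk A (pt f x)\<^esub>"
proof -
  let ?y = "pt f x"
  have y: "?y \<in> points A" using pt_closed[OF x] by simp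
  obtain V where V: "?y \<in> V" "affine_open_subset Y V" "affine_open_subset X (preim X f V)"
    using cover[OF pt_closed[OF x]] .
  interpret V: affine_open_subset Y V by (rule V(2))
  interpret P: affine_open_subset X "preim X f V" by (rule V(3))
  let ?P = "preim X f V"
  note oV = V.open_U and oP = P.open_U
  have oA: "open_in A V" and xP: "x \<in> ?P" using oV x V by simp_all
  obtain r e W s and n :: nat where r: "r \<in> carrier (sec Y V)" "?y \<in> nonvanishing Y V r"
    and e: "e \<in> carrier (sec X ?P)"
      "germ A ?y V e = germ A ?y V (shm f V r [^]\<^bsub>sec A V\<^esub> n) \<otimes>\<^bsub>stalk A ?y\<^esub> \<beta>"
    by (rule extend_germ[OF V(2,3,1) \<beta>])
  let ?r = "shm f V r [^]\<^bsub>sec X ?P\<^esub> n"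
  interpret PR: cring "sec X ?P" by (rule src.sec_cring[OF oP])
  interpret h: ring_hom_cring "stalk A ?y" "stalk X x" "stalk_map X k x"
    using km.stalk_map_ring_hom_cring[OF x] by simp
  interpret gV: ring_hom_cring "sec A V" "stalk A ?y" "germ A ?y V"
    by (rule g.src.germ_ring_hom_cring[OF oA V(1)])
  have fr: "shm f V r \<in> carrier (sec X ?P)" by (rule shm_closed[OF oV r(1)])
  have rc: "?r \<in> carrier (sec X ?P)" using fr by simp
  have gr: "germ A ?y V ?r \<in> carrier (stalk A ?y)" using gV.hom_closed[of ?r] rc by simp
  have "germ X x ?P e = stalk_map X k x (germ A ?y V e)"
    using km.stalk_map_germ[OF x, of V e] oV V(1) e(1) by simp
  also have "\<dots> = \<zero>\<^bsub>stalk X x\<^esub>" unfolding e(2) using gr \<beta> z by simp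
  also have "\<dots> = germ X x ?P \<zero>\<^bsub>sec X ?P\<^esub>" using src.germ_one_zero(2)[OF oP xP] by simp
  finally obtain W' where W': "open_in X W'" "x \<in> W'" "W' \<subseteq> ?P" "res X ?P W' e = res X ?P W' \<zero>\<^bsub>sec X ?P\<^esub>"
    using src.germ_eq_res[OF oP xP e(1) PR.zero_closed] by blast
  obtain b where b: "b \<in> carrier (sec X ?P)" "x \<in> nonvanishing X ?P b" "nonvanishing X ?P b \<subseteq> W'"
    using P.nonvanishing_basis[OF W'(1,2) xP] .
  let ?D = "nonvanishing X ?P b"
  have oD: "open_in X ?D" by (rule src.nonvanishing_open[OF oP b(1)])
  interpret rD: ring_hom_cring "sec X ?P" "sec X ?D" "res X ?P ?D"
    by (rule src.res_ring_hom_cring[OF oP oD src.nonvanishing_subset])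
  have "res X ?P ?D e = res X W' ?D (res X ?P W' e)"
    using oP W' oD b e by (intro src.res_res[symmetric])
  also have "\<dots> = res X ?P ?D \<zero>\<^bsub>sec X ?P\<^esub>"
    unfolding W'(4) using oP W' oD b by (intro src.res_res) simp_all
  finally have "res X ?P ?D e = \<zero>\<^bsub>sec X ?D\<^esub>" by simp
  then obtain m :: nat where m: "b [^]\<^bsub>sec X ?P\<^esub> m \<otimes>\<^bsub>sec X ?P\<^esub> e = \<zero>\<^bsub>sec X ?P\<^esub>"
    using P.section_torsion[OF b(1) e(1)] by blast
  let ?b = "b [^]\<^bsub>sec X ?P\<^esub> m"
  have bc: "?b \<in> carrier (sec X ?P)" using b by simp
  \<comment> \<open>The two multipliers combined: the power of \<open>r\<close> makes \<beta> the
    germ of \<open>e\<close>, and the power of \<open>b\<close> kills \<open>e\<close>. Both are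
    nonzero at \<open>x\<close>.\<close>
  let ?u = "germ A ?y V (?b \<otimes>\<^bsub>sec X ?P\<^esub> ?r)"
  have u: "?u \<in> carrier (stalk A ?y)" using gV.hom_closed[of "?b \<otimes>\<^bsub>sec X ?P\<^esub> ?r"] bc rc by simp
  have "x \<in> preim X f (nonvanishing Y V r)" using r(2) x by simp
  then have "x \<in> nonvanishing X ?P (shm f V r)" by (simp only: preim_nonvanishing[OF oV r(1)])
  then have "x \<in> nonvanishing X ?P (?b \<otimes>\<^bsub>sec X ?P\<^esub> ?r)"
    using src.nonvanishing_mult[OF oP bc rc] src.nonvanishing_pow[OF oP b(1), of m]
      src.nonvanishing_pow[OF oP fr, of n] b(2) by blast
  then have "stalk_map X k x ?u \<notin> max_ideal (stalk X x)"
    using km.stalk_map_germ[OF x, of V "?b \<otimes>\<^bsub>sec X ?P\<^esub> ?r"] oV V(1) bc rc by (simp add: nonvanishing_def)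
  moreover have "?u \<otimes>\<^bsub>stalk A ?y\<^esub> \<beta> = \<zero>\<^bsub>stalk A ?y\<^esub>"
  proof -
    have gb: "germ A ?y V ?b \<in> carrier (stalk A ?y)" using gV.hom_closed[of ?b] bc by simp
    have "?u \<otimes>\<^bsub>stalk A ?y\<^esub> \<beta> = (germ A ?y V ?b \<otimes>\<^bsub>stalk A ?y\<^esub> germ A ?y V ?r) \<otimes>\<^bsub>stalk A ?y\<^esub> \<beta>"
      using gV.hom_mult[of ?b ?r] bc rc by simp
    also have "\<dots> = germ A ?y V ?b \<otimes>\<^bsub>stalk A ?y\<^esub> germ A ?y V e"
      using gb gr \<beta> e(2) by (simp add: h.R.m_assoc)
    also have "\<dots> = germ A ?y V (?b \<otimes>\<^bsub>sec X ?P\<^esub> e)"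
      using gV.hom_mult[of ?b e] bc e(1) by simp
    also have "\<dots> = \<zero>\<^bsub>stalk A ?y\<^esub>" unfolding m using gV.hom_zero by simp
    finally show ?thesis .
  qed
  ultimately show ?thesis using u by blast
qed

text \<open>In the affine preimage pick D(t) around \<open>x\<close> inside \<open>U\<close>. The
  restriction of \<open>a\<close> to D(t) extends to the whole preimage after multiplication by t^n,
  and this extension is the numerator.\<close>

lemma local_fractions_k:
  assumes U: "open_in X U" and a: "a \<in> carrier (sec X U)" and x: "x \<in> U"
  shows "\<exists>V t b (n::nat). open_in A V \<and> t \<in> carrier (sec A V) \<and> b \<in> carrier (sec A V) \<and>
        x \<in> nonvanishing X (preim X k V) (shm k V t) \<and>
        nonvanishing X (preim X k V) (shm k V t) \<subseteq> U \<and>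
        (\<forall>y \<in> nonvanishing X (preim X k V) (shm k V t).
          stalk_map X k y (germ A (pt k y) V t [^]\<^bsub>stalk A (pt k y)\<^esub> n) \<otimes>\<^bsub>stalk X y\<^esub> germ X y U a
          = stalk_map X k y (germ A (pt k y) V b))"
proof -
  have xX: "x \<in> points X" using x U openin_subset by blast
  obtain V where V: "pt f x \<in> V" "affine_open_subset Y V" "affine_open_subset X (preim X f V)"
    using cover[OF pt_closed[OF xX]] .
  interpret P: affine_open_subset X "preim X f V" by (rule V(3))
  let ?P = "preim X f V"
  note oP = P.open_U
  have oV: "open_in Y V" using V(2) by (rule affine_open_subset.open_U)
  have xP: "x \<in> ?P" using xX V by simp
  obtain t where t: "t \<in> carrier (sec X ?P)" "x \<in> nonvanishing X ?P t" "nonvanishing X ?P t \<subseteq> U"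
    using P.nonvanishing_basis[OF U x xP] .
  let ?D = "nonvanishing X ?P t"
  have oD: "open_in X ?D" and DP: "?D \<subseteq> ?P"
    using src.nonvanishing_open[OF oP t(1)] src.nonvanishing_subset by auto
  have a': "res X U ?D a \<in> carrier (sec X ?D)" by (rule src.res_closed[OF U oD t(3) a])
  obtain n :: nat and e where e: "e \<in> carrier (sec X ?P)"
    "res X ?P ?D e = res X ?P ?D (t [^]\<^bsub>sec X ?P\<^esub> n) \<otimes>\<^bsub>sec X ?D\<^esub> res X U ?D a"
    using P.extend_section[OF t(1) a'] .
  interpret PR: cring "sec X ?P" by (rule src.sec_cring[OF oP])
  have tn: "t [^]\<^bsub>sec X ?P\<^esub> n \<in> carrier (sec X ?P)" using t by simp
  have "stalk_map X k z (germ A (pt f z) V t [^]\<^bsub>stalk A (pt f z)\<^esub> n) \<otimes>\<^bsub>stalk X z\<^esub> germ X z U a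
      = stalk_map X k z (germ A (pt f z) V e)" if z: "z \<in> ?D" for z
  proof -
    have zP: "z \<in> ?P" using z DP by blast
    then have zX: "z \<in> points X" and zV: "pt f z \<in> V" by simp_all
    have "germ A (pt f z) V t [^]\<^bsub>stalk A (pt f z)\<^esub> n = germ A (pt f z) V (t [^]\<^bsub>sec X ?P\<^esub> n)"
      using g.src.germ_pow[of V "pt f z" t n] oV zV t by simp
    then have "stalk_map X k z (germ A (pt f z) V t [^]\<^bsub>stalk A (pt f z)\<^esub> n)
        = germ X z ?P (t [^]\<^bsub>sec X ?P\<^esub> n)"
      using km.stalk_map_germ[OF zX, of V "t [^]\<^bsub>sec X ?P\<^esub> n"] oV zV tn by simp
    also have "\<dots> = germ X z ?D (res X ?P ?D (t [^]\<^bsub>sec X ?P\<^esub> n))"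
      by (rule src.germ_res[OF oP oD DP z tn, symmetric])
    finally have "stalk_map X k z (germ A (pt f z) V t [^]\<^bsub>stalk A (pt f z)\<^esub> n) \<otimes>\<^bsub>stalk X z\<^esub> germ X z U a
        = germ X z ?D (res X ?P ?D (t [^]\<^bsub>sec X ?P\<^esub> n)) \<otimes>\<^bsub>stalk X z\<^esub> germ X z ?D (res X U ?D a)"
      using src.germ_res[OF U oD t(3) z a] by simp
    also have "\<dots> = germ X z ?D (res X ?P ?D e)"
      unfolding e(2) by (rule src.germ_mult_add(1)[OF oD z src.res_closed[OF oP oD DP tn] a'])
    also have "\<dots> = germ X z ?P e" by (rule src.germ_res[OF oP oD DP z e(1)])
    also have "\<dots> = stalk_map X k z (germ A (pt f z) V e)"
      using km.stalk_map_germ[OF zX, of V e] oV zV e(1) by simp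
    finally show ?thesis .
  qed
  then show ?thesis
    using oV t e(1) by (intro exI[of _ V] exI[of _ t] exI[of _ e] exI[of _ n]) simp
qed

sublocale cmp: loc_compare X A MA k c
  by unfold_locales (use c_bij local_fractions_k kernel_k in simp_all)

end

section \<open>The comparison map as an isomorphism over the base\<close>

context affine_mor
begin

lemma Spec_direct_image_eq: "Spec_direct_image X Y f = loc A MA"
  by (simp add: Spec_direct_image_def rel_spec_def)

lemma g_prs_morphism: "prs_morphism A MA Y (local_prime_system Y) g"
  using prime_system_MA tgt.local_prime_system g_morphism
  by (auto simp: prs_morphism_def MA_iff local_prime_system_def)

sublocale gp: prs_mor A MA Y "local_prime_system Y" g
  by unfold_locales (rule g_prs_morphism)

text \<open>The structure map passes through the localization of \<open>Y\<close>. Identifying it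
  with \<open>f\<close> after \<open>cmp.D\<close> makes it a morphism of locally ringed spaces
  without studying that localization. On values, both maps send a section to the germ of its
  pullback over 1.\<close>

lemma struct_eq_D: "rs_eq (loc A MA) Y (rs_comp X f cmp.D) (Spec_direct_image_struct X Y f)"
  unfolding rs_eq_def
proof (intro conjI ballI allI impI)
  let ?LY = "loc Y (local_prime_system Y)" and ?pY = "loc_proj Y (local_prime_system Y)"
  let ?l = "loc_map A MA Y g"
  have struct: "Spec_direct_image_struct X Y f = rs_comp ?LY ?pY ?l"
    by (simp add: Spec_direct_image_struct_def rel_spec_struct_def)
  have lpt: "pt ?l (y, p) = (y, max_ideal (stalk Y y))" if "(y, p) \<in> points (loc A MA)" for y p
    using that by (simp add: gp.pt_loc_map k.tgt.points_loc MA_iff)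
  show pts: "pt (rs_comp X f cmp.D) w = pt (Spec_direct_image_struct X Y f) w" if w: "w \<in> points (loc A MA)" for w
  proof -
    obtain x where x: "x \<in> points X" "w = c x" by (rule cmp.loc_points_cases[OF w])
    have "(pt f x, snd (c x)) \<in> points (loc A MA)" using w x(2) by (simp add: c_eq)
    then have "pt ?l (c x) = (pt f x, max_ideal (stalk Y (pt f x)))" using lpt by (simp add: c_eq)
    then show ?thesis unfolding struct x(2) using cmp.pt_D_c[OF x(1)] by (simp add: rs_comp_def loc_proj_def)
  qed
  fix V s assume V: "open_in Y V" and s: "s \<in> carrier (sec Y V)"
  let ?t = "shm ?pY V s"
  have oP: "open_in X (preim X f V)" by (rule preim_open[OF V])
  have pre: "preim (loc A MA) ?l (preim ?LY ?pY V) = c ` preim X f V"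
  proof -
    have "w \<in> preim (loc A MA) ?l (preim ?LY ?pY V) \<longleftrightarrow> w \<in> preim (loc A MA) cmp.D (preim X f V)" for w
      using pts[of w] gp.pt_loc_map_closed[of w] cmp.tr.D_morphism rs_mor.pt_closed[of "loc A MA" X cmp.D w]
      by (auto simp: struct rs_comp_def rs_mor_def)
    then have "preim (loc A MA) ?l (preim ?LY ?pY V) = preim (loc A MA) cmp.D (preim X f V)" by blast
    then show ?thesis by (simp only: cmp.preim_D[OF oP])
  qed
  have "shm cmp.D (preim X f V) (shm f V s) = restrict (shm ?l (preim ?LY ?pY V) ?t) (c ` preim X f V)"
  proof (rule cmp.shm_D_pointwise[OF oP])
    fix x assume x: "x \<in> preim X f V"
    then have xX: "x \<in> points X" and yV: "pt f x \<in> V" by simp_all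
    let ?y = "pt f x" and ?p = "contraction (stalk A (pt f x)) (stalk_map X k x) (max_ideal (stalk X x))"
    let ?m = "max_ideal (stalk Y ?y)"
    have y: "?y \<in> points Y" by (rule pt_closed[OF xX])
    have cx: "c x \<in> points (loc A MA)" by (rule cmp.c_closed[OF xX])
    then have p: "?p \<in> MA ?y" by (simp add: c_eq k.tgt.points_loc)
    interpret h: ring_hom_cring "stalk Y ?y" "stalk A ?y" "stalk_map A g ?y"
      using g.stalk_map_ring_hom_cring[of ?y] y by simp
    interpret pl: prime_localization "stalk A ?y" ?p using cmp.prime_loc[OF xX] by simp
    have m: "contraction (stalk Y ?y) (stalk_map A g ?y) ?p = ?m" using p by (simp add: MA_iff)
    have gs: "germ Y ?y V s \<in> carrier (stalk Y ?y)" by (rule tgt.germ_closed[OF V yV s])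
    have gfs: "stalk_map A g ?y (germ Y ?y V s) = germ A ?y V (shm f V s)"
      using g.stalk_map_germ[of ?y V s] y V yV s by (simp add: preim_g)
    have lc: "pt ?l (c x) = (?y, ?m)" using cx lpt by (simp add: c_eq)
    have "c x \<in> preim (loc A MA) ?l (preim ?LY ?pY V)" unfolding pre using x by blast
    then have "shm ?l (preim ?LY ?pY V) ?t (c x)
        = localize_hom (stalk A ?y) ?p (stalk_map A g ?y) (?t (?y, ?m))"
      using lc unfolding c_eq by (simp add: gp.shm_loc_map)
    also have "?t (?y, ?m) = fraction (stalk Y ?y) ?m (germ Y ?y V s) \<one>\<^bsub>stalk Y ?y\<^esub>"
      using y yV by (simp add: loc_proj_def gp.tgt.points_loc local_prime_system_def)
    also have "localize_hom (stalk A ?y) ?p (stalk_map A g ?y) \<dots>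
        = fraction (stalk A ?y) ?p (germ A ?y V (shm f V s)) \<one>\<^bsub>stalk A ?y\<^esub>"
      using localize_hom_fraction[OF h.R.is_cring h.S.is_cring h.homh pl.prime gs, of "\<one>\<^bsub>stalk Y ?y\<^esub>"]
        pl.one_denom gfs unfolding m by simp
    finally have "shm ?l (preim ?LY ?pY V) ?t (c x)
        = fraction (stalk A ?y) ?p (germ A ?y V (shm f V s)) \<one>\<^bsub>stalk A ?y\<^esub>" .
    moreover have "cmp.\<delta> x (germ X x (preim X f V) (shm f V s))
        = fraction (stalk A ?y) ?p (germ A ?y V (shm f V s)) \<one>\<^bsub>stalk A ?y\<^esub>"
    proof -
      have kx: "stalk_map X k x (germ A ?y V (shm f V s)) = germ X x (preim X f V) (shm f V s)"
        using km.stalk_map_germ[OF xX, of V "shm f V s"] V yV shm_closed[OF V s] by simp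
      have gx: "germ X x (preim X f V) (shm f V s) \<in> carrier (stalk X x)"
        by (rule src.germ_closed[OF oP x shm_closed[OF V s]])
      have ga: "germ A ?y V (shm f V s) \<in> carrier (stalk A ?y)" using gs gfs h.hom_closed by metis
      interpret kh: ring_hom_cring "stalk A ?y" "stalk X x" "stalk_map X k x"
        using km.stalk_map_ring_hom_cring[OF xX] by simp
      show ?thesis
        using cmp.\<delta>_eq[OF xX gx, of "germ A ?y V (shm f V s)" "\<one>\<^bsub>stalk A ?y\<^esub>"] ga gx kx pl.one_denom by simp
    qed
    ultimately show "cmp.\<delta> x (germ X x (preim X f V) (shm f V s)) = shm ?l (preim ?LY ?pY V) ?t (c x)" by simp
  qed
  also have "\<dots> = shm ?l (preim ?LY ?pY V) ?t"
    using gp.shm_loc_map_extensional[of "preim ?LY ?pY V" ?t] unfolding pre by (simp add: extensional_restrict)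
  finally show "shm (rs_comp X f cmp.D) V s = shm (Spec_direct_image_struct X Y f) V s"
    by (simp add: struct rs_comp_def)
qed

text \<open>Existence of an inverse of the projection makes the choice in \<open>lrs_inverse\<close>
  an actual inverse, and \<open>cmp.loc_map_inverse_eq_E\<close> accepts any such inverse.\<close>

lemma comparison_eq_E: "rs_eq X (loc A MA) (comparison X Y f) cmp.tr.E"
proof -
  let ?L = "loc X (local_prime_system X)" and ?p = "loc_proj X (local_prime_system X)"
  have "\<exists>h. lrs_morphism X ?L h \<and> inverse_rs_maps ?L X ?p h"
    using src.loc_proj_iso by (simp add: lrs_iso_def)
  then have g: "lrs_morphism X ?L (lrs_inverse ?L X ?p) \<and> inverse_rs_maps ?L X ?p (lrs_inverse ?L X ?p)"
    unfolding lrs_inverse_def by (rule someI_ex)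
  then have "ringed_space ?L" "rs_morphism X ?L (lrs_inverse ?L X ?p)"
    by (simp_all add: lrs_morphism_def locally_ringed_space_def)
  then show ?thesis
    unfolding comparison_def using g by (intro cmp.loc_map_inverse_eq_E) (simp_all add: inverse_rs_maps_def)
qed

lemma comparison_lrs_morphism: "lrs_morphism X (loc A MA) (comparison X Y f)"
  by (rule lrs_morphism_cong[OF cmp.tr.E_lrs_morphism rs_eq_sym[OF comparison_eq_E]])

lemma comparison_inverse: "inverse_rs_maps X (loc A MA) (comparison X Y f) cmp.D"
  using rs_eq_trans[OF rs_comp_cong_right[OF cmp.tr.D_morphism comparison_eq_E] cmp.tr.D_E]
    rs_eq_trans[OF rs_comp_cong_left[OF cmp.tr.D_morphism comparison_eq_E] cmp.tr.E_D]
  by (simp add: inverse_rs_maps_def)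

lemma struct_lrs_morphism: "lrs_morphism (loc A MA) Y (Spec_direct_image_struct X Y f)"
  by (rule lrs_morphism_cong[OF lrs_morphism_comp[OF cmp.tr.D_lrs_morphism lrs_mor] struct_eq_D])

lemma comparison_over: "rs_eq X Y (rs_comp (loc A MA) (Spec_direct_image_struct X Y f) (comparison X Y f)) f"
proof -
  have C: "rs_morphism X (loc A MA) (comparison X Y f)"
    using comparison_lrs_morphism by (simp add: lrs_morphism_def)
  have "rs_eq X Y (rs_comp (loc A MA) (Spec_direct_image_struct X Y f) (comparison X Y f))
      (rs_comp (loc A MA) (rs_comp X f cmp.D) (comparison X Y f))"
    by (rule rs_comp_cong_left[OF C rs_eq_sym[OF struct_eq_D]])
  also have "rs_eq X Y \<dots> (rs_comp X f (rs_comp (loc A MA) cmp.D (comparison X Y f)))"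
    by (rule rs_eq_sym[OF rs_comp_assoc[OF cmp.tr.D_morphism]])
  also (rs_eq_trans) have "rs_eq X Y \<dots> (rs_comp X f rs_id)"
    using comparison_inverse by (intro rs_comp_cong_right[OF mor]) (simp add: inverse_rs_maps_def)
  also (rs_eq_trans) have "rs_eq X Y \<dots> f" by (rule rs_comp_id_right)
  finally (rs_eq_trans) show ?thesis .
qed

lemma comparison_iso:
  "lrs_over_iso Y X f (Spec_direct_image X Y f) (Spec_direct_image_struct X Y f) (comparison X Y f)"
  unfolding lrs_over_iso_def lrs_over_morphism_def Spec_direct_image_eq
  using lrs_mor struct_lrs_morphism comparison_lrs_morphism comparison_over cmp.tr.D_lrs_morphism
    struct_eq_D comparison_inverse by blast

end

section \<open>Naturality in the space over the base\<close>

locale affine_mor_over = affine_mor X Y f + X': affine_mor X' Y f'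
  for X :: "('a, 'b) rspace" and Y :: "('c, 'd) rspace" and f :: "('a, 'b, 'c, 'd) rs_map"
    and X' :: "('e, 'g) rspace" and f' :: "('e, 'g, 'c, 'd) rs_map" +
  fixes h :: "('a, 'b, 'e, 'g) rs_map"
  assumes h: "lrs_morphism X X' h" and over: "rs_eq X Y (rs_comp X' f' h) f"

sublocale affine_mor_over \<subseteq> h: lrs_mor X X' h
  by unfold_locales (rule h)

context affine_mor_over
begin

abbreviation "u \<equiv> direct_image_map X' f' h :: ('c, 'b, 'c, 'g) rs_map"

lemma over_pt: "x \<in> points X \<Longrightarrow> pt f' (pt h x) = pt f x"
  using over by (simp add: rs_eq_def rs_comp_def)

lemma over_shm: "open_in Y V \<Longrightarrow> s \<in> carrier (sec Y V) \<Longrightarrow> shm h (preim X' f' V) (shm f' V s) = shm f V s"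
  using over by (simp add: rs_eq_def rs_comp_def)

lemma preim_over: "preim X h (preim X' f' V) = preim X f V"
  using over_pt h.pt_closed by auto

lemma u_simps [simp]: "pt u y = y" "shm u V = shm h (preim X' f' V)"
  by (simp_all add: direct_image_map_def)

lemma preim_u: "open_in Y V \<Longrightarrow> preim A u V = V"
  using openin_subset[of "top_sp Y" V] by auto

lemma u_morphism: "rs_morphism A X'.A u"
proof -
  have "continuous_map (top_sp A) (top_sp X'.A) (pt u)"
    by (simp add: continuous_map_def) (simp add: openin_subset Collect_conj_eq openin_Int)
  moreover have "shm h (preim X' f' V) \<in> ring_hom (sec X' (preim X' f' V)) (sec X (preim X f V))"
    if "open_in Y V" for V
    using h.shm_hom[OF X'.preim_open[OF that]] unfolding preim_over .
  moreover have "shm h (preim X' f' W) (res X' (preim X' f' V) (preim X' f' W) s)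
      = res X (preim X f V) (preim X f W) (shm h (preim X' f' V) s)"
    if "open_in Y V" "open_in Y W" "W \<subseteq> V" "s \<in> carrier (sec X' (preim X' f' V))" for V W s
    using h.shm_res[OF X'.preim_open[OF that(1)] X'.preim_open[OF that(2)] preim_mono[OF that(3)] that(4)]
    unfolding preim_over .
  ultimately show ?thesis
    using ringed_A X'.ringed_A by (simp add: rs_morphism_def preim_u)
qed

sublocale um: rs_mor A X'.A u
  by unfold_locales (rule u_morphism)

lemma stalk_map_u_g:
  assumes y: "y \<in> points Y" and \<alpha>: "\<alpha> \<in> carrier (stalk Y y)"
  shows "stalk_map A u y (stalk_map X'.A X'.g y \<alpha>) = stalk_map A g y \<alpha>"
proof -
  obtain V s where V: "open_in Y V" "y \<in> V" "s \<in> carrier (sec Y V)" "\<alpha> = germ Y y V s"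
    using tgt.stalk_cases[OF \<alpha>] .
  show ?thesis
    using X'.g.stalk_map_germ[of y V s] g.stalk_map_germ[of y V s] um.stalk_map_germ[of y V "shm f' V s"]
      V y X'.shm_closed[OF V(1,3)] over_shm[OF V(1,3)]
    by (simp add: preim_g X'.preim_g preim_u)
qed

text \<open>The algebra map commutes with the structure maps from \<open>Y\<close>, so a prime and
  its contraction along \<open>u\<close> lie over the same ideal of the stalk of
  \<open>Y\<close>.\<close>

lemma u_prs_morphism: "prs_morphism A MA X'.A X'.MA u"
proof -
  have "contraction (stalk X'.A y) (stalk_map A u y) p \<in> X'.MA y" if y: "y \<in> points Y" and p: "p \<in> MA y" for y p
  proof -
    have "contraction (stalk Y y) (stalk_map X'.A X'.g y) (contraction (stalk X'.A y) (stalk_map A u y) p)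
        = contraction (stalk Y y) (stalk_map A g y) p"
      using stalk_map_u_g[OF y] ring_hom_closed[OF X'.g.stalk_map_hom[of y]] y
      by (intro contraction_comp[symmetric]) simp_all
    moreover have "primeideal (contraction (stalk X'.A y) (stalk_map A u y) p) (stalk X'.A y)"
      using um.stalk_map_ring_hom_cring[of y] y p
      by (intro primeideal_contraction[of _ "stalk A y"])
        (simp_all add: MA_iff ring_hom_cring_def ring_hom_cring_axioms_def um.stalk_map_hom[of y, simplified])
    ultimately show ?thesis using p by (simp add: X'.MA_iff MA_iff)
  qed
  then show ?thesis
    using prime_system_MA X'.prime_system_MA u_morphism by (simp add: prs_morphism_def)
qed

sublocale u: prs_mor A MA X'.A X'.MA u
  by unfold_locales (rule u_prs_morphism)

text \<open>The square of direct images commutes already on sections: either way a section over the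
  preimage of V in \<open>X'\<close> is pulled back by \<open>h\<close>.\<close>

lemma stalk_map_k_u:
  assumes x: "x \<in> points X" and \<alpha>: "\<alpha> \<in> carrier (stalk X'.A (pt f x))"
  shows "stalk_map X k x (stalk_map A u (pt f x) \<alpha>) = stalk_map X h x (stalk_map X' X'.k (pt h x) \<alpha>)"
proof -
  have y: "pt f x \<in> points Y" and hx: "pt h x \<in> points X'" and fh: "pt f' (pt h x) = pt f x"
    using pt_closed[OF x] h.pt_closed[OF x] over_pt[OF x] by auto
  obtain V s where V: "open_in Y V" "pt f x \<in> V" "s \<in> carrier (sec X' (preim X' f' V))"
      "\<alpha> = germ X'.A (pt f x) V s"
    using X'.g.src.stalk_cases[OF \<alpha>] by auto
  have o: "open_in X' (preim X' f' V)" by (rule X'.preim_open[OF V(1)])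
  have sh: "shm h (preim X' f' V) s \<in> carrier (sec X (preim X f V))"
    using h.shm_closed[OF o V(3)] unfolding preim_over .
  have "stalk_map A u (pt f x) \<alpha> = germ A (pt f x) V (shm h (preim X' f' V) s)"
    using um.stalk_map_germ[of "pt f x" V s] y V by (simp add: preim_u)
  then have "stalk_map X k x (stalk_map A u (pt f x) \<alpha>) = germ X x (preim X f V) (shm h (preim X' f' V) s)"
    using km.stalk_map_germ[OF x, of V "shm h (preim X' f' V) s"] V sh by simp
  moreover have "stalk_map X' X'.k (pt h x) \<alpha> = germ X' (pt h x) (preim X' f' V) s"
    using X'.km.stalk_map_germ[OF hx, of V s] V fh by simp
  moreover have "stalk_map X h x (germ X' (pt h x) (preim X' f' V) s)
      = germ X x (preim X f V) (shm h (preim X' f' V) s)"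
    using h.stalk_map_germ[OF x o, of s] V hx fh unfolding preim_over by simp
  ultimately show ?thesis by simp
qed

text \<open>Contract the maximal ideal at \<open>x\<close> along the two sides of the commuting
  square; locality of \<open>h\<close> turns it into the maximal ideal at the image of
  \<open>x\<close>.\<close>

lemma loc_map_u_c:
  assumes x: "x \<in> points X"
  shows "pt (loc_map A MA X'.A u) (c x) = X'.c (pt h x)"
proof -
  have y: "pt f x \<in> points Y" and hx: "pt h x \<in> points X'" and fh: "pt f' (pt h x) = pt f x"
    using pt_closed[OF x] h.pt_closed[OF x] over_pt[OF x] by auto
  let ?R = "stalk X'.A (pt f x)" and ?m = "max_ideal (stalk X x)"
  have "contraction ?R (stalk_map A u (pt f x)) (contraction (stalk A (pt f x)) (stalk_map X k x) ?m)
      = contraction ?R (\<lambda>\<alpha>. stalk_map X k x (stalk_map A u (pt f x) \<alpha>)) ?m"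
    using ring_hom_closed[OF um.stalk_map_hom[of "pt f x"]] y
    by (intro contraction_comp[symmetric]) simp_all
  also have "\<dots> = contraction ?R (stalk_map X' X'.k (pt h x)) (contraction (stalk X' (pt h x)) (stalk_map X h x) ?m)"
    using stalk_map_k_u[OF x] ring_hom_closed[OF X'.km.stalk_map_hom[OF hx]] fh
    by (intro contraction_comp) simp_all
  also have "contraction (stalk X' (pt h x)) (stalk_map X h x) ?m = max_ideal (stalk X' (pt h x))"
    using h x by (simp add: lrs_morphism_def local_hom_def)
  finally show ?thesis by (simp add: c_eq X'.c_eq u.pt_loc_map fh)
qed

text \<open>The values on both sides are computed with \<open>\<delta>\<close>. If \<beta> over
  \<gamma> represents the germ of \<open>a\<close> on \<open>X'\<close>, then the images of \<beta>
  and \<gamma> under \<open>u\<close> form a valid pair for the germ of the pullback of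
  \<open>a\<close> to \<open>X\<close>.\<close>

lemma D_natural:
  "rs_eq (loc A MA) X' (rs_comp X h cmp.D) (rs_comp (loc X'.A X'.MA) X'.cmp.D (loc_map A MA X'.A u))"
  unfolding rs_eq_def
proof (intro conjI ballI allI impI)
  let ?l = "loc_map A MA X'.A u" and ?S' = "loc X'.A X'.MA"
  have pts: "pt X'.cmp.D (pt ?l (c x)) = pt h x" if "x \<in> points X" for x
    using loc_map_u_c[OF that] X'.cmp.pt_D_c[OF h.pt_closed[OF that]] by simp
  show "pt (rs_comp X h cmp.D) w = pt (rs_comp ?S' X'.cmp.D ?l) w" if w: "w \<in> points (loc A MA)" for w
  proof -
    obtain x where x: "x \<in> points X" "w = c x" by (rule cmp.loc_points_cases[OF w])
    show ?thesis unfolding x(2) using pts[OF x(1)] cmp.pt_D_c[OF x(1)] by (simp add: rs_comp_def)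
  qed
  fix U a assume U: "open_in X' U" and a: "a \<in> carrier (sec X' U)"
  have oP: "open_in X (preim X h U)" by (rule h.preim_open[OF U])
  have pre: "preim (loc A MA) ?l (preim ?S' X'.cmp.D U) = c ` preim X h U"
  proof (intro equalityI subsetI)
    fix w assume w: "w \<in> preim (loc A MA) ?l (preim ?S' X'.cmp.D U)"
    then have "w \<in> points (loc A MA)" by simp
    then obtain x where x: "x \<in> points X" "w = c x" by (rule cmp.loc_points_cases)
    have "pt h x \<in> U" using w pts[OF x(1)] unfolding x(2) by simp
    then show "w \<in> c ` preim X h U" using x by auto
  next
    fix w assume "w \<in> c ` preim X h U"
    then obtain x where x: "x \<in> points X" "pt h x \<in> U" "w = c x" by auto
    then show "w \<in> preim (loc A MA) ?l (preim ?S' X'.cmp.D U)"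
      using pts[OF x(1)] cmp.c_closed[OF x(1)] u.pt_loc_map_closed by simp
  qed
  let ?s = "shm X'.cmp.D U a"
  have "shm cmp.D (preim X h U) (shm h U a) = restrict (shm ?l (preim ?S' X'.cmp.D U) ?s) (c ` preim X h U)"
  proof (rule cmp.shm_D_pointwise[OF oP])
    fix x assume x: "x \<in> preim X h U"
    then have xX: "x \<in> points X" and hU: "pt h x \<in> U" by simp_all
    have y: "pt f x \<in> points Y" and hx: "pt h x \<in> points X'" and fh: "pt f' (pt h x) = pt f x"
      using pt_closed[OF xX] h.pt_closed[OF xX] over_pt[OF xX] by auto
    let ?y = "pt f x" and ?p = "contraction (stalk A (pt f x)) (stalk_map X k x) (max_ideal (stalk X x))"
    let ?R = "stalk X'.A ?y" and ?p' = "contraction (stalk X'.A ?y) (stalk_map X' X'.k (pt h x)) (max_ideal (stalk X' (pt h x)))"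
    interpret uh: ring_hom_cring ?R "stalk A ?y" "stalk_map A u ?y"
      using um.stalk_map_ring_hom_cring[of ?y] y by simp
    interpret hh: ring_hom_cring "stalk X' (pt h x)" "stalk X x" "stalk_map X h x"
      by (rule h.stalk_map_ring_hom_cring[OF xX])
    interpret kh: ring_hom_cring ?R "stalk X' (pt h x)" "stalk_map X' X'.k (pt h x)"
      using X'.km.stalk_map_ring_hom_cring[OF hx] fh by simp
    interpret pl: prime_localization "stalk A ?y" ?p using cmp.prime_loc[OF xX] by simp
    have cp: "contraction ?R (stalk_map A u ?y) ?p = ?p'"
      using loc_map_u_c[OF xX] by (simp add: c_eq X'.c_eq u.pt_loc_map fh)
    have ga: "germ X' (pt h x) U a \<in> carrier (stalk X' (pt h x))" by (rule X'.src.germ_closed[OF U hU a])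
    obtain \<beta> \<gamma> where b: "\<beta> \<in> carrier ?R" "\<gamma> \<in> carrier ?R - ?p'"
      "stalk_map X' X'.k (pt h x) \<gamma> \<otimes>\<^bsub>stalk X' (pt h x)\<^esub> germ X' (pt h x) U a = stalk_map X' X'.k (pt h x) \<beta>"
      using X'.cmp.fraction_exists[OF hx ga] fh by auto
    have sval: "?s (X'.c (pt h x)) = fraction ?R ?p' \<beta> \<gamma>"
      using X'.cmp.shm_D[OF U hU, of a] X'.cmp.\<delta>_eq[OF hx ga, of \<beta> \<gamma>] b fh by simp
    have \<gamma>: "\<gamma> \<in> carrier ?R" "stalk_map A u ?y \<gamma> \<notin> ?p"
      using b(2) unfolding cp[symmetric] by (auto simp: contraction_def)
    have "c x \<in> preim (loc A MA) ?l (preim ?S' X'.cmp.D U)" unfolding pre using x by blast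
    then have "shm ?l (preim ?S' X'.cmp.D U) ?s (c x)
        = localize_hom (stalk A ?y) ?p (stalk_map A u ?y) (?s (X'.c (pt h x)))"
      using loc_map_u_c[OF xX] unfolding c_eq by (simp add: u.shm_loc_map)
    also have "\<dots> = fraction (stalk A ?y) ?p (stalk_map A u ?y \<beta>) (stalk_map A u ?y \<gamma>)"
      unfolding sval
      using localize_hom_fraction[OF uh.R.is_cring uh.S.is_cring uh.homh pl.prime b(1) \<gamma>] unfolding cp .
    also have "\<dots> = cmp.\<delta> x (germ X x (preim X h U) (shm h U a))"
    proof -
      have hg: "stalk_map X h x (germ X' (pt h x) U a) = germ X x (preim X h U) (shm h U a)"
        by (rule h.stalk_map_germ[OF xX U hU a])
      have gx: "germ X x (preim X h U) (shm h U a) \<in> carrier (stalk X x)"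
        by (rule src.germ_closed[OF oP x h.shm_closed[OF U a]])
      have "stalk_map X k x (stalk_map A u ?y \<gamma>) \<otimes>\<^bsub>stalk X x\<^esub> germ X x (preim X h U) (shm h U a)
          = stalk_map X h x (stalk_map X' X'.k (pt h x) \<gamma>) \<otimes>\<^bsub>stalk X x\<^esub> stalk_map X h x (germ X' (pt h x) U a)"
        using stalk_map_k_u[OF xX \<gamma>(1)] hg by simp
      also have "\<dots> = stalk_map X h x (stalk_map X' X'.k (pt h x) \<beta>)"
        using \<gamma>(1) ga b(3) hh.hom_mult[of "stalk_map X' X'.k (pt h x) \<gamma>" "germ X' (pt h x) U a"] by simp
      also have "\<dots> = stalk_map X k x (stalk_map A u ?y \<beta>)" using stalk_map_k_u[OF xX b(1)] by simp
      finally show ?thesis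
        using cmp.\<delta>_eq[OF xX gx, of "stalk_map A u ?y \<beta>" "stalk_map A u ?y \<gamma>"] b(1) \<gamma> by simp
    qed
    finally show "cmp.\<delta> x (germ X x (preim X h U) (shm h U a)) = shm ?l (preim ?S' X'.cmp.D U) ?s (c x)"
      by (rule sym)
  qed
  also have "\<dots> = shm ?l (preim ?S' X'.cmp.D U) ?s"
    using u.shm_loc_map_extensional[of "preim ?S' X'.cmp.D U" ?s] unfolding pre by (simp add: extensional_restrict)
  finally show "shm (rs_comp X h cmp.D) U a = shm (rs_comp ?S' X'.cmp.D ?l) U a"
    by (simp add: rs_comp_def)
qed

lemma comparison_natural:
  "rs_eq X (Spec_direct_image X' Y f') (rs_comp X' (comparison X' Y f') h)
    (rs_comp (Spec_direct_image X Y f) (Spec_direct_image_map X Y f X' f' h) (comparison X Y f))"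
proof -
  let ?S = "loc A MA" and ?S' = "loc X'.A X'.MA" and ?l = "loc_map A MA X'.A u"
  let ?C = "comparison X Y f" and ?C' = "comparison X' Y f'"
  have S: "Spec_direct_image X Y f = ?S" "Spec_direct_image X' Y f' = ?S'"
    by (rule Spec_direct_image_eq, rule X'.Spec_direct_image_eq)
  have l: "Spec_direct_image_map X Y f X' f' h = ?l"
    by (simp add: Spec_direct_image_map_def rel_spec_map_def)
  have lm: "rs_morphism ?S ?S' ?l"
    by (rule u.loc_map_morphism[OF cmp.tr.ringed_target X'.cmp.tr.ringed_target])
  have C: "rs_morphism X ?S ?C" using comparison_lrs_morphism by (simp add: lrs_morphism_def)
  have C': "rs_morphism X' ?S' ?C'" using X'.comparison_lrs_morphism by (simp add: lrs_morphism_def)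
  have lC: "rs_morphism X ?S' (rs_comp ?S ?l ?C)" by (rule rs_morphism_comp[OF C lm])
  have DC: "rs_eq X X (rs_comp ?S cmp.D ?C) rs_id"
    using comparison_inverse by (simp add: inverse_rs_maps_def)
  have CD': "rs_eq ?S' ?S' (rs_comp X' ?C' X'.cmp.D) rs_id"
    using X'.comparison_inverse by (simp add: inverse_rs_maps_def)
  \<comment> \<open>Writing D' for \<open>X'.cmp.D\<close>: h = h D C = D' l C by naturality of D,
    and composing with C' on the left gives C' h = C' D' l C = l C.\<close>
  have "rs_eq X X' h (rs_comp X h rs_id)" by (rule rs_eq_sym[OF rs_comp_id_right])
  also have "rs_eq X X' \<dots> (rs_comp X h (rs_comp ?S cmp.D ?C))"
    by (rule rs_comp_cong_right[OF h.mor rs_eq_sym[OF DC]])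
  also (rs_eq_trans) have "rs_eq X X' \<dots> (rs_comp ?S (rs_comp X h cmp.D) ?C)"
    by (rule rs_comp_assoc[OF cmp.tr.D_morphism])
  also (rs_eq_trans) have "rs_eq X X' \<dots> (rs_comp ?S (rs_comp ?S' X'.cmp.D ?l) ?C)"
    by (rule rs_comp_cong_left[OF C D_natural])
  also (rs_eq_trans) have "rs_eq X X' \<dots> (rs_comp ?S' X'.cmp.D (rs_comp ?S ?l ?C))"
    by (rule rs_eq_sym[OF rs_comp_assoc[OF lm]])
  finally (rs_eq_trans) have hD: "rs_eq X X' h (rs_comp ?S' X'.cmp.D (rs_comp ?S ?l ?C))" .
  have "rs_eq X ?S' (rs_comp X' ?C' h) (rs_comp X' ?C' (rs_comp ?S' X'.cmp.D (rs_comp ?S ?l ?C)))"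
    by (rule rs_comp_cong_right[OF C' hD])
  also have "rs_eq X ?S' \<dots> (rs_comp ?S' (rs_comp X' ?C' X'.cmp.D) (rs_comp ?S ?l ?C))"
    by (rule rs_comp_assoc[OF X'.cmp.tr.D_morphism])
  also (rs_eq_trans) have "rs_eq X ?S' \<dots> (rs_comp ?S' rs_id (rs_comp ?S ?l ?C))"
    by (rule rs_comp_cong_left[OF lC CD'])
  also (rs_eq_trans) have "rs_eq X ?S' \<dots> (rs_comp ?S ?l ?C)"
    by (rule rs_comp_id_left[OF lC])
  finally (rs_eq_trans) show ?thesis unfolding S l .
qed

end

lemma affine_morI: "affine_morphism X Y f \<Longrightarrow> affine_mor X Y f"
  by (simp add: affine_mor_def affine_mor_axioms_def lrs_mor_def affine_morphism_def)

theorem lemma13: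
  fixes X :: "('a, 'b) rspace" and Y :: "('c, 'd) rspace" and f :: "('a, 'b, 'c, 'd) rs_map"
  assumes "scheme X" and "scheme Y" and "affine_morphism X Y f"
  shows "lrs_over_iso Y X f (Spec_direct_image X Y f) (Spec_direct_image_struct X Y f)
           (comparison X Y f) \<and>
         (\<forall>(X' :: ('e, 'g) rspace) f' h.
            scheme X' \<and> affine_morphism X' Y f' \<and> lrs_over_morphism Y X f X' f' h \<longrightarrow>
            rs_eq X (Spec_direct_image X' Y f')
              (rs_comp X' (comparison X' Y f') h)
              (rs_comp (Spec_direct_image X Y f)
                 (Spec_direct_image_map X Y f X' f' h) (comparison X Y f)))"
proof (intro conjI allI impI)
  interpret affine_mor X Y f by (rule affine_morI[OF assms(3)])
  show "lrs_over_iso Y X f (Spec_direct_image X Y f) (Spec_direct_image_struct X Y f) (comparison X Y f)"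
    by (rule comparison_iso)
next
  fix X' :: "('e, 'g) rspace" and f' h
  assume "scheme X' \<and> affine_morphism X' Y f' \<and> lrs_over_morphism Y X f X' f' h"
  then have a: "affine_morphism X' Y f'" and h: "lrs_morphism X X' h" "rs_eq X Y (rs_comp X' f' h) f"
    by (simp_all add: lrs_over_morphism_def)
  interpret affine_mor_over X Y f X' f' h
    by (intro affine_mor_over.intro affine_mor_over_axioms.intro affine_morI assms(3) a h)
  show "rs_eq X (Spec_direct_image X' Y f') (rs_comp X' (comparison X' Y f') h)
      (rs_comp (Spec_direct_image X Y f) (Spec_direct_image_map X Y f X' f' h) (comparison X Y f))"
    by (rule comparison_natural)
qed

end
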